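(* Let $d\ge 1$ and $\ell\ge 2$ be integers, let $A\in GL_d(\mathbb R)$ have spectral radius $\rho(A)<1$, and suppose $|\det(A)|>1/\ell$. If $\phi\in C^r(\mathbb S^1,\mathbb R^d)$ with $r\ge (d+3)/2$ satisfies the derivative dispersion condition $\mathbf D$, then the SRB measure $\mu_\phi$ of $T(x,y)=(\ell x,\,Ay+\phi(x))$ is absolutely continuous with respect to the Lebesgue measure on $\mathbb S^1\times\mathbb R^d$.
   Context: Setting. $\mathbb S^1=\mathbb R/\mathbb Z$; $r\ge 2$ throughout; $\tau(x)=\ell x \pmod 1$; $T:\mathbb S^1\times\mathbb R^d\to\mathbb S^1\times\mathbb R^d$, $T(x,y)=(\tau(x),Ay+\phi(x))$. $\|\cdot\|$ is the Euclidean norm or the associated operator norm; $A^T$ is the transpose. Words. $\mathcal A=\{1,\dots,\ell\}$; $\mathcal A^n$ is the set of words of length $n$, $\mathcal A^\infty=\mathcal A^{\mathbb N}$. $\mathcal P(k)=[(k-1)/\ell,k/\ell)$ for $1\le k\le \ell$, and $\mathcal P(\mathbf a)=\bigcap_{j=0}^{n-1}\tau^{-j}(\mathcal P(a_{n-j}))$ for $\mathbf a=(a_1,\dots,a_n)$. $[\mathbf a]_j$ is the prefix of length $j$ of $\mathbf a$. $\tau_{\mathbf a}^{-j}(x)$ is the unique point of $\mathcal P([\mathbf a]_j)$ with $\tau^j(\tau_{\mathbf a}^{-j}(x))=x$. Graph functions. For $\mathbf a$ of length $n$ with $1\le n\le\infty$, $S(x,\mathbf a)=\sum_{j=1}^{n}A^{j-1}\phi(\tau_{\mathbf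 a}^{-j}(x))$. SRB measure. $T$ has a unique SRB measure $\mu_\phi$; it equals $\Psi_*(m\times\nu)$, where $\Psi(x,\mathbf a)=(x,S(x,\mathbf a))$ on $\mathbb S^1\times\mathcal A^\infty$, $m$ is Lebesgue measure on $\mathbb S^1$ and $\nu$ is the Bernoulli measure on $\mathcal A^\infty$ with equal weights $1/\ell$. Derivative dispersion. Fix $\kappa>0$ with $\phi\in\mathcal U_\kappa=\{\phi\in C^r(\mathbb S^1,\mathbb R^d):\max_{0\le k\le r}\sup_x\|\phi^{(k)}(x)\|\le\kappa\}$ and set $\alpha=\kappa\sum_{i\ge0}\|A^i\|$ (the validity of condition $\mathbf D$ below does not depend on the choice of $\kappa$). For $\mathbf c\in\mathcal A^p$, $\mathcal P_*(\mathbf c)$ is the union of $\mathcal P(\mathbf c)$ and the two adjacent intervals of the same generation; $S_{\mathbf c}(\cdot,\mathbf a):\mathcal P_*(\mathbf c)\to\mathbb R^d$ is the natural $C^r$ extension of $S(\cdot,\mathbf a)|_{\mathcal P(\mathbf c)}$, obtained by continuing each inverse branch $\tau_{\mathbf a}^{-j}$ continuously (as an affine map) from $\mathcal P(\mathbf c)$ to $\mathcal P_*(\mathbf c)$; $S'_{\mathbf c}$ is its $x$-derivative. For $(\xi,\eta)\in\mathbb Z\times\mathbb R^d$ let $$B^q_{\mathbf c}(\xi,\eta)=\{\mathbf a\in\mathcal A^q:\exists x\in\mathcal P_*(\mathbf c),\ |\xi+\eta\cdot S'_{\mathbf c}(x,\mathbf a)|<2\alpha\ell^{-q}\|(A^q)^T\eta\|\}.$$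 Set $M(p,q)=\max_{\mathbf c\in\mathcal A^p}\sup_{(\xi,\eta)}\#B^q_{\mathbf c}(\xi,\eta)$ and $M(q)=\lim_{p\to\infty}M(p,q)=\inf_{p\ge1}M(p,q)$. The function $\phi$ satisfies condition $\mathbf D_\beta$ ($\beta>0$) if $\limsup_{q\to\infty}\frac1q\log M(q)<\beta$, and satisfies the derivative dispersion condition $\mathbf D$ if it satisfies $\mathbf D_\beta$ for every $\beta>0$. *)

theory Defs
  imports "HOL-Probability.Probability"
begin

(* The circle R/Z is represented by its fundamental domain [0,1).  Functions on the circle
   are 1-periodic functions on the real line, so that their regularity is that of the lift. *)

section \<open>Matrices\<close>

definition matrix_pow :: "real ^ 'd ^ 'd \<Rightarrow> nat \<Rightarrow> real ^ 'd ^ 'd" where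
  "matrix_pow A n = (((**) A) ^^ n) (mat 1)"

definition opnorm :: "real ^ 'd ^ 'd \<Rightarrow> real" where
  "opnorm A = onorm ((*v) A)"

definition complex_eigenvalues :: "real ^ 'd ^ 'd \<Rightarrow> complex set" where
  "complex_eigenvalues A =
     {c. \<exists>v :: complex ^ 'd. v \<noteq> 0 \<and> (\<chi> i j. complex_of_real (A $ i $ j)) *v v = c *s v}"

definition spectral_radius :: "real ^ 'd ^ 'd \<Rightarrow> real" where
  "spectral_radius A = Sup (cmod ` complex_eigenvalues A)"

section \<open>Functions of class $C^r$ on the circle\<close>

definition nth_vderiv :: "nat \<Rightarrow> (real \<Rightarrow> 'v :: real_normed_vector) \<Rightarrow> real \<Rightarrow> 'v" where
  "nth_vderiv k f = ((\<lambda>g x. vector_derivative g (at x)) ^^ k) f"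

definition Cr_circle :: "nat \<Rightarrow> (real \<Rightarrow> 'v :: real_normed_vector) set" where
  "Cr_circle r = {f. (\<forall>x. f (x + 1) = f x) \<and>
     (\<forall>k<r. \<forall>x. nth_vderiv k f differentiable (at x)) \<and>
     (\<forall>k\<le>r. continuous_on UNIV (nth_vderiv k f))}"

definition U_kappa :: "nat \<Rightarrow> real \<Rightarrow> (real \<Rightarrow> 'v :: real_normed_vector) set" where
  "U_kappa r \<kappa> = {f \<in> Cr_circle r. \<forall>k\<le>r. \<forall>x. norm (nth_vderiv k f x) \<le> \<kappa>}"

section \<open>The skew product and its SRB measure\<close>

definition tau :: "nat \<Rightarrow> real \<Rightarrow> real" where
  "tau l x = frac (real l * x)"

definition T_map :: "nat \<Rightarrow> real ^ 'd ^ 'd \<Rightarrow> (real \<Rightarrow> real ^ 'd)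
    \<Rightarrow> real \<times> (real ^ 'd) \<Rightarrow> real \<times> (real ^ 'd)" where
  "T_map l A \<phi> = (\<lambda>(x, y). (tau l x, A *v y + \<phi> x))"

definition lebesgue_cyl :: "(real \<times> (real ^ 'd)) measure" where
  "lebesgue_cyl = restrict_space lborel {0..<1} \<Otimes>\<^sub>M lborel"

text \<open>Bounded continuous functions on $(R/Z) \times R^d$.\<close>

definition test_functions :: "(real \<times> (real ^ 'd) \<Rightarrow> real) set" where
  "test_functions = {f. continuous_on UNIV f \<and> bounded (range f) \<and>
     (\<forall>x y. f (x + 1, y) = f (x, y))}"

text \<open>The points whose empirical measures converge weakly to \<open>\<mu>\<close>.\<close>

definition basin ::
  "(real \<times> (real ^ 'd) \<Rightarrow> real \<times> (real ^ 'd)) \<Rightarrow> (real \<times> (real ^ 'd)) measure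
    \<Rightarrow> (real \<times> (real ^ 'd)) set" where
  "basin T \<mu> = {z \<in> space lebesgue_cyl. \<forall>f \<in> test_functions.
     (\<lambda>n. (\<Sum>i<n. f ((T ^^ i) z)) / real n) \<longlonglongrightarrow> (\<integral>w. f w \<partial>\<mu>)}"

text \<open>An SRB (physical) measure is an invariant Borel probability measure whose basin has
  positive Lebesgue measure.\<close>

definition SRB_measure ::
  "(real \<times> (real ^ 'd) \<Rightarrow> real \<times> (real ^ 'd)) \<Rightarrow> (real \<times> (real ^ 'd)) measure \<Rightarrow> bool" where
  "SRB_measure T \<mu> \<longleftrightarrow>
     sets \<mu> = sets lebesgue_cyl \<and> prob_space \<mu> \<and> distr \<mu> \<mu> T = \<mu> \<and>
     emeasure lebesgue_cyl (basin T \<mu>) > 0"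

section \<open>Words, partitions and inverse branches\<close>

definition words :: "nat \<Rightarrow> nat \<Rightarrow> nat list set" where
  "words l n = {a. length a = n \<and> set a \<subseteq> {1..l}}"

definition cell1 :: "nat \<Rightarrow> nat \<Rightarrow> real set" where
  "cell1 l k = {(real k - 1) / real l ..< real k / real l}"

text \<open>With lists indexed from 0, the letter $a_{n-j}$ is the list entry \<open>a ! (n - 1 - j)\<close>.\<close>

definition cell :: "nat \<Rightarrow> nat list \<Rightarrow> real set" where
  "cell l a = {x \<in> {0..<1}. \<forall>j<length a. (tau l ^^ j) x \<in> cell1 l (a ! (length a - 1 - j))}"

definition inv_branch :: "nat \<Rightarrow> nat list \<Rightarrow> nat \<Rightarrow> real \<Rightarrow> real" where
  "inv_branch l a j x = (THE y. y \<in> cell l (take j a) \<and> (tau l ^^ j) y = x)"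

text \<open>For \<open>c\<close> of length \<open>p\<close>, \<open>cell l c\<close> is an interval \<open>[u, u + l\<^sup>-\<^sup>p)\<close>.  Its union with the two
  adjacent intervals of the same length is an arc of the circle; \<open>cell_star\<close> is the lift of this
  arc to the real line that contains \<open>cell l c\<close>, and may leave \<open>[0,1)\<close>.
  (For \<open>l\<^sup>p = 2\<close> the two neighbours are the same arc, which is then lifted on both sides.)\<close>

definition left_end :: "nat \<Rightarrow> nat list \<Rightarrow> real" where
  "left_end l c = Inf (cell l c)"

definition cell_star :: "nat \<Rightarrow> nat list \<Rightarrow> real set" where
  "cell_star l c =
     {left_end l c - 1 / real l ^ length c ..< left_end l c + 2 / real l ^ length c}"

text \<open>The \<open>j\<close>-th inverse branch is affine with slope \<open>l\<^sup>-\<^sup>j\<close> on \<open>cell l c\<close>; \<open>inv_branch_ext\<close> is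
  its affine continuation to the real line.\<close>

definition inv_branch_ext :: "nat \<Rightarrow> nat list \<Rightarrow> nat list \<Rightarrow> nat \<Rightarrow> real \<Rightarrow> real" where
  "inv_branch_ext l c a j x =
     inv_branch l a j (left_end l c) + (x - left_end l c) / real l ^ j"

definition S_ext :: "nat \<Rightarrow> real ^ 'd ^ 'd \<Rightarrow> (real \<Rightarrow> real ^ 'd) \<Rightarrow> nat list \<Rightarrow> nat list
    \<Rightarrow> real \<Rightarrow> real ^ 'd" where
  "S_ext l A \<phi> c a x =
     (\<Sum>j = 1..length a. matrix_pow A (j - 1) *v \<phi> (inv_branch_ext l c a j x))"

definition S_ext_deriv :: "nat \<Rightarrow> real ^ 'd ^ 'd \<Rightarrow> (real \<Rightarrow> real ^ 'd) \<Rightarrow> nat list \<Rightarrow> nat list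
    \<Rightarrow> real \<Rightarrow> real ^ 'd" where
  "S_ext_deriv l A \<phi> c a x = vector_derivative (S_ext l A \<phi> c a) (at x)"

section \<open>Derivative dispersion\<close>

definition alpha :: "real ^ 'd ^ 'd \<Rightarrow> real \<Rightarrow> real" where
  "alpha A \<kappa> = \<kappa> * (\<Sum>i. opnorm (matrix_pow A i))"

definition bad_words :: "nat \<Rightarrow> real ^ 'd ^ 'd \<Rightarrow> (real \<Rightarrow> real ^ 'd) \<Rightarrow> real \<Rightarrow> nat \<Rightarrow> nat list
    \<Rightarrow> int \<Rightarrow> real ^ 'd \<Rightarrow> nat list set" where
  "bad_words l A \<phi> \<kappa> q c \<xi> \<eta> = {a \<in> words l q. \<exists>x \<in> cell_star l c.
     \<bar>real_of_int \<xi> + \<eta> \<bullet> S_ext_deriv l A \<phi> c a x\<bar>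
       < 2 * alpha A \<kappa> / real l ^ q * norm (transpose (matrix_pow A q) *v \<eta>)}"

text \<open>All cardinalities are at most \<open>l\<^sup>q\<close>, so the suprema below are over bounded sets of naturals.\<close>

definition M_pq :: "nat \<Rightarrow> real ^ 'd ^ 'd \<Rightarrow> (real \<Rightarrow> real ^ 'd) \<Rightarrow> real \<Rightarrow> nat \<Rightarrow> nat \<Rightarrow> nat" where
  "M_pq l A \<phi> \<kappa> p q =
     Max ((\<lambda>c. SUP (\<xi>, \<eta>)\<in>UNIV. card (bad_words l A \<phi> \<kappa> q c \<xi> \<eta>)) ` words l p)"

definition M_q :: "nat \<Rightarrow> real ^ 'd ^ 'd \<Rightarrow> (real \<Rightarrow> real ^ 'd) \<Rightarrow> real \<Rightarrow> nat \<Rightarrow> nat" where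
  "M_q l A \<phi> \<kappa> q = (INF p\<in>{1..}. M_pq l A \<phi> \<kappa> p q)"

definition cond_D_beta :: "nat \<Rightarrow> real ^ 'd ^ 'd \<Rightarrow> (real \<Rightarrow> real ^ 'd) \<Rightarrow> real \<Rightarrow> real \<Rightarrow> bool" where
  "cond_D_beta l A \<phi> \<kappa> \<beta> \<longleftrightarrow>
     limsup (\<lambda>q. ereal (ln (real (M_q l A \<phi> \<kappa> q)) / real q)) < ereal \<beta>"

definition derivative_dispersion ::
    "nat \<Rightarrow> real ^ 'd ^ 'd \<Rightarrow> (real \<Rightarrow> real ^ 'd) \<Rightarrow> real \<Rightarrow> bool" where
  "derivative_dispersion l A \<phi> \<kappa> \<longleftrightarrow> (\<forall>\<beta>>0. cond_D_beta l A \<phi> \<kappa> \<beta>)"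

end

theory Submission
  imports Defs "HOL-Complex_Analysis.Cauchy_Integral_Formula"
begin

text \<open>The physical measure \<open>\<mu>\<close> is compared with the forward images of \<open>dx\<close> times a Gaussian in the fibre.
  For points \<open>z\<close> in a bounded part of the basin the Birkhoff averages of a test function \<open>f\<close> tend to
  \<open>\<integral> f d\<mu>\<close>.  The Gaussian density is bounded below there, so Fatou's lemma bounds \<open>\<integral> f d\<mu>\<close> by a
  constant times any common bound for the integrals of \<open>f \<ge> 0\<close> against these images
  (\<open>SRB_integral_bound\<close>).  A uniform bound for the \<open>L\<^sup>2\<close> norms of their densities thus gives
  \<open>\<integral> f d\<mu> \<le> const (t \<integral> f\<^sup>2 + 1/t)\<close> for every \<open>t > 0\<close>; applied to functions decreasing to
  the indicator of a compact Lebesgue null set it shows that \<open>\<mu>\<close> does not charge that set.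

  Over a base point \<open>x\<close> the \<open>n\<close>-th image is the average, over the \<open>l^n\<close> inverse branches, of Gaussians
  of shape \<open>A^n\<close> centred at the values of the graph functions.  If the word is coded by an integer
  \<open>N < l^n\<close>, then all these values are \<open>s\<^sub>n(x + N)\<close> for the single function
  \<open>s\<^sub>n(t) = \<Sum>j<n. A^j \<phi>(t / l^(j+1))\<close>.  The Plancherel identity for mixtures of Gaussians rewrites
  the square of the \<open>L\<^sup>2\<close> norm, up to a constant, as
  \<open>energy n = \<integral> gauss((A^n)\<^sup>T \<eta>) D\<^sub>n(\<eta>) d\<eta>\<close>, where \<open>D\<^sub>n(\<eta>)\<close> is the integral over \<open>x \<in> [0,1]\<close> of
  \<open>|l^(-n) (\<Sum>N<l^n. e(\<eta> \<bullet> s\<^sub>n(x + N)))|\<^sup>2\<close> with \<open>e(t) = exp(2\<pi>it)\<close> (\<open>push_density_energy\<close>).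

  The heart of the proof is the inequality (\<open>fibre_energy_recursion\<close>)
  \<open>D\<^sub>q\<^sub>+\<^sub>n(\<eta>) \<le> c M(q) l^(-q) D\<^sub>n((A^q)\<^sup>T \<eta>) + C |\<eta>|^(-2(r-1))\<close>
  with \<open>c\<close> depending on \<open>r\<close> only and \<open>C\<close> independent of \<open>n\<close>.  The last term is integrable at infinity
  because \<open>2(r - 1) \<ge> d + 1\<close>.  The substitution of \<open>(A^q)\<^sup>T \<eta>\<close> for \<open>\<eta>\<close> turns the first factor into
  \<open>c M(q) / (l |det A|)^q\<close>, and this is at most \<open>1/2\<close> for some \<open>q\<close>, since \<open>M(q)\<close> grows
  subexponentially by derivative dispersion while \<open>l |det A| > 1\<close>.  Hence the energies are bounded.

  To prove the inequality, the average of \<open>e(\<eta> \<bullet> s\<^sub>q\<^sub>+\<^sub>n(x + N))\<close> over \<open>N\<close>, as a function of \<open>x\<close>, is cut off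
  to a short arc and expanded in a Fourier series; it is a sum of \<open>l^q\<close> terms, one for each word of
  length \<open>q\<close>.  At the frequency \<open>\<xi>\<close> at most \<open>M(q)\<close> words are bad.  For them the Cauchy-Schwarz
  inequality costs a factor \<open>M(q)\<close> instead of \<open>l^q\<close>, and Bessel's inequality gives the first term.  For
  the other words the phase \<open>\<xi> x + \<eta> \<bullet> s\<^sub>q\<^sub>+\<^sub>n(x + N)\<close> has derivative at least a constant times \<open>|\<eta>|\<close>,
  whatever the continuation of the word, and \<open>r - 1\<close> integrations by parts gain the factor
  \<open>|\<eta>|^(-(r-1))\<close>.  Bounding each coefficient separately and summing squares over the roughly \<open>|\<eta>|\<close>
  relevant frequencies would lose a factor \<open>|\<eta>|\<close>, which is too much when \<open>2r = d + 3\<close>; therefore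
  \<open>oscillatory_sum\<close> estimates the sum of the squares over \<open>\<xi>\<close> directly.\<close>

section \<open>Fourier series on intervals of length at most one\<close>

text \<open>The basic character \<open>t \<mapsto> exp(2\<pi>it)\<close> of the circle \<open>\<real>/\<int>\<close>.\<close>

definition cyc :: "real \<Rightarrow> complex" where "cyc t = cis (2 * pi * t)"

lemma cyc_add: "cyc (s + t) = cyc s * cyc t"
  by (simp add: cyc_def cis_mult distrib_left)

lemma norm_cyc [simp]: "cmod (cyc t) = 1"
  by (simp add: cyc_def)

lemma cyc_0 [simp]: "cyc 0 = 1"
  by (simp add: cyc_def)

lemma cnj_cyc: "cnj (cyc t) = cyc (- t)"
  by (simp add: cyc_def cis_cnj)

lemma cyc_int [simp]: "cyc (real_of_int k) = 1"
  by (simp add: cyc_def cis_multiple_2pi)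

lemma cyc_uminus_mult: "cyc (- t) * cyc t = 1"
  by (simp flip: cyc_add)

lemma continuous_on_cyc [continuous_intros]:
  "continuous_on S f \<Longrightarrow> continuous_on S (\<lambda>x. cyc (f x))"
  unfolding cyc_def by (intro continuous_intros)

lemma cyc_has_vector_derivative:
  assumes "(f has_real_derivative f') (at x within S)"
  shows "((\<lambda>x. cyc (f x)) has_vector_derivative (2 * pi * \<i> * of_real f' * cyc (f x))) (at x within S)"
proof -
  have 1: "((\<lambda>x. 2 * pi * f x) has_vector_derivative (2 * pi * f')) (at x within S)"
    using DERIV_cmult[OF assms, of "2 * pi"] by (simp add: has_real_derivative_iff_has_vector_derivative)
  have 2: "(cis has_vector_derivative (\<i> * cis t)) (at t within T)" for t T
    unfolding has_vector_derivative_def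
    by (rule derivative_eq_intros refl | simp add: scaleR_conv_of_real)+
  have "((cis \<circ> (\<lambda>x. 2 * pi * f x)) has_vector_derivative
      ((2 * pi * f') *\<^sub>R (\<i> * cis (2 * pi * f x)))) (at x within S)"
    by (rule vector_diff_chain_within[OF 1 2])
  then show ?thesis
    by (simp add: cyc_def scaleR_conv_of_real mult_ac o_def)
qed

lemma integral_cyc:
  fixes k :: int
  shows "((\<lambda>x. cyc (real_of_int k * x)) has_integral (if k = 0 then 1 else 0)) {a..a+1}"
proof (cases "k = 0")
  case True
  then show ?thesis using has_integral_const_real[of "1::complex" a "a+1"] by simp
next
  case False
  have "((\<lambda>x. cyc (real_of_int k * x)) has_integral
     (cyc (k * (a+1)) / (2 * pi * \<i> * k) - cyc (k * a) / (2 * pi * \<i> * k))) {a..a+1}"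
  proof (rule fundamental_theorem_of_calculus)
    fix x assume "x \<in> {a..a+1}"
    have d: "((\<lambda>x. k * x) has_real_derivative k) (at x within {a..a+1})"
      by (auto intro!: derivative_eq_intros)
    have "((\<lambda>x. cyc (k * x) / (2 * pi * \<i> * k)) has_vector_derivative
       (2 * pi * \<i> * of_real (real_of_int k) * cyc (k * x)) / (2 * pi * \<i> * k)) (at x within {a..a+1})"
      by (rule has_vector_derivative_divide[OF cyc_has_vector_derivative[OF d]])
    then show "((\<lambda>x. cyc (k * x) / (2 * pi * \<i> * k)) has_vector_derivative
       cyc (k * x)) (at x within {a..a+1})"
      using False by simp
  qed simp
  moreover have "cyc (k * (a+1)) = cyc (k * a)"
    by (simp add: distrib_left cyc_add)
  ultimately show ?thesis using False by simp
qed

lemma integral_norm_trig_sum: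
  fixes X :: "int set" and c :: "int \<Rightarrow> complex"
  assumes "finite X"
  shows "((\<lambda>x. of_real ((cmod (\<Sum>\<xi>\<in>X. c \<xi> * cyc (- (\<xi> * x))))\<^sup>2) :: complex) has_integral
     of_real (\<Sum>\<xi>\<in>X. (cmod (c \<xi>))\<^sup>2)) {a..a+1}"
proof -
  have eq: "of_real ((cmod (\<Sum>\<xi>\<in>X. c \<xi> * cyc (- (\<xi> * x))))\<^sup>2)
     = (\<Sum>\<xi>\<in>X. \<Sum>\<zeta>\<in>X. c \<xi> * cnj (c \<zeta>) * cyc (real_of_int (\<zeta> - \<xi>) * x))" for x :: real
    unfolding complex_norm_square
    by (simp add: cnj_cyc sum_product mult_ac algebra_simps flip: cyc_add)
  have "((\<lambda>x. \<Sum>\<xi>\<in>X. \<Sum>\<zeta>\<in>X. c \<xi> * cnj (c \<zeta>) * cyc (real_of_int (\<zeta> - \<xi>) * x)) has_integral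
     (\<Sum>\<xi>\<in>X. \<Sum>\<zeta>\<in>X. c \<xi> * cnj (c \<zeta>) * (if \<zeta> - \<xi> = 0 then 1 else 0))) {a..a+1}"
    using assms by (intro has_integral_sum has_integral_mult_right integral_cyc)
  also have "(\<Sum>\<xi>\<in>X. \<Sum>\<zeta>\<in>X. c \<xi> * cnj (c \<zeta>) * (if \<zeta> - \<xi> = 0 then 1 else 0))
     = (\<Sum>\<xi>\<in>X. \<Sum>\<zeta>\<in>X. if \<xi> = \<zeta> then c \<xi> * cnj (c \<zeta>) else 0)"
    by (intro sum.cong) auto
  also have "\<dots> = of_real (\<Sum>\<xi>\<in>X. (cmod (c \<xi>))\<^sup>2)"
    using assms by (simp add: complex_norm_square of_real_sum del: of_real_power)
  finally show ?thesis unfolding eq .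
qed

lemma integral_norm_trig_sum_real:
  fixes X :: "int set" and c :: "int \<Rightarrow> complex"
  assumes "finite X"
  shows "integral {a..a+1} (\<lambda>x. (cmod (\<Sum>\<xi>\<in>X. c \<xi> * cyc (- (\<xi> * x))))\<^sup>2) = (\<Sum>\<xi>\<in>X. (cmod (c \<xi>))\<^sup>2)"
  using has_integral_linear[OF integral_norm_trig_sum[OF assms, of c a] bounded_linear_Re]
  by (intro integral_unique) (simp add: o_def)

text \<open>Expanding the square exhibits the distance to a trigonometric polynomial as a quadratic function
  of its coefficients; Bessel's inequality and the approximate Parseval identity both come from it.
  The characters enter conjugated, so that the Fourier coefficients are integrals against \<open>cyc (\<xi> * x)\<close>.\<close>

lemma integral_dist_trig_sum:
  fixes X :: "int set" and c :: "int \<Rightarrow> complex" and f :: "real \<Rightarrow> complex"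
  assumes "finite X" and f: "continuous_on {a..b} f"
  shows "integral {a..b} (\<lambda>x. (cmod (f x - (\<Sum>\<xi>\<in>X. c \<xi> * cyc (- (\<xi> * x)))))\<^sup>2)
    = integral {a..b} (\<lambda>x. (cmod (f x))\<^sup>2)
      - 2 * (\<Sum>\<xi>\<in>X. Re (cnj (c \<xi>) * integral {a..b} (\<lambda>x. cyc (\<xi> * x) * f x)))
      + integral {a..b} (\<lambda>x. (cmod (\<Sum>\<xi>\<in>X. c \<xi> * cyc (- (\<xi> * x))))\<^sup>2)"
proof -
  let ?P = "\<lambda>x::real. \<Sum>\<xi>\<in>X. c \<xi> * cyc (- (\<xi> * x))"
  have eq: "(cmod (f x - ?P x))\<^sup>2 = (cmod (f x))\<^sup>2
     - 2 * (\<Sum>\<xi>\<in>X. Re (cnj (c \<xi>) * (cyc (\<xi> * x) * f x))) + (cmod (?P x))\<^sup>2" for x :: real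
  proof -
    have "(cmod (z - w))\<^sup>2 = (cmod z)\<^sup>2 - 2 * Re (z * cnj w) + (cmod w)\<^sup>2" for z w
      unfolding cmod_power2 by (simp add: power2_eq_square algebra_simps)
    then have "(cmod (f x - ?P x))\<^sup>2 = (cmod (f x))\<^sup>2 - 2 * Re (f x * cnj (?P x)) + (cmod (?P x))\<^sup>2"
      by blast
    also have "f x * cnj (?P x) = (\<Sum>\<xi>\<in>X. cnj (c \<xi>) * (cyc (\<xi> * x) * f x))"
      by (simp add: cnj_cyc sum_distrib_left mult_ac)
    finally show ?thesis by simp
  qed
  have I1: "((\<lambda>x. (cmod (f x))\<^sup>2) has_integral integral {a..b} (\<lambda>x. (cmod (f x))\<^sup>2)) {a..b}"
    by (intro integrable_integral integrable_continuous_real continuous_intros f)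
  have I3: "((\<lambda>x. (cmod (?P x))\<^sup>2) has_integral integral {a..b} (\<lambda>x. (cmod (?P x))\<^sup>2)) {a..b}"
    by (intro integrable_integral integrable_continuous_real continuous_intros f)
  have I2: "((\<lambda>x. \<Sum>\<xi>\<in>X. Re (cnj (c \<xi>) * (cyc (\<xi> * x) * f x))) has_integral
     (\<Sum>\<xi>\<in>X. Re (cnj (c \<xi>) * integral {a..b} (\<lambda>x. cyc (\<xi> * x) * f x)))) {a..b}"
    using assms(1)
  proof (rule has_integral_sum)
    fix \<xi> assume "\<xi> \<in> X"
    have "((\<lambda>x. cnj (c \<xi>) * (cyc (\<xi> * x) * f x)) has_integral
       cnj (c \<xi>) * integral {a..b} (\<lambda>x. cyc (\<xi> * x) * f x)) {a..b}"
      by (intro has_integral_mult_right integrable_integral integrable_continuous_real continuous_intros f)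
    from has_integral_linear[OF this bounded_linear_Re]
    show "((\<lambda>x. Re (cnj (c \<xi>) * (cyc (\<xi> * x) * f x))) has_integral
       Re (cnj (c \<xi>) * integral {a..b} (\<lambda>x. cyc (\<xi> * x) * f x))) {a..b}"
      by (simp add: o_def)
  qed
  show ?thesis
    unfolding eq
    by (intro integral_unique has_integral_add has_integral_diff has_integral_mult_right I1 I2 I3)
qed

text \<open>The characters are orthonormal on a full period only.  On a shorter interval the norm of the
  projection can only decrease, and that is the direction required.\<close>

lemma bessel_inequality:
  fixes f :: "real \<Rightarrow> complex" and X :: "int set"
  assumes f: "continuous_on {a..b} f" and len: "b - a \<le> 1" and X: "finite X"
  shows "(\<Sum>\<xi>\<in>X. (cmod (integral {a..b} (\<lambda>x. cyc (\<xi> * x) * f x)))\<^sup>2)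
    \<le> integral {a..b} (\<lambda>x. (cmod (f x))\<^sup>2)"
proof -
  define c where "c \<xi> = integral {a..b} (\<lambda>x. cyc (real_of_int \<xi> * x) * f x)" for \<xi> :: int
  let ?P = "\<lambda>x::real. \<Sum>\<xi>\<in>X. c \<xi> * cyc (- (\<xi> * x))"
  have 0: "0 \<le> integral {a..b} (\<lambda>x. (cmod (f x - ?P x))\<^sup>2)"
    by (intro integral_nonneg integrable_continuous_real continuous_intros f) simp
  have re: "Re (cnj z * z) = (cmod z)\<^sup>2" for z
    unfolding cmod_power2 by (simp add: power2_eq_square)
  have "integral {a..b} (\<lambda>x. (cmod (?P x))\<^sup>2) \<le> integral {a..a+1} (\<lambda>x. (cmod (?P x))\<^sup>2)"
    using len by (intro integral_subset_le integrable_continuous_real continuous_intros) auto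
  with integral_norm_trig_sum_real[OF X, of a c]
  have "integral {a..b} (\<lambda>x. (cmod (?P x))\<^sup>2) \<le> (\<Sum>\<xi>\<in>X. (cmod (c \<xi>))\<^sup>2)" by simp
  with 0 show ?thesis
    unfolding integral_dist_trig_sum[OF X f] c_def[symmetric] re by simp
qed

text \<open>An inductive description, because closure under products and under real polynomials is an
  induction; the coefficients are recovered in \<open>trig_poly_expansion\<close>.\<close>

inductive trig_poly :: "(real \<Rightarrow> complex) \<Rightarrow> bool" where
  mono: "trig_poly (\<lambda>x. c * cyc (real_of_int \<xi> * x))"
| add: "trig_poly P \<Longrightarrow> trig_poly Q \<Longrightarrow> trig_poly (\<lambda>x. P x + Q x)"

lemma trig_poly_const: "trig_poly (\<lambda>x. c)"
  using mono[of c 0] by simp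

lemma trig_poly_mult:
  assumes "trig_poly P" "trig_poly Q"
  shows "trig_poly (\<lambda>x. P x * Q x)"
  using assms(1)
proof induction
  case (mono c \<xi>)
  show ?case using assms(2)
  proof induction
    case (mono d \<zeta>)
    have "(\<lambda>x::real. c * cyc (\<xi> * x) * (d * cyc (\<zeta> * x))) = (\<lambda>x. (c * d) * cyc (real_of_int (\<xi> + \<zeta>) * x))"
      by (simp add: fun_eq_iff distrib_right cyc_add)
    then show ?case using trig_poly.mono[of "c * d" "\<xi> + \<zeta>"] by simp
  next
    case (add P Q)
    from trig_poly.add[OF add.IH] show ?case by (simp add: distrib_left)
  qed
next
  case (add P Q)
  from trig_poly.add[OF add.IH] show ?case by (simp add: distrib_right)
qed

lemma trig_poly_expansion:
  assumes "trig_poly P"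
  shows "\<exists>X c. finite X \<and> P = (\<lambda>x. \<Sum>\<xi>\<in>X. c \<xi> * cyc (- (real_of_int \<xi> * x)))"
  using assms
proof induction
  case (mono c \<xi>)
  show ?case by (intro exI[of _ "{-\<xi>}"] exI[of _ "\<lambda>_. c"]) simp
next
  case (add P Q)
  then obtain X c Y d where X: "finite X" "P = (\<lambda>x. \<Sum>\<xi>\<in>X. c \<xi> * cyc (- (real_of_int \<xi> * x)))"
    and Y: "finite Y" "Q = (\<lambda>x. \<Sum>\<xi>\<in>Y. d \<xi> * cyc (- (real_of_int \<xi> * x)))" by blast
  have "(\<Sum>\<xi>\<in>X \<union> Y. ((if \<xi> \<in> X then c \<xi> else 0) + (if \<xi> \<in> Y then d \<xi> else 0)) * cyc (- (real_of_int \<xi> * x)))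
     = P x + Q x" for x
  proof -
    have "P x = (\<Sum>\<xi>\<in>X \<union> Y. (if \<xi> \<in> X then c \<xi> else 0) * cyc (- (real_of_int \<xi> * x)))"
      unfolding X(2) using X(1) Y(1) by (intro sum.mono_neutral_cong_left) auto
    moreover have "Q x = (\<Sum>\<xi>\<in>X \<union> Y. (if \<xi> \<in> Y then d \<xi> else 0) * cyc (- (real_of_int \<xi> * x)))"
      unfolding Y(2) using X(1) Y(1) by (intro sum.mono_neutral_cong_left) auto
    ultimately show ?thesis by (simp add: distrib_right sum.distrib)
  qed
  with X(1) Y(1) show ?case
    by (intro exI[of _ "X \<union> Y"] exI[of _ "\<lambda>\<xi>. (if \<xi> \<in> X then c \<xi> else 0) + (if \<xi> \<in> Y then d \<xi> else 0)"]) auto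
qed

lemma trig_poly_real_polynomial:
  assumes "real_polynomial_function g"
  shows "trig_poly (\<lambda>x. of_real (g (cyc x)))"
  using assms
proof induction
  case (linear f)
  interpret bounded_linear f by fact
  have eq: "of_real (f (cyc x)) = (of_real (f 1) / 2 + of_real (f \<i>) / (2 * \<i>)) * cyc (real_of_int 1 * x)
     + (of_real (f 1) / 2 - of_real (f \<i>) / (2 * \<i>)) * cyc (real_of_int (-1) * x)" for x
  proof -
    have "cyc x = cos (2 * pi * x) *\<^sub>R 1 + sin (2 * pi * x) *\<^sub>R \<i>"
      by (simp add: cyc_def complex_eq_iff)
    then have "f (cyc x) = cos (2 * pi * x) * f 1 + sin (2 * pi * x) * f \<i>"
      by (metis add scaleR real_scaleR_def)
    moreover have "cyc (- x) = cnj (cyc x)" by (simp add: cnj_cyc)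
    ultimately show ?thesis
      by (simp add: complex_eq_iff cyc_def field_simps)
  qed
  show ?case unfolding eq by (intro trig_poly.intros)
next
  case (add f g)
  then show ?case using trig_poly.add by simp
next
  case (mult f g)
  then show ?case using trig_poly_mult by simp
qed (auto intro: trig_poly_const)

text \<open>A continuous function with equal values at the end points of a period is a continuous function on
  the unit circle, and by Stone-Weierstrass that is a uniform limit of real polynomials in the
  coordinates, which pull back to trigonometric polynomials.\<close>

lemma trig_poly_approx_real:
  fixes f :: "real \<Rightarrow> real"
  assumes f: "continuous_on {a..a+1} f" and per: "f (a + 1) = f a" and e: "0 < e"
  shows "\<exists>P. trig_poly P \<and> (\<forall>x\<in>{a..a+1}. cmod (of_real (f x) - P x) < e)"
proof -
  have inj: "f x = f y" if xy: "x \<in> {a..a+1}" "y \<in> {a..a+1}" and eq: "cyc x = cyc y" for x y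
  proof -
    have "cyc (x - y) = 1"
      using eq cyc_uminus_mult[of y] by (simp add: cyc_add diff_conv_add_uminus mult.commute del: add_uminus_conv_diff)
    then have "cos (2 * pi * (x - y)) = 1" by (simp add: cyc_def complex_eq_iff)
    then obtain n :: int where "2 * pi * (x - y) = real_of_int n * (2 * pi)"
      unfolding cos_one_2pi_int by auto
    then have n: "x - y = n" by simp
    with xy have "\<bar>real_of_int n\<bar> \<le> 1" by auto
    then have "n = 0 \<or> n = 1 \<or> n = -1" by linarith
    then show ?thesis
    proof (elim disjE)
      assume "n = 1" with n xy have "x = a + 1" "y = a" by auto
      then show ?thesis using per by simp
    next
      assume "n = -1" with n xy have "y = a + 1" "x = a" by auto
      then show ?thesis using per by simp
    qed (use n in simp)
  qed
  have onto: "\<exists>x\<in>{a..a+1}. cyc x = z" if "z \<in> sphere 0 1" for z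
  proof -
    have "cmod z = 1" using that by simp
    then have z: "z = cyc (Arg z / (2 * pi))"
      by (metis cyc_def cis_Arg complex_norm_eq_1_exp cis_conv_exp mult.commute nonzero_divide_eq_eq norm_zero pi_neq_zero sgn_eq times_divide_eq_right zero_neq_one mult_eq_0_iff zero_neq_numeral div_by_1 of_real_1 divide_numeral_1 numeral_One nonzero_mult_div_cancel_left)
    define t where "t = Arg z / (2 * pi)"
    have "cyc (a + frac (t - a)) = cyc (t + real_of_int (- \<lfloor>t - a\<rfloor>))"
      by (simp add: frac_def algebra_simps)
    also have "\<dots> = z" unfolding cyc_add using z by (simp add: t_def del: of_int_minus)
    finally show ?thesis
      by (intro bexI[of _ "a + frac (t - a)"]) (auto intro: less_imp_le simp: frac_lt_1)
  qed
  \<comment> \<open>the function on the circle; at the common image of the end points both choices agree\<close>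
  define h where "h z = f (SOME x. x \<in> {a..a+1} \<and> cyc x = z)" for z
  have h: "h (cyc x) = f x" if "x \<in> {a..a+1}" for x
    unfolding h_def
    by (rule someI2[of "\<lambda>y. y \<in> {a..a+1} \<and> cyc y = cyc x" x, OF conjI[OF that refl]])
      (use inj that in blast)
  have "continuous_on (sphere 0 1) h"
  proof (subst continuous_on_closed_vimage[OF closed_sphere], safe)
    fix C :: "real set" assume "closed C"
    have "h -` C \<inter> sphere 0 1 = cyc ` (f -` C \<inter> {a..a+1})"
      using onto h by (fastforce simp: image_iff)
    moreover have "compact (f -` C \<inter> {a..a+1})"
    proof -
      have "closed (f -` C \<inter> {a..a+1})"
        using f \<open>closed C\<close> continuous_on_closed_vimage[of "{a..a+1}" f] by simp
      moreover have "bounded (f -` C \<inter> {a..a+1})"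
        by (rule bounded_subset[of "{a..a+1}"]) auto
      ultimately show ?thesis by (simp add: compact_eq_bounded_closed)
    qed
    ultimately show "closed (h -` C \<inter> sphere 0 1)"
      using compact_imp_closed[OF compact_continuous_image[OF continuous_on_cyc[OF continuous_on_id]]] by simp
  qed
  then obtain g where g: "real_polynomial_function g" "\<And>z. z \<in> sphere 0 1 \<Longrightarrow> \<bar>h z - g z\<bar> < e"
    using Stone_Weierstrass_real_polynomial_function[OF compact_sphere _ e, of 0 1 h] by metis
  show ?thesis
  proof (intro exI conjI ballI)
    show "trig_poly (\<lambda>x. of_real (g (cyc x)))" by (rule trig_poly_real_polynomial[OF g(1)])
    fix x assume "x \<in> {a..a+1}"
    then show "cmod (of_real (f x) - of_real (g (cyc x))) < e"
      using g(2)[of "cyc x"] h[of x] by (simp flip: of_real_diff)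
  qed
qed

lemma trig_poly_approx:
  fixes f :: "real \<Rightarrow> complex"
  assumes f: "continuous_on {a..a+1} f" and per: "f (a + 1) = f a" and e: "0 < e"
  shows "\<exists>P. trig_poly P \<and> (\<forall>x\<in>{a..a+1}. cmod (f x - P x) < e)"
proof -
  obtain P where P: "trig_poly P" "\<And>x. x\<in>{a..a+1} \<Longrightarrow> cmod (of_real (Re (f x)) - P x) < e/2"
    using trig_poly_approx_real[OF continuous_on_Re[OF f], of "e/2"] per e by force
  obtain Q where Q: "trig_poly Q" "\<And>x. x\<in>{a..a+1} \<Longrightarrow> cmod (of_real (Im (f x)) - Q x) < e/2"
    using trig_poly_approx_real[OF continuous_on_Im[OF f], of "e/2"] per e by force
  show ?thesis
  proof (intro exI conjI ballI)
    show "trig_poly (\<lambda>x. P x + \<i> * Q x)"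
      by (intro trig_poly.add trig_poly_mult trig_poly_const P Q)
    fix x assume x: "x \<in> {a..a+1}"
    have "f x - (P x + \<i> * Q x) = (of_real (Re (f x)) - P x) + \<i> * (of_real (Im (f x)) - Q x)"
      by (metis (no_types) complex_eq add_diff_add right_diff_distrib)
    also have "cmod \<dots> \<le> cmod (of_real (Re (f x)) - P x) + cmod (of_real (Im (f x)) - Q x)"
      by (rule order_trans[OF norm_triangle_ineq]) (simp add: norm_mult)
    also have "\<dots> < e" using P(2)[OF x] Q(2)[OF x] by simp
    finally show "cmod (f x - (P x + \<i> * Q x)) < e" .
  qed
qed

text \<open>A function vanishing at both end points extends by zero to a continuous periodic function, hence is
  close to some trigonometric polynomial; replacing the coefficients of the latter by the Fourier
  coefficients of \<open>f\<close> does not increase the distance.  A finite set of frequencies up to an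
  error \<open>e\<close> replaces the infinite series, so that all later sums over \<open>\<xi>\<close> are finite.\<close>

lemma parseval_approx:
  fixes f :: "real \<Rightarrow> complex"
  assumes f: "continuous_on {a..b} f" and ab: "a \<le> b" and len: "b - a \<le> 1"
    and fa: "f a = 0" and fb: "f b = 0" and e: "0 < e"
  shows "\<exists>X::int set. finite X \<and> integral {a..b} (\<lambda>x. (cmod (f x))\<^sup>2)
     \<le> (\<Sum>\<xi>\<in>X. (cmod (integral {a..b} (\<lambda>x. cyc (\<xi> * x) * f x)))\<^sup>2) + e"
proof -
  define F where "F x = (if x \<le> b then f x else 0)" for x
  have F: "continuous_on {a..a+1} F"
  proof -
    have "continuous_on ({a..b} \<union> {b..a+1}) F"
      unfolding F_def
      by (rule continuous_on_If) (use f fb in \<open>auto simp: continuous_on_const\<close>)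
    then show ?thesis using ab len by (simp add: ivl_disj_un_two_touch)
  qed
  have split: "integral {a..a+1} (\<lambda>x. k x (F x)) = integral {a..b} (\<lambda>x. k x (f x))"
    if k: "\<And>x. k x 0 = 0" "continuous_on {a..a+1} (\<lambda>x. k x (F x))" for k :: "real \<Rightarrow> complex \<Rightarrow> 'b::banach"
  proof -
    have "integral {a..a+1} (\<lambda>x. k x (F x)) = integral {a..b} (\<lambda>x. k x (F x)) + integral {b..a+1} (\<lambda>x. k x (F x))"
      using ab len k(2) by (intro Henstock_Kurzweil_Integration.integral_combine[symmetric] integrable_continuous_real) auto
    also have "integral {b..a+1} (\<lambda>x. k x (F x)) = integral {b..a+1} (\<lambda>x. 0)"
      by (intro integral_cong) (auto simp: F_def k(1) fb)
    also have "integral {a..b} (\<lambda>x. k x (F x)) = integral {a..b} (\<lambda>x. k x (f x))"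
      by (intro integral_cong) (auto simp: F_def)
    finally show ?thesis by simp
  qed
  have "F (a + 1) = F a" using fa fb ab len by (auto simp: F_def) (metis add_le_cancel_left antisym_conv diff_le_eq add.commute)
  then obtain P where P: "trig_poly P" "\<And>x. x \<in> {a..a+1} \<Longrightarrow> cmod (F x - P x) < min 1 e"
    using trig_poly_approx[OF F, of "min 1 e"] e by auto
  obtain X c where X: "finite X" and Pc: "P = (\<lambda>x. \<Sum>\<xi>\<in>X. c \<xi> * cyc (- (real_of_int \<xi> * x)))"
    using trig_poly_expansion[OF P(1)] by blast
  have "integral {a..a+1} (\<lambda>x. (cmod (F x - P x))\<^sup>2) \<le> integral {a..a+1} (\<lambda>x. e)"
  proof (rule integral_le)
    show "(\<lambda>x. (cmod (F x - P x))\<^sup>2) integrable_on {a..a+1}"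
      unfolding Pc by (intro integrable_continuous_real continuous_intros F)
    fix x assume "x \<in> {a..a+1}"
    from P(2)[OF this] have "cmod (F x - P x) < 1" "cmod (F x - P x) < e" by auto
    then have "cmod (F x - P x) * cmod (F x - P x) \<le> 1 * e"
      by (intro mult_mono) auto
    then show "(cmod (F x - P x))\<^sup>2 \<le> e" by (simp add: power2_eq_square)
  qed auto
  then have 1: "integral {a..a+1} (\<lambda>x. (cmod (F x - P x))\<^sup>2) \<le> e" by simp
  define d where "d \<xi> = integral {a..b} (\<lambda>x. cyc (real_of_int \<xi> * x) * f x)" for \<xi> :: int
  have dF: "integral {a..a+1} (\<lambda>x. cyc (real_of_int \<xi> * x) * F x) = d \<xi>" for \<xi>
    unfolding d_def by (rule split) (auto intro!: continuous_intros F)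
  have FF: "integral {a..a+1} (\<lambda>x. (cmod (F x))\<^sup>2) = integral {a..b} (\<lambda>x. (cmod (f x))\<^sup>2)"
    by (rule split[of "\<lambda>x z. (cmod z)\<^sup>2"]) (auto intro!: continuous_intros F)
  have "integral {a..b} (\<lambda>x. (cmod (f x))\<^sup>2)
     - 2 * (\<Sum>\<xi>\<in>X. Re (cnj (c \<xi>) * d \<xi>)) + (\<Sum>\<xi>\<in>X. (cmod (c \<xi>))\<^sup>2) \<le> e"
    using 1 unfolding Pc integral_dist_trig_sum[OF X F] integral_norm_trig_sum_real[OF X] dF FF .
  \<comment> \<open>completing the square: the Fourier coefficients \<open>d\<close> are the best choice\<close>
  moreover have "2 * (\<Sum>\<xi>\<in>X. Re (cnj (c \<xi>) * d \<xi>)) \<le> (\<Sum>\<xi>\<in>X. (cmod (c \<xi>))\<^sup>2) + (\<Sum>\<xi>\<in>X. (cmod (d \<xi>))\<^sup>2)"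
    unfolding sum_distrib_left sum.distrib[symmetric]
  proof (rule sum_mono)
    fix \<xi> assume "\<xi> \<in> X"
    have "0 \<le> (Re (c \<xi>) - Re (d \<xi>))\<^sup>2 + (Im (c \<xi>) - Im (d \<xi>))\<^sup>2" by simp
    then show "2 * Re (cnj (c \<xi>) * d \<xi>) \<le> (cmod (c \<xi>))\<^sup>2 + (cmod (d \<xi>))\<^sup>2"
      unfolding cmod_power2 by (simp add: power2_eq_square algebra_simps)
  qed
  ultimately show ?thesis using X by (intro exI[of _ X]) (auto simp: d_def)
qed

section \<open>Oscillatory integrals, square-summed over the frequency\<close>

text \<open>Functions on \<open>J\<close> of class \<open>C\<^sup>k\<close>, all of whose derivatives up to order \<open>k\<close> are bounded by \<open>\<Gamma>\<close> and, up to
  order \<open>k - 1\<close>, vanish on \<open>V\<close>.  With \<open>V\<close> empty these are the coefficients, and with \<open>V\<close> the set of end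
  points the amplitudes whose \<open>k\<close> integrations by parts produce no boundary terms.  The recursion
  on \<open>k\<close> makes products an induction and avoids the Leibniz formula.\<close>

primrec Ck_bounded :: "real set \<Rightarrow> real set \<Rightarrow> nat \<Rightarrow> real \<Rightarrow> (real \<Rightarrow> real) \<Rightarrow> bool" where
  "Ck_bounded J V 0 \<Gamma> w \<longleftrightarrow> continuous_on J w \<and> (\<forall>x\<in>J. \<bar>w x\<bar> \<le> \<Gamma>)"
| "Ck_bounded J V (Suc k) \<Gamma> w \<longleftrightarrow> (\<forall>x\<in>J. \<bar>w x\<bar> \<le> \<Gamma>) \<and> (\<forall>x\<in>V. w x = 0) \<and>
     (\<exists>w'. (\<forall>x\<in>J. (w has_real_derivative w' x) (at x within J)) \<and> Ck_bounded J V k \<Gamma> w')"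

lemma Ck_bounded_continuous: "Ck_bounded J V k \<Gamma> w \<Longrightarrow> continuous_on J w"
  by (cases k) (auto intro: DERIV_continuous_on)

lemma Ck_bounded_le: "Ck_bounded J V k \<Gamma> w \<Longrightarrow> x \<in> J \<Longrightarrow> \<bar>w x\<bar> \<le> \<Gamma>"
  by (cases k) auto

lemma Ck_bounded_mono: "Ck_bounded J V k \<Gamma> w \<Longrightarrow> \<Gamma> \<le> \<Gamma>' \<Longrightarrow> Ck_bounded J V k \<Gamma>' w"
proof (induction k arbitrary: w)
  case (Suc k)
  from Suc.prems obtain w' where
    "\<forall>x\<in>J. (w has_real_derivative w' x) (at x within J)" "Ck_bounded J V k \<Gamma> w'"
    by auto
  with Suc show ?case by (auto intro: order_trans)
qed (auto intro: order_trans)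

lemma Ck_bounded_Suc: "Ck_bounded J V (Suc k) \<Gamma> w \<Longrightarrow> Ck_bounded J V k \<Gamma> w"
proof (induction k arbitrary: w)
  case 0
  then show ?case by (auto intro: DERIV_continuous_on)
next
  case (Suc k)
  from Suc.prems obtain w' where
    "\<forall>x\<in>J. (w has_real_derivative w' x) (at x within J)" "Ck_bounded J V (Suc k) \<Gamma> w'"
    by (subst (asm) Ck_bounded.simps(2)) blast
  with Suc.IH[of w'] Suc.prems show ?case by (auto simp del: Ck_bounded.simps(2) simp: Ck_bounded.simps(2)[of J V k \<Gamma> w] Ck_bounded.simps(2)[of J V "Suc k" \<Gamma> w])
qed

lemma Ck_bounded_lower: "Ck_bounded J V k \<Gamma> w \<Longrightarrow> j \<le> k \<Longrightarrow> Ck_bounded J V j \<Gamma> w"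
  by (induction k) (auto simp: le_Suc_eq simp del: Ck_bounded.simps dest: Ck_bounded_Suc)

lemma Ck_bounded_add:
  "Ck_bounded J V k \<Gamma> w \<Longrightarrow> Ck_bounded J V k \<Delta> v \<Longrightarrow> Ck_bounded J V k (\<Gamma> + \<Delta>) (\<lambda>x. w x + v x)"
proof (induction k arbitrary: w v)
  case 0
  then show ?case by (auto intro!: continuous_intros) (meson abs_triangle_ineq add_mono order_trans)
next
  case (Suc k)
  from Suc.prems obtain w' v' where
    w: "\<forall>x\<in>J. (w has_real_derivative w' x) (at x within J)" "Ck_bounded J V k \<Gamma> w'" and
    v: "\<forall>x\<in>J. (v has_real_derivative v' x) (at x within J)" "Ck_bounded J V k \<Delta> v'"
    by auto
  have "\<forall>x\<in>J. ((\<lambda>x. w x + v x) has_real_derivative (w' x + v' x)) (at x within J)"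
    using w v by (auto intro!: derivative_intros)
  moreover have "\<bar>w x + v x\<bar> \<le> \<Gamma> + \<Delta>" if "x \<in> J" for x
    using Suc.prems that by (meson Ck_bounded_le abs_triangle_ineq add_mono order_trans)
  ultimately show ?case using Suc.IH[OF w(2) v(2)] Suc.prems by auto
qed

lemma Ck_bounded_cmult:
  "Ck_bounded J V k \<Gamma> w \<Longrightarrow> Ck_bounded J V k (\<bar>c\<bar> * \<Gamma>) (\<lambda>x. c * w x)"
proof (induction k arbitrary: w)
  case 0
  then show ?case by (auto intro!: continuous_intros simp: abs_mult mult_left_mono)
next
  case (Suc k)
  from Suc.prems obtain w' where
    w: "\<forall>x\<in>J. (w has_real_derivative w' x) (at x within J)" "Ck_bounded J V k \<Gamma> w'"
    by auto
  have "\<forall>x\<in>J. ((\<lambda>x. c * w x) has_real_derivative (c * w' x)) (at x within J)"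
    using w by (auto intro!: DERIV_cmult)
  with Suc.IH[OF w(2)] Suc.prems show ?case by (auto simp: abs_mult mult_left_mono)
qed

text \<open>The derivative of a product is a sum of two products of one class less, which doubles the constant
  at each order.\<close>

lemma Ck_bounded_mult:
  assumes "Ck_bounded J {} k \<Gamma> w" "Ck_bounded J V k \<Delta> v" "0 \<le> \<Gamma>" "0 \<le> \<Delta>"
  shows "Ck_bounded J V k (2 ^ k * (\<Gamma> * \<Delta>)) (\<lambda>x. w x * v x)"
  using assms(1,2)
proof (induction k arbitrary: w v)
  case 0
  then show ?case using assms(3,4) by (auto intro!: continuous_intros simp: abs_mult mult_mono)
next
  case (Suc k)
  from Suc.prems obtain w' v' where
    w: "\<forall>x\<in>J. (w has_real_derivative w' x) (at x within J)" "Ck_bounded J {} k \<Gamma> w'" and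
    v: "\<forall>x\<in>J. (v has_real_derivative v' x) (at x within J)" "Ck_bounded J V k \<Delta> v'"
    by auto
  have d: "\<forall>x\<in>J. ((\<lambda>x. w x * v x) has_real_derivative (w' x * v x + w x * v' x)) (at x within J)"
    using w v by (auto intro!: derivative_eq_intros)
  have "Ck_bounded J V k (2 ^ k * (\<Gamma> * \<Delta>) + 2 ^ k * (\<Gamma> * \<Delta>)) (\<lambda>x. w' x * v x + w x * v' x)"
    by (intro Ck_bounded_add Suc.IH w v Ck_bounded_Suc[OF Suc.prems(1)] Ck_bounded_Suc[OF Suc.prems(2)])
  moreover have "\<bar>w x * v x\<bar> \<le> 2 ^ Suc k * (\<Gamma> * \<Delta>)" if "x \<in> J" for x
  proof -
    have "\<bar>w x * v x\<bar> \<le> \<Gamma> * \<Delta>"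
      using Ck_bounded_le[OF Suc.prems(1) that] Ck_bounded_le[OF Suc.prems(2) that] assms(3)
      by (simp add: abs_mult mult_mono)
    also have "1 * (\<Gamma> * \<Delta>) \<le> 2 ^ Suc k * (\<Gamma> * \<Delta>)"
      using assms(3,4) by (intro mult_right_mono one_le_power mult_nonneg_nonneg) auto
    finally show ?thesis by simp
  qed
  moreover have "2 ^ k * (\<Gamma> * \<Delta>) + 2 ^ k * (\<Gamma> * \<Delta>) = 2 ^ Suc k * (\<Gamma> * \<Delta>)" by simp
  moreover have "\<forall>x\<in>V. w x * v x = 0" using Suc.prems(2) by auto
  ultimately show ?case using d unfolding Ck_bounded.simps by (intro conjI ballI exI) simp_all
qed

lemma Ck_bounded_tower:
  assumes "\<And>j x. j < k \<Longrightarrow> (G j has_real_derivative G (Suc j) x) (at x)"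
    and "continuous_on UNIV (G k)" and "\<And>j x. j \<le> k \<Longrightarrow> x \<in> J \<Longrightarrow> \<bar>G j x\<bar> \<le> \<Gamma>"
  shows "Ck_bounded J {} k \<Gamma> (G 0)"
  using assms
proof (induction k arbitrary: G)
  case 0
  then show ?case by (auto intro: continuous_on_subset)
next
  case (Suc k)
  have "Ck_bounded J {} k \<Gamma> (G (Suc 0))"
    using Suc.IH[of "\<lambda>j. G (Suc j)"] Suc.prems by auto
  then show ?case using Suc.prems(1)[of 0] Suc.prems(3)[of 0]
    by (auto intro: has_field_derivative_at_within)
qed

text \<open>Differentiating replaces the monomial by two monomials whose exponents have sum smaller by one, with
  coefficients \<open>a\<close> and \<open>- b\<close>; so each derivative costs at most a factor \<open>a + b\<close>.\<close>

lemma Ck_bounded_bump: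
  fixes u v :: real
  assumes "v - u \<le> 1" "k \<le> a" "k \<le> b"
  shows "Ck_bounded {u..v} {u, v} k (real (a + b) ^ k) (\<lambda>x. (x - u) ^ a * (v - x) ^ b)"
  using assms(2,3)
proof (induction k arbitrary: a b)
  case 0
  have "(x - u) ^ a * (v - x) ^ b \<le> 1" "0 \<le> (x - u) ^ a * (v - x) ^ b" if "x \<in> {u..v}" for x
    using that assms(1) by (auto intro!: mult_le_one power_le_one)
  then show ?case by (auto intro!: continuous_intros)
next
  case (Suc k)
  obtain a' b' where ab: "a = Suc a'" "b = Suc b'" using Suc.prems by (cases a; cases b) auto
  have bd: "(x - u) ^ a * (v - x) ^ b \<le> 1" "0 \<le> (x - u) ^ a * (v - x) ^ b" if "x \<in> {u..v}" for x
    using that assms(1) by (auto intro!: mult_le_one power_le_one)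
  have one: "1 \<le> real (a + b) ^ Suc k" using ab by (intro one_le_power) simp
  have d: "\<forall>x\<in>{u..v}. ((\<lambda>x. (x - u) ^ a * (v - x) ^ b) has_real_derivative
     (real a * ((x - u) ^ a' * (v - x) ^ b) + (- real b) * ((x - u) ^ a * (v - x) ^ b'))) (at x within {u..v})"
  proof
    fix x
    have "((\<lambda>x. (x - u) ^ a) has_real_derivative real a * (x - u) ^ a') (at x within {u..v})"
      unfolding ab by (rule derivative_eq_intros refl | simp)+
    moreover have "((\<lambda>x. (v - x) ^ b) has_real_derivative - real b * (v - x) ^ b') (at x within {u..v})"
      unfolding ab by (rule derivative_eq_intros refl | simp add: algebra_simps)+
    ultimately show "((\<lambda>x. (x - u) ^ a * (v - x) ^ b) has_real_derivative
     (real a * ((x - u) ^ a' * (v - x) ^ b) + (- real b) * ((x - u) ^ a * (v - x) ^ b'))) (at x within {u..v})"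
      by (rule DERIV_cong[OF DERIV_mult']) (simp add: algebra_simps)
  qed
  have b: "Ck_bounded {u..v} {u, v} k (\<bar>real a\<bar> * real (a' + b) ^ k + \<bar>- real b\<bar> * real (a + b') ^ k)
     (\<lambda>x. real a * ((x - u) ^ a' * (v - x) ^ b) + (- real b) * ((x - u) ^ a * (v - x) ^ b'))"
    using Suc.prems ab by (intro Ck_bounded_add Ck_bounded_cmult Suc.IH) auto
  have le: "\<bar>real a\<bar> * real (a' + b) ^ k + \<bar>- real b\<bar> * real (a + b') ^ k \<le> real (a + b) ^ Suc k"
  proof -
    have "real (a' + b) ^ k \<le> real (a + b) ^ k" "real (a + b') ^ k \<le> real (a + b) ^ k"
      using ab by (auto intro!: power_mono)
    then have "real a * real (a' + b) ^ k + real b * real (a + b') ^ k \<le> real a * real (a + b) ^ k + real b * real (a + b) ^ k"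
      by (intro add_mono mult_left_mono) auto
    then show ?thesis by (simp add: algebra_simps)
  qed
  have bd': "\<bar>(x - u) ^ a * (v - x) ^ b\<bar> \<le> real (a + b) ^ Suc k" if "x \<in> {u..v}" for x
    using bd[OF that] one by linarith
  show ?case
    unfolding Ck_bounded.simps
    by (intro conjI exI[of _ "\<lambda>x. real a * ((x - u) ^ a' * (v - x) ^ b) + (- real b) * ((x - u) ^ a * (v - x) ^ b')"]
        d Ck_bounded_mono[OF b le] ballI bd') (auto simp: ab)
qed

lemma integral_cauchy_schwarz_unit:
  fixes g :: "real \<Rightarrow> complex"
  assumes g: "continuous_on {a..b} g" and ab: "a \<le> b" "b - a \<le> 1"
  shows "(cmod (integral {a..b} g))\<^sup>2 \<le> integral {a..b} (\<lambda>x. (cmod (g x))\<^sup>2)"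
  using bessel_inequality[OF g ab(2), of "{0}"] by simp

text \<open>The constants in \<open>oscillatory_sum\<close>: after one integration by parts the amplitude \<open>w\<close> over the \<open>m\<close>-th
  power of the phase derivative becomes \<open>w'\<close> over the power \<open>m + 1\<close> and \<open>(m + 1) F'' w\<close> over the power
  \<open>m + 2\<close>.\<close>

primrec osc_const :: "real \<Rightarrow> nat \<Rightarrow> nat \<Rightarrow> real" where
  "osc_const \<Lambda> 0 m = 2 * (1 + real m * \<Lambda>)"
| "osc_const \<Lambda> (Suc k) m =
     2 * (osc_const \<Lambda> k (m + 1) + (real m + 1) * (2 ^ k * \<Lambda>) * osc_const \<Lambda> k (m + 2))"

lemma osc_const_nonneg: "0 \<le> \<Lambda> \<Longrightarrow> 0 \<le> osc_const \<Lambda> k m"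
  by (induction k arbitrary: m) auto

lemma norm_add_sq_le: "(cmod (x + y))\<^sup>2 \<le> 2 * ((cmod x)\<^sup>2 + (cmod y)\<^sup>2)"
proof -
  have "(cmod (x + y))\<^sup>2 \<le> (cmod x + cmod y)\<^sup>2"
    by (intro power_mono norm_triangle_ineq) auto
  also have "\<dots> \<le> 2 * ((cmod x)\<^sup>2 + (cmod y)\<^sup>2)"
    using sum_squares_bound[of "cmod x" "cmod y"] by (simp add: power2_eq_square algebra_simps)
  finally show ?thesis .
qed

context
  fixes u v c \<Lambda> :: real and F F1 F2 :: "real \<Rightarrow> real" and X :: "int set"
  assumes uv: "u \<le> v" "v - u \<le> 1" and c: "0 < c" and lam: "0 \<le> \<Lambda>" and X: "finite X"
    and F: "\<And>x. x \<in> {u..v} \<Longrightarrow> (F has_real_derivative F1 x) (at x within {u..v})"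
    and F1: "\<And>x. x \<in> {u..v} \<Longrightarrow> (F1 has_real_derivative F2 x) (at x within {u..v})"
    and away: "\<And>\<xi> x. \<xi> \<in> X \<Longrightarrow> x \<in> {u..v} \<Longrightarrow> c \<le> \<bar>real_of_int \<xi> + F1 x\<bar>"
begin

lemma F_cont: "continuous_on {u..v} F"
  by (rule DERIV_continuous_on[OF F])

lemma F1_cont: "continuous_on {u..v} F1"
  by (rule DERIV_continuous_on[OF F1])

lemma phase_nonzero: "\<xi> \<in> X \<Longrightarrow> x \<in> {u..v} \<Longrightarrow> real_of_int \<xi> + F1 x \<noteq> 0"
  using away[of \<xi> x] c by auto

lemma inverse_phase_le:
  assumes "\<xi> \<in> X" "x \<in> {u..v}"
  shows "\<bar>1 / (real_of_int \<xi> + F1 x) ^ m\<bar> \<le> 1 / c ^ m"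
proof -
  have "c ^ m \<le> \<bar>real_of_int \<xi> + F1 x\<bar> ^ m"
    using away[OF assms] c by (intro power_mono) auto
  then show ?thesis using c by (simp add: power_abs frac_le)
qed

lemma inverse_phase_deriv:
  assumes "\<xi> \<in> X" "x \<in> {u..v}"
  shows "((\<lambda>x. 1 / (real_of_int \<xi> + F1 x) ^ m) has_real_derivative
     (- real m * (F2 x / (real_of_int \<xi> + F1 x) ^ (m + 1)))) (at x within {u..v})"
proof -
  let ?f = "\<lambda>x. real_of_int \<xi> + F1 x"
  have nz: "?f x \<noteq> 0" by (rule phase_nonzero[OF assms])
  have "((\<lambda>x. 1 / ?f x ^ m) has_real_derivative
     (- (real m * ?f x ^ (m - 1) * F2 x)) / (?f x ^ m)\<^sup>2) (at x within {u..v})"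
    using nz F1[OF assms(2)] by (auto intro!: derivative_eq_intros simp: power2_eq_square)
  also have "(- (real m * ?f x ^ (m - 1) * F2 x)) / (?f x ^ m)\<^sup>2 = - real m * (F2 x / ?f x ^ (m + 1))"
  proof (cases m)
    case (Suc n)
    define y where "y = ?f x"
    have "y \<noteq> 0" using nz by (simp add: y_def)
    then have "(- (real m * y ^ (m - 1) * F2 x)) / (y ^ m)\<^sup>2 = - real m * (F2 x / y ^ (m + 1))"
      by (simp add: Suc divide_simps power2_eq_square) (simp add: algebra_simps)
    then show ?thesis by (simp add: y_def)
  qed simp
  finally show ?thesis .
qed

text \<open>For an amplitude independent of \<open>\<xi>\<close> this would be Bessel's inequality.  The factor
  \<open>\<sigma>\<^sub>\<xi> = 1 / (\<xi> + F')^m\<close> depends on \<open>\<xi>\<close>, but it has a bounded derivative in \<open>x\<close>; integrating it by parts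
  against the primitives \<open>H\<^sub>\<xi>\<close> of the remaining factor leaves \<open>\<sigma>\<^sub>\<xi>(u) H\<^sub>\<xi>(u)\<close> and an average of
  \<open>\<sigma>\<^sub>\<xi>'(t) H\<^sub>\<xi>(t)\<close> over \<open>t\<close>, and Bessel's inequality applies to the \<open>H\<^sub>\<xi>(t)\<close> for each \<open>t\<close>.\<close>

lemma oscillatory_base:
  assumes F2: "continuous_on {u..v} F2" and F2_le: "\<And>x. x \<in> {u..v} \<Longrightarrow> \<bar>F2 x\<bar> \<le> \<Lambda> * c"
    and w: "continuous_on {u..v} w" and w_le: "\<And>x. x \<in> {u..v} \<Longrightarrow> \<bar>w x\<bar> \<le> \<Gamma>"
  shows "(\<Sum>\<xi>\<in>X. (cmod (integral {u..v} (\<lambda>x. cyc (\<xi> * x + F x) *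
      of_real (1 / (real_of_int \<xi> + F1 x) ^ m * w x))))\<^sup>2) \<le> (osc_const \<Lambda> 0 m * \<Gamma> / c ^ m)\<^sup>2"
proof -
  have \<Gamma>: "0 \<le> \<Gamma>" using w_le[of u] uv by auto
  define h where "h x = cyc (F x) * of_real (w x)" for x
  have h: "continuous_on {u..v} h"
    unfolding h_def by (intro continuous_intros F_cont w)
  have h_le: "cmod (h x) \<le> \<Gamma>" if "x \<in> {u..v}" for x
    using w_le[OF that] by (simp add: h_def norm_mult)
  define H where "H \<xi> t = integral {t..v} (\<lambda>x. cyc (real_of_int \<xi> * x) * h x)" for \<xi> :: int and t
  have hc: "continuous_on {u..v} (\<lambda>x. cyc (real_of_int \<xi> * x) * h x)" for \<xi>
    by (intro continuous_intros h)
  have H_deriv: "(H \<xi> has_vector_derivative (- (cyc (real_of_int \<xi> * t) * h t))) (at t within {u..v})"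
    if "t \<in> {u..v}" for \<xi> t
    unfolding H_def using integral_has_vector_derivative'[OF hc that] .
  have H_cont: "continuous_on {u..v} (H \<xi>)" for \<xi>
    unfolding continuous_on_eq_continuous_within
    using has_vector_derivative_continuous[OF H_deriv] by blast
  have H_sum: "(\<Sum>\<xi>\<in>X. (cmod (H \<xi> t))\<^sup>2) \<le> \<Gamma>\<^sup>2" if t: "t \<in> {u..v}" for t
  proof -
    have ht: "continuous_on {t..v} h" using h t by (auto intro: continuous_on_subset)
    have "(\<Sum>\<xi>\<in>X. (cmod (H \<xi> t))\<^sup>2) \<le> integral {t..v} (\<lambda>x. (cmod (h x))\<^sup>2)"
      unfolding H_def using t uv by (intro bessel_inequality X ht) auto
    also have "\<dots> \<le> integral {t..v} (\<lambda>x. \<Gamma>\<^sup>2)"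
      using t h_le by (intro integral_le integrable_continuous_real continuous_intros ht power_mono) auto
    also have "\<dots> = (v - t) * \<Gamma>\<^sup>2" using t by simp
    also have "\<dots> \<le> 1 * \<Gamma>\<^sup>2" using t uv by (intro mult_right_mono) auto
    finally show ?thesis by simp
  qed
  define K where "K = 1 / c ^ m"
  have K: "0 < K" using c by (simp add: K_def)
  have each: "(cmod (integral {u..v} (\<lambda>x. cyc (\<xi> * x + F x) *
      of_real (1 / (real_of_int \<xi> + F1 x) ^ m * w x))))\<^sup>2
     \<le> 2 * (K\<^sup>2 * (cmod (H \<xi> u))\<^sup>2 + (real m * \<Lambda> * K)\<^sup>2 * integral {u..v} (\<lambda>t. (cmod (H \<xi> t))\<^sup>2))"
    if \<xi>: "\<xi> \<in> X" for \<xi>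
  proof -
    define \<sigma> where "\<sigma> x = 1 / (real_of_int \<xi> + F1 x) ^ m" for x
    define \<sigma>' where "\<sigma>' x = - real m * (F2 x / (real_of_int \<xi> + F1 x) ^ (m + 1))" for x
    have \<sigma>_deriv: "(\<sigma> has_real_derivative \<sigma>' x) (at x within {u..v})" if "x \<in> {u..v}" for x
      unfolding \<sigma>_def \<sigma>'_def by (rule inverse_phase_deriv[OF \<xi> that])
    have \<sigma>_cont: "continuous_on {u..v} \<sigma>" by (rule DERIV_continuous_on[OF \<sigma>_deriv])
    have \<sigma>'_cont: "continuous_on {u..v} \<sigma>'"
      unfolding \<sigma>'_def using phase_nonzero[OF \<xi>] by (intro continuous_intros F2 F1_cont) auto
    have "((\<lambda>x. of_real (\<sigma>' x) * H \<xi> x + of_real (\<sigma> x) * (- (cyc (real_of_int \<xi> * x) * h x))) has_integral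
       (of_real (\<sigma> v) * H \<xi> v - of_real (\<sigma> u) * H \<xi> u)) {u..v}"
    proof (rule fundamental_theorem_of_calculus[OF uv(1)])
      fix x assume x: "x \<in> {u..v}"
      have "((\<lambda>x. complex_of_real (\<sigma> x)) has_vector_derivative of_real (\<sigma>' x)) (at x within {u..v})"
        using \<sigma>_deriv[OF x] by (intro has_vector_derivative_of_real) (simp add: has_real_derivative_iff_has_vector_derivative)
      from has_vector_derivative_mult[OF this H_deriv[OF x, of \<xi>]]
      show "((\<lambda>x. of_real (\<sigma> x) * H \<xi> x) has_vector_derivative
         (of_real (\<sigma>' x) * H \<xi> x + of_real (\<sigma> x) * (- (cyc (real_of_int \<xi> * x) * h x)))) (at x within {u..v})"
        by (simp add: algebra_simps)
    qed
    moreover have "((\<lambda>x. of_real (\<sigma>' x) * H \<xi> x) has_integral integral {u..v} (\<lambda>x. of_real (\<sigma>' x) * H \<xi> x)) {u..v}"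
      by (intro integrable_integral integrable_continuous_real continuous_intros \<sigma>'_cont H_cont)
    ultimately have "((\<lambda>x. of_real (\<sigma>' x) * H \<xi> x - (of_real (\<sigma>' x) * H \<xi> x + of_real (\<sigma> x) * (- (cyc (real_of_int \<xi> * x) * h x))))
       has_integral (integral {u..v} (\<lambda>x. of_real (\<sigma>' x) * H \<xi> x) - (of_real (\<sigma> v) * H \<xi> v - of_real (\<sigma> u) * H \<xi> u))) {u..v}"
      by (rule has_integral_diff[rotated])
    moreover have "H \<xi> v = 0" by (simp add: H_def)
    moreover have "of_real (\<sigma>' x) * H \<xi> x - (of_real (\<sigma>' x) * H \<xi> x + of_real (\<sigma> x) * (- (cyc (real_of_int \<xi> * x) * h x)))
       = cyc (\<xi> * x + F x) * of_real (\<sigma> x * w x)" for x :: real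
      by (simp add: h_def cyc_add)
    ultimately have "integral {u..v} (\<lambda>x. cyc (\<xi> * x + F x) * of_real (\<sigma> x * w x))
       = of_real (\<sigma> u) * H \<xi> u + integral {u..v} (\<lambda>x. of_real (\<sigma>' x) * H \<xi> x)"
      by (simp only: mult_zero_right) (drule integral_unique, simp only: , simp)
    also have "(cmod \<dots>)\<^sup>2 \<le> 2 * ((cmod (of_real (\<sigma> u) * H \<xi> u))\<^sup>2 + (cmod (integral {u..v} (\<lambda>x. of_real (\<sigma>' x) * H \<xi> x)))\<^sup>2)"
      by (rule norm_add_sq_le)
    also have "(cmod (of_real (\<sigma> u) * H \<xi> u))\<^sup>2 \<le> K\<^sup>2 * (cmod (H \<xi> u))\<^sup>2"
    proof -
      have "\<bar>\<sigma> u\<bar> \<le> K" unfolding \<sigma>_def K_def using uv by (intro inverse_phase_le \<xi>) auto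
      then have "\<bar>\<sigma> u\<bar>\<^sup>2 \<le> K\<^sup>2" by (intro power_mono) auto
      then show ?thesis by (simp add: norm_mult power_mult_distrib mult_right_mono)
    qed
    also have "(cmod (integral {u..v} (\<lambda>x. of_real (\<sigma>' x) * H \<xi> x)))\<^sup>2
       \<le> integral {u..v} (\<lambda>x. (cmod (of_real (\<sigma>' x) * H \<xi> x))\<^sup>2)"
      using uv by (intro integral_cauchy_schwarz_unit continuous_intros \<sigma>'_cont H_cont)
    also have "\<dots> \<le> integral {u..v} (\<lambda>x. (real m * \<Lambda> * K)\<^sup>2 * (cmod (H \<xi> x))\<^sup>2)"
    proof (rule integral_le)
      fix x assume x: "x \<in> {u..v}"
      have "\<bar>\<sigma>' x\<bar> = real m * (\<bar>F2 x\<bar> * \<bar>1 / (real_of_int \<xi> + F1 x) ^ (m + 1)\<bar>)"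
        by (simp add: \<sigma>'_def abs_mult)
      also have "\<dots> \<le> real m * ((\<Lambda> * c) * (1 / c ^ (m + 1)))"
        using lam c by (intro mult_left_mono mult_mono F2_le[OF x] inverse_phase_le[OF \<xi> x]) auto
      also have "\<dots> = real m * \<Lambda> * K" using c by (simp add: K_def)
      finally have "\<bar>\<sigma>' x\<bar>\<^sup>2 \<le> (real m * \<Lambda> * K)\<^sup>2" by (intro power_mono) auto
      then show "(cmod (of_real (\<sigma>' x) * H \<xi> x))\<^sup>2 \<le> (real m * \<Lambda> * K)\<^sup>2 * (cmod (H \<xi> x))\<^sup>2"
        by (simp add: norm_mult power_mult_distrib mult_right_mono)
    qed (intro integrable_continuous_real continuous_intros \<sigma>'_cont H_cont)+
    also have "\<dots> = (real m * \<Lambda> * K)\<^sup>2 * integral {u..v} (\<lambda>x. (cmod (H \<xi> x))\<^sup>2)"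
      by simp
    finally show ?thesis by (simp add: \<sigma>_def)
  qed
  have "(\<Sum>\<xi>\<in>X. (cmod (integral {u..v} (\<lambda>x. cyc (\<xi> * x + F x) *
      of_real (1 / (real_of_int \<xi> + F1 x) ^ m * w x))))\<^sup>2)
    \<le> (\<Sum>\<xi>\<in>X. 2 * (K\<^sup>2 * (cmod (H \<xi> u))\<^sup>2 + (real m * \<Lambda> * K)\<^sup>2 * integral {u..v} (\<lambda>t. (cmod (H \<xi> t))\<^sup>2)))"
    by (intro sum_mono each)
  also have "\<dots> = 2 * (K\<^sup>2 * (\<Sum>\<xi>\<in>X. (cmod (H \<xi> u))\<^sup>2)
      + (real m * \<Lambda> * K)\<^sup>2 * integral {u..v} (\<lambda>t. \<Sum>\<xi>\<in>X. (cmod (H \<xi> t))\<^sup>2))"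
  proof -
    have "integral {u..v} (\<lambda>t. \<Sum>\<xi>\<in>X. (cmod (H \<xi> t))\<^sup>2) = (\<Sum>\<xi>\<in>X. integral {u..v} (\<lambda>t. (cmod (H \<xi> t))\<^sup>2))"
      by (intro integral_sum X integrable_continuous_real continuous_intros H_cont)
    then show ?thesis by (simp add: sum_distrib_left sum.distrib algebra_simps)
  qed
  also have "\<dots> \<le> 2 * (K\<^sup>2 * \<Gamma>\<^sup>2 + (real m * \<Lambda> * K)\<^sup>2 * \<Gamma>\<^sup>2)"
  proof -
    have "integral {u..v} (\<lambda>t. \<Sum>\<xi>\<in>X. (cmod (H \<xi> t))\<^sup>2) \<le> integral {u..v} (\<lambda>t. \<Gamma>\<^sup>2)"
      using H_sum by (intro integral_le integrable_continuous_real continuous_intros H_cont) auto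
    also have "\<dots> = (v - u) * \<Gamma>\<^sup>2" using uv by simp
    also have "\<dots> \<le> 1 * \<Gamma>\<^sup>2" using uv by (intro mult_right_mono) auto
    finally have "integral {u..v} (\<lambda>t. \<Sum>\<xi>\<in>X. (cmod (H \<xi> t))\<^sup>2) \<le> \<Gamma>\<^sup>2" by simp
    moreover have "(\<Sum>\<xi>\<in>X. (cmod (H \<xi> u))\<^sup>2) \<le> \<Gamma>\<^sup>2" using H_sum uv by auto
    ultimately show ?thesis by (intro mult_left_mono add_mono) auto
  qed
  also have "\<dots> = 2 * (1 + (real m * \<Lambda>)\<^sup>2) * (K * \<Gamma>)\<^sup>2"
    by (simp add: power_mult_distrib algebra_simps)
  also have "\<dots> \<le> (2 * (1 + real m * \<Lambda>))\<^sup>2 * (K * \<Gamma>)\<^sup>2"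
  proof (rule mult_right_mono)
    have "2 * (1 + y\<^sup>2) \<le> (2 * (1 + y))\<^sup>2" if "0 \<le> y" for y :: real
      using that by (simp add: power2_eq_square algebra_simps)
    then show "2 * (1 + (real m * \<Lambda>)\<^sup>2) \<le> (2 * (1 + real m * \<Lambda>))\<^sup>2"
      using lam by simp
  qed simp
  also have "\<dots> = (osc_const \<Lambda> 0 m * \<Gamma> / c ^ m)\<^sup>2"
    by (simp add: K_def power_mult_distrib power_divide)
  finally show ?thesis .
qed

text \<open>The factor \<open>2\<pi>i (\<xi> + F')\<close> times the exponential is an exact derivative.\<close>

lemma integration_by_parts_phase:
  assumes \<xi>: "\<xi> \<in> X" and F2: "continuous_on {u..v} F2"
    and w: "\<And>x. x \<in> {u..v} \<Longrightarrow> (w has_real_derivative w' x) (at x within {u..v})"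
    and w': "continuous_on {u..v} w'" and w0: "w u = 0" "w v = 0"
  shows "2 * pi * \<i> * integral {u..v} (\<lambda>x. cyc (\<xi> * x + F x) * of_real (1 / (real_of_int \<xi> + F1 x) ^ m * w x))
    = of_real (real m + 1) * integral {u..v} (\<lambda>x. cyc (\<xi> * x + F x) * of_real (1 / (real_of_int \<xi> + F1 x) ^ (m + 2) * (F2 x * w x)))
      - integral {u..v} (\<lambda>x. cyc (\<xi> * x + F x) * of_real (1 / (real_of_int \<xi> + F1 x) ^ (m + 1) * w' x))"
proof -
  define f1 where "f1 x = real_of_int \<xi> + F1 x" for x
  have nz: "f1 x \<noteq> 0" if "x \<in> {u..v}" for x unfolding f1_def by (rule phase_nonzero[OF \<xi> that])
  have f1c: "continuous_on {u..v} f1" unfolding f1_def by (intro continuous_intros F1_cont)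
  have wc: "continuous_on {u..v} w" by (rule DERIV_continuous_on[OF w])
  define \<psi> where "\<psi> x = cyc (\<xi> * x + F x)" for x :: real
  have \<psi>c: "continuous_on {u..v} \<psi>" unfolding \<psi>_def by (intro continuous_intros F_cont)
  have I: "((\<lambda>x. \<psi> x * of_real (1 / f1 x ^ j * g x)) has_integral
      integral {u..v} (\<lambda>x. \<psi> x * of_real (1 / f1 x ^ j * g x))) {u..v}"
    if "continuous_on {u..v} g" for j g
    using nz by (intro integrable_integral integrable_continuous_real continuous_intros \<psi>c f1c that) auto
  have "((\<lambda>x. 2 * pi * \<i> * (\<psi> x * of_real (1 / f1 x ^ m * w x)) +
     (\<psi> x * of_real (1 / f1 x ^ (m + 1) * w' x) - of_real (real m + 1) * (\<psi> x * of_real (1 / f1 x ^ (m + 2) * (F2 x * w x)))))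
    has_integral (\<psi> v * of_real (1 / f1 v ^ (m + 1) * w v) - \<psi> u * of_real (1 / f1 u ^ (m + 1) * w u))) {u..v}"
  proof (rule fundamental_theorem_of_calculus[OF uv(1)])
    fix x assume x: "x \<in> {u..v}"
    have "((\<lambda>x. \<xi> * x + F x) has_real_derivative f1 x) (at x within {u..v})"
      unfolding f1_def using F[OF x] by (auto intro!: derivative_eq_intros)
    from cyc_has_vector_derivative[OF this]
    have \<psi>d: "(\<psi> has_vector_derivative (2 * pi * \<i> * of_real (f1 x) * \<psi> x)) (at x within {u..v})"
      unfolding \<psi>_def .
    have "((\<lambda>x. 1 / f1 x ^ (m + 1) * w x) has_real_derivative
       (1 / f1 x ^ (m + 1) * w' x + (- real (m + 1) * (F2 x / f1 x ^ (m + 1 + 1))) * w x)) (at x within {u..v})"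
      unfolding f1_def by (rule DERIV_mult'[OF inverse_phase_deriv[OF \<xi> x] w[OF x]])
    then have "((\<lambda>x. complex_of_real (1 / f1 x ^ (m + 1) * w x)) has_vector_derivative
       of_real (1 / f1 x ^ (m + 1) * w' x + (- real (m + 1) * (F2 x / f1 x ^ (m + 1 + 1))) * w x)) (at x within {u..v})"
      by (intro has_vector_derivative_of_real) (simp add: has_real_derivative_iff_has_vector_derivative)
    from has_vector_derivative_mult[OF \<psi>d this]
    show "((\<lambda>x. \<psi> x * of_real (1 / f1 x ^ (m + 1) * w x)) has_vector_derivative
      (2 * pi * \<i> * (\<psi> x * of_real (1 / f1 x ^ m * w x)) +
     (\<psi> x * of_real (1 / f1 x ^ (m + 1) * w' x) - of_real (real m + 1) * (\<psi> x * of_real (1 / f1 x ^ (m + 2) * (F2 x * w x))))))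
      (at x within {u..v})"
      by (rule back_subst[where P = "\<lambda>d. (_ has_vector_derivative d) _"]) (use nz[OF x] in \<open>simp add: field_simps\<close>)
  qed
  moreover have "((\<lambda>x. 2 * pi * \<i> * (\<psi> x * of_real (1 / f1 x ^ m * w x)) +
     (\<psi> x * of_real (1 / f1 x ^ (m + 1) * w' x) - of_real (real m + 1) * (\<psi> x * of_real (1 / f1 x ^ (m + 2) * (F2 x * w x)))))
    has_integral (2 * pi * \<i> * integral {u..v} (\<lambda>x. \<psi> x * of_real (1 / f1 x ^ m * w x)) +
     (integral {u..v} (\<lambda>x. \<psi> x * of_real (1 / f1 x ^ (m + 1) * w' x))
      - of_real (real m + 1) * integral {u..v} (\<lambda>x. \<psi> x * of_real (1 / f1 x ^ (m + 2) * (F2 x * w x)))))) {u..v}"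
    by (intro has_integral_add has_integral_diff has_integral_mult_right I continuous_intros wc w' F2)
  ultimately have "2 * pi * \<i> * integral {u..v} (\<lambda>x. \<psi> x * of_real (1 / f1 x ^ m * w x)) +
     (integral {u..v} (\<lambda>x. \<psi> x * of_real (1 / f1 x ^ (m + 1) * w' x))
      - of_real (real m + 1) * integral {u..v} (\<lambda>x. \<psi> x * of_real (1 / f1 x ^ (m + 2) * (F2 x * w x)))) = 0"
    using w0 by (auto dest: has_integral_unique)
  then show ?thesis unfolding \<psi>_def f1_def by (simp add: algebra_simps)
qed

text \<open>Each of the \<open>k\<close> integrations by parts gains a factor \<open>1/c\<close>: the power of \<open>1/(\<xi> + F')\<close> grows by one,
  or by two together with a factor \<open>F''\<close> of size \<open>c\<close>.  The new amplitudes \<open>w'\<close> and \<open>F'' w\<close> again do not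
  depend on \<open>\<xi>\<close>, so the induction ends with \<open>oscillatory_base\<close>, and the whole sum over \<open>\<xi>\<close> obeys the
  bound that integration by parts gives for a single frequency.\<close>

lemma oscillatory_sum:
  assumes F2: "Ck_bounded {u..v} {} (k - 1) (\<Lambda> * c) F2"
    and w: "Ck_bounded {u..v} {u, v} k \<Gamma> w"
  shows "(\<Sum>\<xi>\<in>X. (cmod (integral {u..v} (\<lambda>x. cyc (\<xi> * x + F x) *
      of_real (1 / (real_of_int \<xi> + F1 x) ^ m * w x))))\<^sup>2) \<le> (osc_const \<Lambda> k m * \<Gamma> / c ^ (k + m))\<^sup>2"
  using assms
proof (induction k arbitrary: m w \<Gamma>)
  case 0
  then show ?case
    using oscillatory_base[of w \<Gamma> m] by (simp add: Ck_bounded.simps)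
next
  case (Suc k)
  have \<Gamma>: "0 \<le> \<Gamma>" using Ck_bounded_le[OF Suc.prems(2), of u] uv by auto
  have F2k: "Ck_bounded {u..v} {} k (\<Lambda> * c) F2" using Suc.prems(1) by simp
  have F2c: "continuous_on {u..v} F2" by (rule Ck_bounded_continuous[OF F2k])
  have F2k1: "Ck_bounded {u..v} {} (k - 1) (\<Lambda> * c) F2"
    by (rule Ck_bounded_lower[OF F2k]) simp
  from Suc.prems(2) obtain w' where
    w': "\<And>x. x \<in> {u..v} \<Longrightarrow> (w has_real_derivative w' x) (at x within {u..v})"
    "Ck_bounded {u..v} {u, v} k \<Gamma> w'" and w0: "w u = 0" "w v = 0"
    unfolding Ck_bounded.simps by blast
  let ?I = "\<lambda>m w \<xi>. integral {u..v} (\<lambda>x. cyc (real_of_int \<xi> * x + F x) *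
      of_real (1 / (real_of_int \<xi> + F1 x) ^ m * w x))"
  define P where "P = osc_const \<Lambda> k (m + 1) * \<Gamma> / c ^ (k + (m + 1))"
  define Q where "Q = osc_const \<Lambda> k (m + 2) * (2 ^ k * (\<Lambda> * c * \<Gamma>)) / c ^ (k + (m + 2))"
  have P: "0 \<le> P" "0 \<le> Q" using \<Gamma> c lam osc_const_nonneg[OF lam] by (auto simp: P_def Q_def)
  have 1: "(\<Sum>\<xi>\<in>X. (cmod (?I (m + 1) w' \<xi>))\<^sup>2) \<le> P\<^sup>2"
    unfolding P_def by (rule Suc.IH[OF F2k1 w'(2)])
  have 2: "(\<Sum>\<xi>\<in>X. (cmod (?I (m + 2) (\<lambda>x. F2 x * w x) \<xi>))\<^sup>2) \<le> Q\<^sup>2"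
    unfolding Q_def using lam c \<Gamma>
    by (intro Suc.IH[OF F2k1] Ck_bounded_mult F2k Ck_bounded_Suc[OF Suc.prems(2)]) auto
  have "(cmod (?I m w \<xi>))\<^sup>2 \<le> 2 * ((real m + 1)\<^sup>2 * (cmod (?I (m + 2) (\<lambda>x. F2 x * w x) \<xi>))\<^sup>2 + (cmod (?I (m + 1) w' \<xi>))\<^sup>2)"
    if "\<xi> \<in> X" for \<xi>
  proof -
    have "cmod (2 * pi * \<i> * ?I m w \<xi>) = 2 * pi * cmod (?I m w \<xi>)"
      by (simp add: norm_mult)
    moreover have "1 * cmod (?I m w \<xi>) \<le> 2 * pi * cmod (?I m w \<xi>)"
      using pi_gt3 by (intro mult_right_mono) auto
    ultimately have "cmod (?I m w \<xi>) \<le> cmod (2 * pi * \<i> * ?I m w \<xi>)" by linarith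
    then have "(cmod (?I m w \<xi>))\<^sup>2 \<le> (cmod (2 * pi * \<i> * ?I m w \<xi>))\<^sup>2" by (intro power_mono) auto
    also have "\<dots> = (cmod (of_real (real m + 1) * ?I (m + 2) (\<lambda>x. F2 x * w x) \<xi> + (- ?I (m + 1) w' \<xi>)))\<^sup>2"
      by (simp only: integration_by_parts_phase[OF that F2c w'(1) Ck_bounded_continuous[OF w'(2)] w0]
          diff_conv_add_uminus)
    also have "\<dots> \<le> 2 * ((cmod (of_real (real m + 1) * ?I (m + 2) (\<lambda>x. F2 x * w x) \<xi>))\<^sup>2 + (cmod (- ?I (m + 1) w' \<xi>))\<^sup>2)"
      by (rule norm_add_sq_le)
    also have "(cmod (of_real (real m + 1) * ?I (m + 2) (\<lambda>x. F2 x * w x) \<xi>))\<^sup>2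
       = (real m + 1)\<^sup>2 * (cmod (?I (m + 2) (\<lambda>x. F2 x * w x) \<xi>))\<^sup>2"
      by (simp only: norm_mult norm_of_real power_mult_distrib power2_abs)
    finally show ?thesis by (simp only: norm_minus_cancel)
  qed
  then have "(\<Sum>\<xi>\<in>X. (cmod (?I m w \<xi>))\<^sup>2)
     \<le> (\<Sum>\<xi>\<in>X. 2 * ((real m + 1)\<^sup>2 * (cmod (?I (m + 2) (\<lambda>x. F2 x * w x) \<xi>))\<^sup>2 + (cmod (?I (m + 1) w' \<xi>))\<^sup>2))"
    by (rule sum_mono)
  also have "\<dots> = 2 * ((real m + 1)\<^sup>2 * (\<Sum>\<xi>\<in>X. (cmod (?I (m + 2) (\<lambda>x. F2 x * w x) \<xi>))\<^sup>2) + (\<Sum>\<xi>\<in>X. (cmod (?I (m + 1) w' \<xi>))\<^sup>2))"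
  proof -
    have "(\<Sum>\<xi>\<in>X. 2 * (a * f \<xi> + g \<xi>)) = 2 * (a * (\<Sum>\<xi>\<in>X. f \<xi>) + (\<Sum>\<xi>\<in>X. g \<xi>))"
      for a :: real and f g
      by (simp add: sum_distrib_left sum.distrib distrib_left)
    then show ?thesis .
  qed
  also have "\<dots> \<le> 2 * ((real m + 1)\<^sup>2 * Q\<^sup>2 + P\<^sup>2)"
    using 1 2 by (intro mult_left_mono add_mono) auto
  also have "\<dots> \<le> (2 * (P + (real m + 1) * Q))\<^sup>2"
  proof -
    have "2 * (y\<^sup>2 + x\<^sup>2) \<le> (2 * (x + y))\<^sup>2" if "0 \<le> x" "0 \<le> y" for x y :: real
      using that mult_nonneg_nonneg[OF that] by (simp add: power2_eq_square algebra_simps)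
    from this[of P "(real m + 1) * Q"] P show ?thesis by (simp add: power_mult_distrib)
  qed
  also have "2 * (P + (real m + 1) * Q) = osc_const \<Lambda> (Suc k) m * \<Gamma> / c ^ (Suc k + m)"
    using c by (simp add: P_def Q_def field_simps)
  finally show ?case .
qed

end

section \<open>Words, inverse branches and graph functions\<close>

text \<open>The integer whose base-\<open>l\<close> digits are the letters minus one, the first letter being the least
  significant digit.  With this order a prefix of length \<open>j\<close> is the residue modulo \<open>l\<^sup>j\<close>.\<close>

fun word_code :: "nat \<Rightarrow> nat list \<Rightarrow> nat" where
  "word_code l [] = 0"
| "word_code l (x # xs) = (x - 1) + l * word_code l xs"

lemma word_code_append: "word_code l (xs @ ys) = word_code l xs + l ^ length xs * word_code l ys"
  by (induction xs) (simp_all add: algebra_simps)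

lemma words_Cons: "x # xs \<in> words l (Suc n) \<longleftrightarrow> 1 \<le> x \<and> x \<le> l \<and> xs \<in> words l n"
  by (auto simp: words_def)

lemma words_take: "a \<in> words l n \<Longrightarrow> j \<le> n \<Longrightarrow> take j a \<in> words l j"
  by (auto simp: words_def dest: in_set_takeD)

lemma word_code_less: "a \<in> words l n \<Longrightarrow> word_code l a < l ^ n"
proof (induction n arbitrary: a)
  case 0
  then show ?case by (auto simp: words_def)
next
  case (Suc n)
  then obtain x xs where a: "a = x # xs" by (cases a) (auto simp: words_def)
  with Suc.prems have x: "1 \<le> x" "x \<le> l" and xs: "xs \<in> words l n" by (auto simp: words_Cons)
  have "word_code l a < l + l * word_code l xs" using x by (simp add: a)
  also have "\<dots> = l * Suc (word_code l xs)" by simp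
  also have "\<dots> \<le> l * l ^ n" using Suc.IH[OF xs] by (intro mult_left_mono) auto
  finally show ?case by simp
qed

lemma word_code_surj: "1 \<le> l \<Longrightarrow> N < l ^ n \<Longrightarrow> \<exists>a\<in>words l n. word_code l a = N"
proof (induction n arbitrary: N)
  case 0
  then show ?case by (auto simp: words_def intro!: bexI[of _ "[]"])
next
  case (Suc n)
  have "N div l < l ^ n" using Suc.prems by (simp add: less_mult_imp_div_less mult.commute)
  with Suc obtain a where a: "a \<in> words l n" "word_code l a = N div l" by blast
  have "Suc (N mod l) # a \<in> words l (Suc n)"
    using a Suc.prems by (auto simp: words_Cons Suc_le_eq)
  moreover have "word_code l (Suc (N mod l) # a) = N" by (simp add: a)
  ultimately show ?case by blast
qed

lemma finite_words: "finite (words l n)"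
proof -
  have "words l n = {xs. set xs \<subseteq> {1..l} \<and> length xs = n}" by (auto simp: words_def)
  then show ?thesis by (simp add: finite_lists_length_eq)
qed

lemma card_words: "card (words l n) = l ^ n"
proof -
  have "words l n = {xs. set xs \<subseteq> {1..l} \<and> length xs = n}" by (auto simp: words_def)
  then show ?thesis using card_lists_length_eq[of "{1..l}" n] by simp
qed

lemma frac_mult_frac: "frac (real l * frac x) = frac (real l * x)"
proof -
  have "real l * frac x = real l * x - of_int (int l * \<lfloor>x\<rfloor>)"
    by (simp add: frac_def algebra_simps)
  then show ?thesis by (simp add: frac_def del: of_int_mult)
qed

lemma tau_funpow: "x \<in> {0..<1} \<Longrightarrow> (tau l ^^ j) x = frac (real l ^ j * x)"
proof (induction j)
  case 0
  then show ?case by (simp add: frac_eq)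
next
  case (Suc j)
  then show ?case by (simp add: tau_def frac_mult_frac mult.assoc)
qed

lemma cell_Cons:
  assumes "a \<in> words l n"
  shows "x \<in> cell l (k # a) \<longleftrightarrow> x \<in> cell l a \<and> (tau l ^^ n) x \<in> cell1 l k"
proof -
  have len: "length a = n" using assms by (simp add: words_def)
  have "(k # a) ! (n - j) = a ! (n - 1 - j)" if "j < n" for j
    using that by (simp add: nth_Cons')
  then show ?thesis
    by (auto simp: cell_def len less_Suc_eq)
qed

text \<open>Prepending a letter refines the interval: the new letter is read off from \<open>\<tau>\<^sup>n x\<close>, the fractional
  part of \<open>l\<^sup>n x\<close>, hence it is the last digit of the integer part of \<open>l\<^sup>n\<^sup>+\<^sup>1 x\<close>.\<close>

lemma cell_iff_floor:
  assumes l: "1 \<le> l" and "a \<in> words l n"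
  shows "x \<in> cell l a \<longleftrightarrow> x \<in> {0..<1} \<and> \<lfloor>real l ^ n * x\<rfloor> = int (word_code l a)"
  using assms(2)
proof (induction n arbitrary: a)
  case 0
  then have "a = []" by (simp add: words_def)
  then show ?case by (auto simp: cell_def floor_eq_iff)
next
  case (Suc n)
  then obtain k b where a: "a = k # b" by (cases a) (auto simp: words_def)
  with Suc.prems have k: "1 \<le> k" "k \<le> l" and b: "b \<in> words l n" by (auto simp: words_Cons)
  show ?case
  proof (cases "x \<in> {0..<1}")
    case True
    define y where "y = real l ^ n * x"
    have 1: "x \<in> cell l a \<longleftrightarrow> \<lfloor>y\<rfloor> = int (word_code l b) \<and> frac y \<in> cell1 l k"
      unfolding a cell_Cons[OF b] Suc.IH[OF b] tau_funpow[OF True] y_def using True by auto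
    have "frac y \<in> cell1 l k \<longleftrightarrow> real k - 1 \<le> real l * frac y \<and> real l * frac y < real k"
      using l by (simp add: cell1_def pos_divide_le_eq pos_less_divide_eq mult.commute)
    then have 2: "frac y \<in> cell1 l k \<longleftrightarrow> \<lfloor>real l * frac y\<rfloor> = int k - 1"
      unfolding floor_eq_iff by auto
    have y: "real l * y = of_int (int l * \<lfloor>y\<rfloor>) + real l * frac y"
      by (simp add: frac_def algebra_simps)
    have 3: "\<lfloor>real l * y\<rfloor> = int l * \<lfloor>y\<rfloor> + \<lfloor>real l * frac y\<rfloor>"
      unfolding y by (rule int_add_floor[symmetric])
    have 4: "0 \<le> \<lfloor>real l * frac y\<rfloor>" "\<lfloor>real l * frac y\<rfloor> < int l"
      using l frac_lt_1[of y] by (auto simp: floor_less_iff)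
    have 5: "int (word_code l a) = int l * int (word_code l b) + (int k - 1)" using k by (simp add: a of_nat_diff)
    have "int l * \<lfloor>y\<rfloor> + \<lfloor>real l * frac y\<rfloor> = int l * int (word_code l b) + (int k - 1)
      \<longleftrightarrow> \<lfloor>y\<rfloor> = int (word_code l b) \<and> \<lfloor>real l * frac y\<rfloor> = int k - 1" (is "?L \<longleftrightarrow> ?R")
    proof
      assume L: ?L
      have "\<lfloor>y\<rfloor> = (int l * \<lfloor>y\<rfloor> + \<lfloor>real l * frac y\<rfloor>) div int l" using 4 l by simp
      also have "\<dots> = int (word_code l b)" unfolding L using k by simp
      finally show ?R using L by simp
    qed simp
    then show ?thesis using True 1 2 3 5 by (simp add: y_def mult.assoc)
  qed (auto simp: cell_def)
qed

lemma cell_eq: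
  assumes l: "1 \<le> l" and a: "a \<in> words l n"
  shows "cell l a = {real (word_code l a) / real l ^ n ..< (real (word_code l a) + 1) / real l ^ n}"
proof -
  have le: "real (word_code l a) + 1 \<le> real l ^ n"
    using word_code_less[OF a] by (metis Suc_leI of_nat_Suc of_nat_le_iff of_nat_power add.commute)
  have pos: "0 < real l ^ n" using l by simp
  have "x \<in> {0..<1}" if "real (word_code l a) \<le> real l ^ n * x" "real l ^ n * x < real (word_code l a) + 1" for x
  proof -
    have "real l ^ n * x < real l ^ n * 1" using that(2) le by simp
    moreover have "real l ^ n * 0 \<le> real l ^ n * x"
      unfolding mult_zero_right by (rule order_trans[OF of_nat_0_le_iff that(1)])
    ultimately show ?thesis
      unfolding mult_less_cancel_left_pos[OF pos] mult_le_cancel_left_pos[OF pos] by simp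
  qed
  then show ?thesis
    unfolding set_eq_iff cell_iff_floor[OF assms] using pos
    by (auto simp: floor_eq_iff field_simps)
qed

lemma left_end_eq:
  assumes "1 \<le> l" "a \<in> words l n"
  shows "left_end l a = real (word_code l a) / real l ^ n"
  unfolding left_end_def cell_eq[OF assms] using assms(1)
  by (intro cInf_atLeastLessThan) (simp add: divide_strict_right_mono)

lemma inv_branch_eq:
  assumes l: "1 \<le> l" and a: "a \<in> words l n" and j: "j \<le> n" and x: "x \<in> {0..<1}"
  shows "inv_branch l a j x = (x + real (word_code l (take j a))) / real l ^ j"
  unfolding inv_branch_def
proof (rule the_equality)
  have w: "take j a \<in> words l j" by (rule words_take[OF a j])
  have pos: "0 < real l ^ j" "0 < l" using l by auto
  let ?y = "(x + real (word_code l (take j a))) / real l ^ j"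
  have y: "real l ^ j * ?y = x + of_int (int (word_code l (take j a)))" using pos by simp
  have c: "?y \<in> cell l (take j a)"
    unfolding cell_eq[OF l w] using x pos by (auto intro!: divide_right_mono divide_strict_right_mono)
  then have y01: "?y \<in> {0..<1}" using cell_iff_floor[OF l w] by blast
  have "(tau l ^^ j) ?y = frac (x + of_int (int (word_code l (take j a))))" unfolding tau_funpow[OF y01] y by (rule refl)
  also have "\<dots> = x" using x by (simp add: frac_def floor_eq_iff)
  finally show "?y \<in> cell l (take j a) \<and> (tau l ^^ j) ?y = x" using c by blast
  fix y assume y: "y \<in> cell l (take j a) \<and> (tau l ^^ j) y = x"
  then have "\<lfloor>real l ^ j * y\<rfloor> = int (word_code l (take j a))" "y \<in> {0..<1}" using cell_iff_floor[OF l w] by auto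
  moreover from this y have "frac (real l ^ j * y) = x" by (simp add: tau_funpow)
  ultimately have "real l ^ j * y = x + real (word_code l (take j a))" by (simp add: frac_def)
  then show "y = ?y" using pos by (simp add: field_simps)
qed

lemma periodic_add_nat:
  fixes f :: "real \<Rightarrow> 'b"
  assumes "\<And>x. f (x + 1) = f x" shows "f (x + real n) = f x"
proof (induction n)
  case (Suc n)
  have "f (x + real (Suc n)) = f ((x + real n) + 1)" by (simp add: add_ac)
  then show ?case by (simp only: assms Suc)
qed simp

text \<open>The function \<open>s\<^sub>n\<close> of the introduction (\<open>k = 0\<close>) and its formal \<open>k\<close>-th derivative.\<close>

definition graph_sum :: "nat \<Rightarrow> real ^ 'd ^ 'd \<Rightarrow> (real \<Rightarrow> real ^ 'd) \<Rightarrow> nat \<Rightarrow> nat \<Rightarrow> real \<Rightarrow> real ^ 'd" where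
  "graph_sum l A \<phi> n k t =
     (\<Sum>j<n. (1 / real l ^ Suc j) ^ k *\<^sub>R (matrix_pow A j *v nth_vderiv k \<phi> (t / real l ^ Suc j)))"

lemma nth_vderiv_0 [simp]: "nth_vderiv 0 f = f"
  by (simp add: nth_vderiv_def)

lemma nth_vderiv_Suc: "nth_vderiv (Suc k) f x = vector_derivative (nth_vderiv k f) (at x)"
  by (simp add: nth_vderiv_def)

text \<open>The \<open>j\<close>-th inverse branch is \<open>x \<mapsto> (x + N\<^sub>j) / l\<^sup>j\<close> with \<open>N\<^sub>j\<close> the code of the prefix of length \<open>j\<close>, on all
  of \<open>\<real>\<close> after continuation.  Since \<open>\<phi>\<close> has period one, \<open>N\<^sub>j\<close> may be replaced by the code of the whole
  word, which differs from it by a multiple of \<open>l\<^sup>j\<close>.\<close>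

lemma S_ext_eq_graph_sum:
  assumes l: "1 \<le> l" and c: "c \<in> words l p" and a: "a \<in> words l q" and per: "\<And>x. \<phi> (x + 1) = \<phi> x"
  shows "S_ext l A \<phi> c a x = graph_sum l A \<phi> q 0 (x + real (word_code l a))"
proof -
  have len: "length a = q" using a by (simp add: words_def)
  have u: "left_end l c \<in> {0..<1}"
  proof -
    have "real (word_code l c) < real l ^ p" using word_code_less[OF c] by (metis of_nat_less_iff of_nat_power)
    then show ?thesis unfolding left_end_eq[OF l c] using l by simp
  qed
  have "\<phi> (inv_branch_ext l c a (Suc j) x) = \<phi> ((x + real (word_code l a)) / real l ^ Suc j)" if j: "j < q" for j
  proof -
    have "inv_branch_ext l c a (Suc j) x = (x + real (word_code l (take (Suc j) a))) / real l ^ Suc j"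
      unfolding inv_branch_ext_def using j
      by (subst inv_branch_eq[OF l a _ u]) (auto simp: add_divide_distrib diff_divide_distrib)
    moreover have "real (word_code l a) = real (word_code l (take (Suc j) a)) + real l ^ Suc j * real (word_code l (drop (Suc j) a))"
    proof -
      have "word_code l a = word_code l (take (Suc j) a @ drop (Suc j) a)" by simp
      also have "\<dots> = word_code l (take (Suc j) a) + l ^ Suc j * word_code l (drop (Suc j) a)"
        unfolding word_code_append using j len by simp
      finally show ?thesis by (metis of_nat_add of_nat_mult of_nat_power)
    qed
    ultimately have "(x + real (word_code l a)) / real l ^ Suc j
       = inv_branch_ext l c a (Suc j) x + real (word_code l (drop (Suc j) a))"
      using l by (simp add: field_simps)
    then show ?thesis using periodic_add_nat[of \<phi>, OF per] by simp
  qed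
  moreover have "S_ext l A \<phi> c a x = (\<Sum>j<q. matrix_pow A j *v \<phi> (inv_branch_ext l c a (Suc j) x))"
    unfolding S_ext_def len by (simp add: sum.atLeast1_atMost_eq)
  ultimately show ?thesis by (simp add: graph_sum_def)
qed

lemma graph_sum_has_vector_derivative:
  assumes phi: "\<And>x. nth_vderiv k \<phi> differentiable (at x)"
  shows "(graph_sum l A \<phi> n k has_vector_derivative graph_sum l A \<phi> n (Suc k) t) (at t)"
  unfolding graph_sum_def
proof (rule has_vector_derivative_sum)
  fix j
  define b where "b = 1 / real l ^ Suc j"
  have "(nth_vderiv k \<phi> has_vector_derivative nth_vderiv (Suc k) \<phi> (b * t)) (at (b * t))"
    unfolding nth_vderiv_Suc using phi by (simp flip: vector_derivative_works)
  moreover have "((\<lambda>t. b * t) has_vector_derivative b) (at t)"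
    by (auto intro!: derivative_eq_intros simp flip: has_real_derivative_iff_has_vector_derivative)
  ultimately have "((nth_vderiv k \<phi> \<circ> (\<lambda>t. b * t)) has_vector_derivative (b *\<^sub>R nth_vderiv (Suc k) \<phi> (b * t))) (at t)"
    by (intro vector_diff_chain_at)
  from bounded_linear.has_vector_derivative[OF bounded_linear_compose[OF bounded_linear_scaleR_right matrix_vector_mul_bounded_linear] this]
  have "((\<lambda>t. b ^ k *\<^sub>R (matrix_pow A j *v nth_vderiv k \<phi> (b * t))) has_vector_derivative
     (b ^ k *\<^sub>R (matrix_pow A j *v (b *\<^sub>R nth_vderiv (Suc k) \<phi> (b * t))))) (at t)"
    by (simp add: o_def)
  then show "((\<lambda>t. (1 / real l ^ Suc j) ^ k *\<^sub>R (matrix_pow A j *v nth_vderiv k \<phi> (t / real l ^ Suc j))) has_vector_derivative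
     (1 / real l ^ Suc j) ^ Suc k *\<^sub>R (matrix_pow A j *v nth_vderiv (Suc k) \<phi> (t / real l ^ Suc j))) (at t)"
    by (simp add: b_def matrix_vector_mult_scaleR mult.commute)
qed

text \<open>The bad words of the dispersion condition, as integers, on an arbitrary set \<open>J\<close> and with an arbitrary
  threshold \<open>\<epsilon>\<close>.\<close>

definition bad_codes :: "nat \<Rightarrow> real ^ 'd ^ 'd \<Rightarrow> (real \<Rightarrow> real ^ 'd) \<Rightarrow> nat \<Rightarrow> real set \<Rightarrow> real \<Rightarrow> int \<Rightarrow> real ^ 'd \<Rightarrow> nat set" where
  "bad_codes l A \<phi> q J \<epsilon> \<xi> \<eta> =
     {N\<in>{..<l ^ q}. \<exists>x\<in>J. \<bar>real_of_int \<xi> + \<eta> \<bullet> graph_sum l A \<phi> q 1 (x + real N)\<bar> < \<epsilon>}"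

lemma card_bad_codes_le:
  assumes l: "1 \<le> l" and per: "\<And>x. \<phi> (x + 1) = \<phi> x" and diff: "\<And>x. \<phi> differentiable (at x)"
    and k: "k < l ^ p"
    and J: "J \<subseteq> {(real k - 1) / real l ^ p ..< (real k + 2) / real l ^ p}"
  shows "card (bad_codes l A \<phi> q J
     (2 * alpha A \<kappa> / real l ^ q * norm (transpose (matrix_pow A q) *v \<eta>)) \<xi> \<eta>) \<le> M_pq l A \<phi> \<kappa> p q"
proof -
  obtain c where c: "c \<in> words l p" "word_code l c = k" using word_code_surj[OF l k] by blast
  define Bw where "Bw = (\<lambda>(\<xi>, \<eta>). bad_words l A \<phi> \<kappa> q c \<xi> \<eta>)"
  have star: "cell_star l c = {(real k - 1) / real l ^ p ..< (real k + 2) / real l ^ p}"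
    using c by (simp add: cell_star_def left_end_eq[OF l c(1)] words_def diff_divide_distrib add_divide_distrib)
  have deriv: "S_ext_deriv l A \<phi> c a x = graph_sum l A \<phi> q 1 (x + real (word_code l a))" if a: "a \<in> words l q" for a x
  proof -
    have "(graph_sum l A \<phi> q 0 has_vector_derivative graph_sum l A \<phi> q 1 (x + real (word_code l a))) (at (x + real (word_code l a)))"
      using graph_sum_has_vector_derivative[of 0 \<phi>] diff by simp
    moreover have "((\<lambda>x. x + real (word_code l a)) has_vector_derivative 1) (at x)"
      by (auto intro!: derivative_eq_intros)
    ultimately have "((graph_sum l A \<phi> q 0 \<circ> (\<lambda>x. x + real (word_code l a))) has_vector_derivative
       (1 *\<^sub>R graph_sum l A \<phi> q 1 (x + real (word_code l a)))) (at x)"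
      by (intro vector_diff_chain_at)
    then show ?thesis
      unfolding S_ext_deriv_def S_ext_eq_graph_sum[where \<phi> = \<phi>, OF l c(1) a per, abs_def] o_def
      by (intro vector_derivative_at) simp
  qed
  let ?\<epsilon> = "2 * alpha A \<kappa> / real l ^ q * norm (transpose (matrix_pow A q) *v \<eta>)"
  have "bad_codes l A \<phi> q J ?\<epsilon> \<xi> \<eta> \<subseteq> word_code l ` Bw (\<xi>, \<eta>)"
  proof
    fix N assume N: "N \<in> bad_codes l A \<phi> q J ?\<epsilon> \<xi> \<eta>"
    then have "N < l ^ q" by (simp add: bad_codes_def)
    then obtain a where a: "a \<in> words l q" "word_code l a = N" using word_code_surj[OF l] by blast
    from N obtain x where "x \<in> J" "\<bar>real_of_int \<xi> + \<eta> \<bullet> graph_sum l A \<phi> q 1 (x + real N)\<bar> < ?\<epsilon>"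
      by (auto simp: bad_codes_def)
    with a J star have "a \<in> Bw (\<xi>, \<eta>)" by (auto simp: Bw_def bad_words_def deriv)
    with a show "N \<in> word_code l ` Bw (\<xi>, \<eta>)" by blast
  qed
  moreover have fin: "Bw z \<subseteq> words l q" for z by (auto simp: Bw_def bad_words_def)
  ultimately have "card (bad_codes l A \<phi> q J ?\<epsilon> \<xi> \<eta>) \<le> card (word_code l ` Bw (\<xi>, \<eta>))"
    using finite_subset[OF fin finite_words] by (intro card_mono) auto
  also have "\<dots> \<le> card (Bw (\<xi>, \<eta>))"
    using finite_subset[OF fin finite_words] by (rule card_image_le)
  also have "\<dots> \<le> (SUP z. card (Bw z))"
    by (intro cSUP_upper bdd_aboveI2[of _ _ "l ^ q"]) (auto intro!: card_mono[OF finite_words fin, unfolded card_words])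
  also have "\<dots> = (SUP (\<xi>, \<eta>)\<in>UNIV. card (bad_words l A \<phi> \<kappa> q c \<xi> \<eta>))"
    by (simp add: Bw_def case_prod_unfold)
  also have "\<dots> \<le> M_pq l A \<phi> \<kappa> p q"
    unfolding M_pq_def using c by (intro Max_ge) (auto simp: finite_words)
  finally show ?thesis .
qed

text \<open>An infimum of natural numbers is attained, so one partition depth \<open>p\<close> realises \<open>M(q)\<close> exactly.\<close>

lemma M_q_attained: "\<exists>p\<ge>1. M_pq l A \<phi> \<kappa> p q = M_q l A \<phi> \<kappa> q"
proof -
  have "(INF p\<in>{1..}. M_pq l A \<phi> \<kappa> p q) \<in> (\<lambda>p. M_pq l A \<phi> \<kappa> p q) ` {1..}"
    by (rule Inf_nat_def1) auto
  then show ?thesis unfolding M_q_def by auto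
qed

section \<open>Powers of a matrix of spectral radius less than one\<close>

lemma matrix_pow_0 [simp]: "matrix_pow A 0 = mat 1"
  by (simp add: matrix_pow_def)

lemma matrix_pow_Suc: "matrix_pow A (Suc n) = A ** matrix_pow A n"
  by (simp add: matrix_pow_def)

lemma matrix_pow_add: "matrix_pow A (m + n) = matrix_pow A m ** matrix_pow A n"
  by (induction m) (simp_all add: matrix_pow_Suc matrix_mul_assoc)

lemma det_matrix_pow: "det (matrix_pow A n) = det A ^ n"
  by (induction n) (simp_all add: matrix_pow_Suc det_mul)

lemma invertible_matrix_pow: "invertible A \<Longrightarrow> invertible (matrix_pow A n)"
  by (simp add: invertible_det_nz det_matrix_pow)

lemma norm_matrix_vector_le_opnorm: "norm (A *v x) \<le> opnorm A * norm (x :: real ^ 'd)"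
  unfolding opnorm_def by (rule onorm[OF matrix_vector_mul_bounded_linear])

lemma opnorm_nonneg: "0 \<le> opnorm A"
  unfolding opnorm_def by (rule onorm_pos_le[OF matrix_vector_mul_bounded_linear])

text \<open>Compare the largest coordinate of an eigenvector with that of its image.  The bound makes the
  supremum in the definition of the spectral radius meaningful.\<close>

lemma complex_eigenvalue_le:
  assumes "c \<in> complex_eigenvalues A"
  shows "cmod c \<le> (\<Sum>i\<in>UNIV. \<Sum>j\<in>UNIV. \<bar>A $ i $ j\<bar>)"
proof -
  obtain v :: "complex ^ 'a" where v: "v \<noteq> 0" "(\<chi> i j. complex_of_real (A $ i $ j)) *v v = c *s v"
    using assms by (auto simp: complex_eigenvalues_def)
  define M where "M = Max (range (\<lambda>i. cmod (v $ i)))"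
  have le: "cmod (v $ i) \<le> M" for i unfolding M_def by (intro Max_ge) auto
  have "M \<in> range (\<lambda>i. cmod (v $ i))" unfolding M_def by (intro Max_in) auto
  then obtain i where i: "M = cmod (v $ i)" by auto
  obtain k where "v $ k \<noteq> 0" using v(1) by (auto simp: vec_eq_iff)
  then have M: "0 < M" using le[of k] by (auto intro: less_le_trans[of _ "cmod (v $ k)"])
  have "c * v $ i = (\<Sum>j\<in>UNIV. complex_of_real (A $ i $ j) * v $ j)"
    using arg_cong[OF v(2), of "\<lambda>w. w $ i"] by (simp add: matrix_vector_mult_def)
  then have "cmod c * M = cmod (\<Sum>j\<in>UNIV. complex_of_real (A $ i $ j) * v $ j)"
    by (metis i norm_mult)
  also have "\<dots> \<le> (\<Sum>j\<in>UNIV. \<bar>A $ i $ j\<bar> * M)"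
    by (rule sum_norm_le) (simp add: norm_mult mult_left_mono le)
  also have "\<dots> = (\<Sum>j\<in>UNIV. \<bar>A $ i $ j\<bar>) * M" by (simp add: sum_distrib_right)
  finally have "cmod c \<le> (\<Sum>j\<in>UNIV. \<bar>A $ i $ j\<bar>)" using M by simp
  also have "\<dots> \<le> (\<Sum>i\<in>UNIV. \<Sum>j\<in>UNIV. \<bar>A $ i $ j\<bar>)"
    by (rule member_le_sum[of i UNIV "\<lambda>i. \<Sum>j\<in>UNIV. \<bar>A $ i $ j\<bar>"]) (auto intro: sum_nonneg)
  finally show ?thesis .
qed

lemma complex_eigenvalue_le_spectral_radius:
  assumes "c \<in> complex_eigenvalues A" shows "cmod c \<le> spectral_radius A"
  unfolding spectral_radius_def
  using assms complex_eigenvalue_le[of _ A]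
  by (intro cSup_upper imageI bdd_aboveI[of _ "\<Sum>i\<in>UNIV. \<Sum>j\<in>UNIV. \<bar>A $ i $ j\<bar>"]) auto

lemma matrix_pow_Suc_entry:
  "matrix_pow A (Suc n) $ k $ m = (\<Sum>j\<in>UNIV. A $ k $ j * matrix_pow A n $ j $ m)"
  by (simp add: matrix_pow_Suc matrix_matrix_mult_def)

text \<open>The entries of \<open>A\<^sup>n\<close> are the Taylor coefficients at \<open>0\<close> of the entries of the resolvent \<open>1 / (1 - z A)\<close>.  By
  Cramer's rule the latter are holomorphic where \<open>det (1 - z A) \<noteq> 0\<close>, in particular on a disc of
  radius \<open>R > 1\<close>, so their Taylor series converge absolutely at \<open>1\<close>.\<close>

lemma summable_matrix_pow_entry:
  fixes A :: "real ^ 'd ^ 'd"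
  assumes rho: "spectral_radius A < 1"
  shows "summable (\<lambda>n. \<bar>matrix_pow A n $ k $ m\<bar>)"
proof -
  define Ac where "Ac = (\<chi> i j. complex_of_real (A $ i $ j))"
  define N where "N z = (mat 1 - (\<chi> i j. z * Ac $ i $ j) :: complex ^ 'd ^ 'd)" for z
  define \<rho> where "\<rho> = max (spectral_radius A) 0"
  \<comment> \<open>any radius strictly between \<open>1\<close> and \<open>1/\<rho>\<close>, also when \<open>\<rho> = 0\<close>\<close>
  define R where "R = 2 / (1 + \<rho>)"
  have \<rho>: "0 \<le> \<rho>" "\<rho> < 1" using rho by (auto simp: \<rho>_def)
  have R: "1 < R" "R * \<rho> < 1" using \<rho> by (auto simp: R_def field_simps)
  have N_mult: "N z *v x = x - z *s (Ac *v x)" for z x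
  proof -
    have "(\<Sum>j\<in>UNIV. ((if i = j then 1 else 0) - z * Ac $ i $ j) * x $ j) = x $ i - z * (\<Sum>j\<in>UNIV. Ac $ i $ j * x $ j)" for i
    proof -
      have "(\<Sum>j\<in>UNIV. ((if i = j then 1 else 0) - z * Ac $ i $ j) * x $ j)
        = (\<Sum>j\<in>UNIV. (if i = j then x $ j else 0) - z * (Ac $ i $ j * x $ j))"
        by (intro sum.cong) (auto simp: left_diff_distrib)
      then show ?thesis by (simp add: sum_subtractf sum_distrib_left)
    qed
    then show ?thesis
      by (simp add: N_def vec_eq_iff matrix_vector_mult_def mat_def)
  qed
  have det_nz: "det (N z) \<noteq> 0" if z: "cmod z < R" for z
  proof -
    have "x = 0" if x: "N z *v x = 0" for x
    proof (rule ccontr)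
      assume "x \<noteq> 0"
      have eq: "x = z *s (Ac *v x)" using x unfolding N_mult by simp
      have z0: "z \<noteq> 0" using eq \<open>x \<noteq> 0\<close> by (metis vector_smult_lzero)
      have "Ac *v x = (1 / z) *s x"
        by (subst (2) eq) (simp add: z0 vector_smult_assoc)
      then have "1 / z \<in> complex_eigenvalues A"
        using \<open>x \<noteq> 0\<close> by (auto simp: complex_eigenvalues_def Ac_def)
      from complex_eigenvalue_le_spectral_radius[OF this] have "1 / cmod z \<le> \<rho>"
        by (simp add: norm_divide \<rho>_def)
      then have "1 \<le> \<rho> * cmod z" using z0 by (simp add: field_simps)
      also have "\<dots> \<le> \<rho> * R" using z \<rho> by (intro mult_left_mono) auto
      finally show False using R by (simp add: mult.commute)
    qed
    then show ?thesis
      using matrix_left_invertible_ker[of "N z"] by (auto simp: invertible_left_inverse simp flip: invertible_det_nz)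
  qed
  define x where "x z = (\<chi> k. det (\<chi> i j. if j = k then (if i = m then 1 else 0) else N z $ i $ j) / det (N z))" for z
  have Nx: "N z *v x z = (\<chi> i. if i = m then 1 else 0)" if "cmod z < R" for z
    unfolding cramer[OF det_nz[OF that]] x_def by (simp only: vec_lambda_beta)
  have hol: "(\<lambda>z. x z $ k) holomorphic_on ball 0 R" for k
  proof -
    have det_hol: "(\<lambda>z. det (\<chi> i j. M z i j)) holomorphic_on ball 0 R"
      if "\<And>i j. (\<lambda>z. M z i j) holomorphic_on ball 0 R" for M :: "complex \<Rightarrow> 'd \<Rightarrow> 'd \<Rightarrow> complex"
      using that by (simp add: det_def) (intro holomorphic_intros)
    have N_hol: "(\<lambda>z. N z $ i $ j) holomorphic_on ball 0 R" for i j
      by (simp add: N_def) (intro holomorphic_intros)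
    have "(\<lambda>z. det (\<chi> i j. if j = k then (if i = m then 1 else 0) else N z $ i $ j)) holomorphic_on ball 0 R"
    proof (rule det_hol)
      show "(\<lambda>z. if j = k then (if i = m then 1 else 0) else N z $ i $ j) holomorphic_on ball 0 R" for i j
        by (cases "j = k") (simp_all add: N_hol)
    qed
    moreover have "(\<lambda>z. det (N z)) holomorphic_on ball 0 R"
      using det_hol[of "\<lambda>z i j. N z $ i $ j", OF N_hol] by simp
    ultimately show ?thesis
      unfolding x_def vec_lambda_beta using det_nz by (intro holomorphic_on_divide) auto
  qed
  define F where "F k = fps_expansion (\<lambda>z. x z $ k) 0" for k
  have exp: "(\<lambda>z. x z $ k) has_fps_expansion F k" for k
    unfolding F_def using R by (intro has_fps_expansion_fps_expansion[of "ball 0 R"] hol) auto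
  \<comment> \<open>the fixed point equation \<open>x = e\<^sub>m + z A x\<close>, read as a recursion for the coefficients\<close>
  have rec: "F k = fps_const (if k = m then 1 else 0) + fps_X * (\<Sum>j\<in>UNIV. fps_const (Ac $ k $ j) * F j)" (is "_ = ?G") for k
  proof -
    have G: "(\<lambda>z. (if k = m then 1 else 0) + z * (\<Sum>j\<in>UNIV. Ac $ k $ j * x z $ j)) has_fps_expansion ?G"
      by (intro fps_expansion_intros exp)
    have "x z $ k = (if k = m then 1 else 0) + z * (\<Sum>j\<in>UNIV. Ac $ k $ j * x z $ j)" if "z \<in> ball 0 R" for z
    proof -
      have "cmod z < R" using that by simp
      from arg_cong[OF Nx[OF this], of "\<lambda>w. w $ k"] show ?thesis
        unfolding N_mult by (simp add: matrix_vector_mult_def algebra_simps)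
    qed
    moreover have "eventually (\<lambda>z. z \<in> ball 0 R) (nhds (0::complex))"
      using R by (intro eventually_nhds_in_open) auto
    ultimately have "eventually (\<lambda>z. x z $ k = (if k = m then 1 else 0) + z * (\<Sum>j\<in>UNIV. Ac $ k $ j * x z $ j)) (nhds 0)"
      by (auto elim: eventually_mono)
    moreover have "eventually (\<lambda>z. eval_fps (F k) z = x z $ k) (nhds 0)"
      using exp[of k] unfolding has_fps_expansion_def by blast
    moreover have "eventually (\<lambda>z. eval_fps ?G z = (if k = m then 1 else 0) + z * (\<Sum>j\<in>UNIV. Ac $ k $ j * x z $ j)) (nhds 0)"
      using G unfolding has_fps_expansion_def by blast
    ultimately have "eventually (\<lambda>z. eval_fps (F k) z = eval_fps ?G z) (nhds 0)"
      by eventually_elim (rule trans[OF _ sym], rule trans, assumption+)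
    with exp[of k] G show ?thesis
      unfolding has_fps_expansion_def by (intro eval_fps_eqD) auto
  qed
  have coeff: "fps_nth (F k) n = complex_of_real (matrix_pow A n $ k $ m)" for n k
  proof (induction n arbitrary: k)
    case 0
    show ?case by (subst rec) (simp add: mat_def)
  next
    case (Suc n)
    show ?case by (subst rec) (simp add: fps_sum_nth Suc matrix_pow_Suc_entry Ac_def)
  qed
  have "ereal R \<le> fps_conv_radius (F k)"
    unfolding F_def using R by (intro conv_radius_fps_expansion) (auto simp: eball_ereal hol)
  then have "ereal (norm (1::complex)) < conv_radius (fps_nth (F k))"
  proof -
    assume "ereal R \<le> fps_conv_radius (F k)"
    moreover have "ereal (norm (1::complex)) < ereal R" using R(1) by simp
    ultimately show ?thesis unfolding fps_conv_radius_def by (rule less_le_trans[rotated])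
  qed
  from abs_summable_in_conv_radius[OF this] show ?thesis by (simp add: coeff)
qed

lemma summable_opnorm_matrix_pow:
  assumes "spectral_radius A < 1"
  shows "summable (\<lambda>n. opnorm (matrix_pow A n))"
proof (rule summable_comparison_test')
  show "summable (\<lambda>n. \<Sum>i\<in>UNIV. \<Sum>j\<in>UNIV. \<bar>matrix_pow A n $ i $ j\<bar>)"
    by (intro summable_sum summable_matrix_pow_entry assms)
  show "norm (opnorm (matrix_pow A n)) \<le> (\<Sum>i\<in>UNIV. \<Sum>j\<in>UNIV. \<bar>matrix_pow A n $ i $ j\<bar>)" for n
    using onorm_le_matrix_component_sum[of "matrix_pow A n"] opnorm_nonneg[of "matrix_pow A n"]
    by (simp add: opnorm_def)
qed

section \<open>Fourier transforms of the fibre measures\<close>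

lemma sum_lessThan_mult:
  fixes f :: "nat \<Rightarrow> 'a::comm_monoid_add"
  shows "(\<Sum>m<a * b. f m) = (\<Sum>i<a. \<Sum>j<b. f (i + a * j))"
proof -
  have "(\<Sum>m<a * b. f m) = (\<Sum>j<b. sum f {j * a ..< j * a + a})"
    by (simp add: sum.nat_group mult.commute)
  also have "\<dots> = (\<Sum>j<b. \<Sum>i<a. f (i + a * j))"
  proof (rule sum.cong[OF refl])
    fix j
    have "sum f {j * a ..< j * a + a} = sum f {0 + j * a ..< a + j * a}" by (simp add: add.commute)
    also have "\<dots> = (\<Sum>i\<in>{0..<a}. f (i + j * a))" by (rule sum.shift_bounds_nat_ivl)
    finally show "sum f {j * a ..< j * a + a} = (\<Sum>i<a. f (i + a * j))"
      by (simp add: atLeast0LessThan mult.commute)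
  qed
  also have "\<dots> = (\<Sum>i<a. \<Sum>j<b. f (i + a * j))" by (rule sum.swap)
  finally show ?thesis .
qed

lemma cmod_sum_squared_le:
  assumes "finite I"
  shows "(cmod (\<Sum>i\<in>I. z i))\<^sup>2 \<le> real (card I) * (\<Sum>i\<in>I. (cmod (z i))\<^sup>2)"
proof -
  have "(cmod (\<Sum>i\<in>I. z i))\<^sup>2 \<le> (\<Sum>i\<in>I. cmod (z i))\<^sup>2"
    by (intro power_mono norm_sum) auto
  also have "\<dots> \<le> (\<Sum>i\<in>I. (cmod (z i))\<^sup>2) * real (card I)"
    by (rule sum_squared_le_sum_of_squares)
  finally show ?thesis by (simp add: mult.commute)
qed

text \<open>Two integrals, one of which is always over an empty or degenerate interval, take the place of a
  signed integral from \<open>0\<close> to \<open>t\<close>.\<close>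

lemma global_antiderivative:
  fixes g :: "real \<Rightarrow> real"
  assumes g: "continuous_on UNIV g"
  shows "\<exists>H. \<forall>t. (H has_real_derivative g t) (at t)"
proof (intro exI allI)
  fix t :: real
  define R where "R = \<bar>t\<bar> + 1"
  define H where "H t = integral {0..t} g - integral {t..0} g" for t
  have int: "g integrable_on {a..b}" for a b
    by (intro integrable_continuous_real continuous_on_subset[OF g]) auto
  have eq: "H s = integral {-R..s} g - integral {-R..0} g" if "-R < s" for s
  proof (cases "0 \<le> s")
    case True
    have "integral {-R..0} g + integral {0..s} g = integral {-R..s} g"
      using True by (intro Henstock_Kurzweil_Integration.integral_combine int) (auto simp: R_def)
    moreover have "integral {s..0} g = 0" using True by (cases "s = 0") auto
    ultimately show ?thesis by (simp add: H_def)
  next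
    case False
    have "integral {-R..s} g + integral {s..0} g = integral {-R..0} g"
      using False that by (intro Henstock_Kurzweil_Integration.integral_combine int) auto
    then show ?thesis using False by (simp add: H_def)
  qed
  have t: "t \<in> {-R<..<R}" by (auto simp: R_def)
  have "((\<lambda>s. integral {-R..s} g) has_real_derivative g t) (at t within {-R..R})"
    using t by (intro integral_has_real_derivative continuous_on_subset[OF g]) auto
  then have "((\<lambda>s. integral {-R..s} g - integral {-R..0} g) has_real_derivative g t - 0) (at t within {-R..R})"
    by (rule DERIV_diff[OF _ DERIV_const])
  then have "((\<lambda>s. integral {-R..s} g - integral {-R..0} g) has_real_derivative g t) (at t)"
  proof -
    assume *: "((\<lambda>s. integral {-R..s} g - integral {-R..0} g) has_real_derivative g t - 0) (at t within {-R..R})"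
    have "at t within {-R..R} = at t"
      using t by (intro at_within_interior) (simp add: interior_atLeastAtMost_real)
    then show ?thesis using * by (simp only: diff_zero)
  qed
  then have "(H has_real_derivative g t) (at t)"
    by (rule has_field_derivative_transform_within_open[of _ _ _ "{-R<..}"]) (use t eq in auto)
  then show "((\<lambda>t. integral {0..t} g - integral {t..0} g) has_real_derivative g t) (at t)"
    unfolding H_def .
qed

lemma periodic_antiderivative:
  fixes g :: "real \<Rightarrow> real"
  assumes g: "continuous_on UNIV g" and per: "\<And>x. g (x + 1) = g x"
  shows "\<exists>H. (\<forall>a b. a \<le> b \<longrightarrow> (g has_integral (H b - H a)) {a..b}) \<and>
    (\<forall>t. (H has_real_derivative g t) (at t)) \<and> (\<forall>t. H (t + 1) = H t + integral {0..1} g)"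
proof -
  obtain H where H: "\<And>t. (H has_real_derivative g t) (at t)"
    using global_antiderivative[OF g] by blast
  have int: "(g has_integral (H b - H a)) {a..b}" if "a \<le> b" for a b
    using that H by (intro fundamental_theorem_of_calculus)
      (auto simp flip: has_real_derivative_iff_has_vector_derivative intro: has_field_derivative_at_within)
  have "((\<lambda>t. H (t + 1) - H t) has_real_derivative 0) (at t)" for t
  proof -
    have "((\<lambda>t. H (t + 1)) has_real_derivative g t) (at t)"
      using H[of "t + 1"] per[of t] by (simp add: DERIV_shift)
    from DERIV_diff[OF this H[of t]] show ?thesis by simp
  qed
  then have "H (t + 1) - H t = H (0 + 1) - H 0" for t
    using DERIV_isconst_all[of "\<lambda>t. H (t + 1) - H t" t 0] by blast
  moreover have "H 1 - H 0 = integral {0..1} g" using int[of 0 1] by (simp add: integral_unique)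
  ultimately show ?thesis using H int by (intro exI[of _ H]) (auto simp: algebra_simps)
qed

lemma integral_sum_preimages:
  fixes g :: "real \<Rightarrow> real"
  assumes g: "continuous_on UNIV g" and per: "\<And>x. g (x + 1) = g x" and m: "0 < m"
  shows "integral {0..1} (\<lambda>x. \<Sum>N<m. g ((x + real N) / real m)) = real m * integral {0..1} g"
proof -
  obtain H where H: "\<And>t. (H has_real_derivative g t) (at t)" "\<And>t. H (t + 1) = H t + integral {0..1} g"
    using periodic_antiderivative[OF g per] by blast
  have "((\<lambda>x. \<Sum>N<m. g ((x + real N) / real m)) has_integral
     (\<Sum>N<m. real m * H ((1 + real N) / real m) - real m * H ((0 + real N) / real m))) {0..1}"
  proof (intro has_integral_sum finite_lessThan fundamental_theorem_of_calculus)
    fix N x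
    have "((\<lambda>x. real m * H ((x + real N) / real m)) has_real_derivative g ((x + real N) / real m)) (at x within {0..1})"
      by (rule derivative_eq_intros DERIV_chain2[OF H(1)] refl | use m in simp)+
    then show "((\<lambda>x. real m * H ((x + real N) / real m)) has_vector_derivative g ((x + real N) / real m)) (at x within {0..1})"
      by (simp add: has_real_derivative_iff_has_vector_derivative)
  qed simp
  moreover have "(\<Sum>N<m. real m * H ((1 + real N) / real m) - real m * H ((0 + real N) / real m))
     = real m * (H (real m / real m) - H (0 / real m))"
    using sum_lessThan_telescope[of "\<lambda>N. real m * H (real N / real m)" m]
    by (simp add: algebra_simps)
  ultimately show ?thesis using m H(2)[of 0] by (simp add: integral_unique)
qed

text \<open>The arcs of length \<open>2L\<close> centred at the cells of length \<open>L\<close> cover the circle exactly twice; in terms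
  of a primitive both sums telescope.\<close>

lemma sum_integral_overlapping:
  fixes g :: "real \<Rightarrow> real" and L :: real
  assumes g: "continuous_on UNIV g" and per: "\<And>x. g (x + 1) = g x" and P: "real P * L = 1" "0 < L"
  shows "(\<Sum>k<P. integral {real k * L - L / 2..real k * L + 3 * L / 2} g) = 2 * integral {0..1} g"
    and "(\<Sum>k<P. integral {real k * L..(real k + 1) * L} g) = integral {0..1} g"
proof -
  obtain H where H: "\<And>a b. a \<le> b \<Longrightarrow> (g has_integral (H b - H a)) {a..b}"
      "\<And>t. H (t + 1) = H t + integral {0..1} g"
    using periodic_antiderivative[OF g per] by blast
  define a where "a k = H (real k * L - L / 2)" for k
  have "integral {real k * L - L / 2..real k * L + 3 * L / 2} g = (a (Suc (Suc k)) - a (Suc k)) + (a (Suc k) - a k)" for k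
    using H(1)[of "real k * L - L / 2" "real k * L + 3 * L / 2"] P(2)
    by (simp add: integral_unique a_def algebra_simps)
  then have "(\<Sum>k<P. integral {real k * L - L / 2..real k * L + 3 * L / 2} g) = (a (Suc P) - a (Suc 0)) + (a P - a 0)"
    by (simp only: sum.distrib sum_lessThan_telescope[of "\<lambda>k. a (Suc k)" P] sum_lessThan_telescope[of a P])
  moreover have "real (Suc P) * L - L / 2 = L / 2 + 1" "real P * L - L / 2 = - L / 2 + 1"
    using P(1) by (simp_all add: algebra_simps)
  then have "a (Suc P) = H (L / 2) + integral {0..1} g" "a P = H (- L / 2) + integral {0..1} g"
    unfolding a_def using H(2)[of "L / 2"] H(2)[of "- L / 2"] by simp_all
  moreover have "a (Suc 0) = H (L / 2)" "a 0 = H (- L / 2)"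
    by (simp_all add: a_def)
  ultimately show "(\<Sum>k<P. integral {real k * L - L / 2..real k * L + 3 * L / 2} g) = 2 * integral {0..1} g"
    by simp
  have "integral {real k * L..(real k + 1) * L} g = H (real (Suc k) * L) - H (real k * L)" for k
    using H(1)[of "real k * L" "(real k + 1) * L"] P(2)
    by (simp add: integral_unique algebra_simps)
  then have "(\<Sum>k<P. integral {real k * L..(real k + 1) * L} g) = H (real P * L) - H (real 0 * L)"
    using sum_lessThan_telescope[of "\<lambda>k. H (real k * L)" P] by simp
  then show "(\<Sum>k<P. integral {real k * L..(real k + 1) * L} g) = integral {0..1} g"
    using H(2)[of 0] P(1) by simp
qed

text \<open>A derivative of a periodic function is periodic by uniqueness of derivatives.\<close>

lemma nth_vderiv_periodic:
  assumes per: "\<And>x. f (x + 1) = f x" and diff: "\<And>j x. j < k \<Longrightarrow> nth_vderiv j f differentiable (at x)"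
  shows "nth_vderiv k f (x + 1) = nth_vderiv k f x"
  using diff
proof (induction k arbitrary: x)
  case 0
  then show ?case by (simp add: per)
next
  case (Suc k)
  let ?g = "nth_vderiv k f"
  have g: "?g (y + 1) = ?g y" for y using Suc by auto
  have "(?g has_vector_derivative nth_vderiv (Suc k) f (x + 1)) (at (x + 1))"
    unfolding nth_vderiv_Suc using Suc.prems by (simp flip: vector_derivative_works)
  moreover have "((\<lambda>x. x + 1) has_vector_derivative 1) (at x)"
    by (auto intro!: derivative_eq_intros)
  ultimately have "((?g \<circ> (\<lambda>x. x + 1)) has_vector_derivative (1 *\<^sub>R nth_vderiv (Suc k) f (x + 1))) (at x)"
    by (intro vector_diff_chain_at)
  then have "(?g has_vector_derivative nth_vderiv (Suc k) f (x + 1)) (at x)"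
    by (simp add: o_def g)
  then show ?case unfolding nth_vderiv_Suc[of k f x] by (simp add: vector_derivative_at)
qed

text \<open>The standing assumptions on the system, without determinant, dimension and dispersion conditions.
  Inside, \<open>s n k\<close> is the \<open>k\<close>-th derivative of \<open>s\<^sub>n\<close>, and \<open>B q\<close> is the action \<open>(A\<^sup>q)\<^sup>T\<close> on frequencies.\<close>

locale solenoidal =
  fixes l r :: nat and A :: "real ^ 'd ^ 'd" and \<phi> :: "real \<Rightarrow> real ^ 'd" and \<kappa> :: real
  assumes l2: "2 \<le> l" and inv: "invertible A" and rho: "spectral_radius A < 1"
    and r2: "2 \<le> r" and phi: "\<phi> \<in> U_kappa r \<kappa>" and kappa: "0 < \<kappa>"
begin

abbreviation s :: "nat \<Rightarrow> nat \<Rightarrow> real \<Rightarrow> real ^ 'd" where "s \<equiv> graph_sum l A \<phi>"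

abbreviation B :: "nat \<Rightarrow> real ^ 'd \<Rightarrow> real ^ 'd" where
  "B q \<eta> \<equiv> transpose (matrix_pow A q) *v \<eta>"

text \<open>The characteristic function at \<open>\<eta>\<close> of the uniform distribution on the \<open>l\<^sup>n\<close> points of the graph
  functions over \<open>t\<close>.\<close>

definition fibre_char :: "nat \<Rightarrow> real ^ 'd \<Rightarrow> real \<Rightarrow> complex" where
  "fibre_char n \<eta> t = (\<Sum>N<l ^ n. cyc (\<eta> \<bullet> s n 0 (t + real N))) / of_nat (l ^ n)"

text \<open>The quantity \<open>D\<^sub>n(\<eta>)\<close> of the introduction.\<close>

definition fibre_energy :: "nat \<Rightarrow> real ^ 'd \<Rightarrow> real" where
  "fibre_energy n \<eta> = integral {0..1} (\<lambda>x. (cmod (fibre_char n \<eta> x))\<^sup>2)"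

lemma l_pos [simp]: "0 < l" using l2 by simp

lemma phi_periodic: "\<phi> (x + 1) = \<phi> x"
  using phi by (simp add: U_kappa_def Cr_circle_def)

lemma phi_differentiable: "k < r \<Longrightarrow> nth_vderiv k \<phi> differentiable (at x)"
  using phi by (simp add: U_kappa_def Cr_circle_def)

lemma phi_continuous: "k \<le> r \<Longrightarrow> continuous_on UNIV (nth_vderiv k \<phi>)"
  using phi by (simp add: U_kappa_def Cr_circle_def)

lemma phi_bound: "k \<le> r \<Longrightarrow> norm (nth_vderiv k \<phi> x) \<le> \<kappa>"
  using phi by (simp add: U_kappa_def)

lemma phi_deriv_periodic: "k \<le> r \<Longrightarrow> nth_vderiv k \<phi> (x + 1) = nth_vderiv k \<phi> x"
  by (intro nth_vderiv_periodic phi_periodic phi_differentiable) auto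

lemma s_has_vector_derivative: "k < r \<Longrightarrow> (s n k has_vector_derivative s n (Suc k) t) (at t)"
  by (intro graph_sum_has_vector_derivative phi_differentiable)

lemma s_continuous: "k \<le> r \<Longrightarrow> continuous_on UNIV (s n k)"
  unfolding graph_sum_def
  by (intro continuous_intros linear_continuous_on_compose[OF _ matrix_vector_mul_linear]
      continuous_on_compose2[OF phi_continuous]) auto

text \<open>The zeroth power of \<open>A\<close> alone contributes norm at least one.\<close>

lemma alpha_pos: "0 < alpha A \<kappa>"
proof -
  obtain i :: 'd where True by blast
  have "norm (matrix_pow A 0 *v axis i 1) \<le> opnorm (matrix_pow A 0) * norm (axis i 1 :: real ^ 'd)"
    by (rule norm_matrix_vector_le_opnorm)
  then have "1 \<le> opnorm (matrix_pow A 0)" by simp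
  also have "opnorm (matrix_pow A 0) \<le> (\<Sum>i. opnorm (matrix_pow A i))"
    using sum_le_suminf[OF summable_opnorm_matrix_pow[OF rho], of "{0}"] by (simp add: opnorm_nonneg)
  finally show ?thesis using kappa by (simp add: alpha_def)
qed

lemma norm_s_le: assumes k: "k \<le> r" shows "norm (s n k t) \<le> alpha A \<kappa>"
proof -
  have "norm (s n k t) \<le> (\<Sum>j<n. opnorm (matrix_pow A j) * \<kappa>)"
    unfolding graph_sum_def
  proof (rule sum_norm_le)
    fix j
    have "1 \<le> real l ^ Suc j" using l2 by (intro one_le_power) simp
    then have "(1 / real l ^ Suc j) ^ k \<le> 1" by (intro power_le_one) (auto simp: field_simps simp del: power_Suc)
    then have "norm ((1 / real l ^ Suc j) ^ k *\<^sub>R (matrix_pow A j *v nth_vderiv k \<phi> (t / real l ^ Suc j)))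
       \<le> 1 * norm (matrix_pow A j *v nth_vderiv k \<phi> (t / real l ^ Suc j))"
      unfolding norm_scaleR by (intro mult_right_mono) (auto simp del: power_Suc)
    also have "\<dots> \<le> opnorm (matrix_pow A j) * norm (nth_vderiv k \<phi> (t / real l ^ Suc j))"
      using norm_matrix_vector_le_opnorm by simp
    also have "\<dots> \<le> opnorm (matrix_pow A j) * \<kappa>"
      by (intro mult_left_mono phi_bound k opnorm_nonneg)
    finally show "norm ((1 / real l ^ Suc j) ^ k *\<^sub>R (matrix_pow A j *v nth_vderiv k \<phi> (t / real l ^ Suc j)))
       \<le> opnorm (matrix_pow A j) * \<kappa>" .
  qed
  also have "\<dots> = \<kappa> * (\<Sum>j<n. opnorm (matrix_pow A j))"
    by (simp add: sum_distrib_left mult.commute)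
  also have "\<dots> \<le> alpha A \<kappa>"
    unfolding alpha_def using kappa
    by (intro mult_left_mono sum_le_suminf summable_opnorm_matrix_pow rho) (auto simp: opnorm_nonneg)
  finally show ?thesis .
qed

lemma s_periodic:
  assumes k: "k \<le> r" shows "s n k (t + real (l ^ n * M)) = s n k t"
  unfolding graph_sum_def
proof (rule sum.cong[OF refl])
  fix j assume "j \<in> {..<n}"
  then obtain d where d: "n = Suc j + d" by (metis lessThan_iff less_iff_Suc_add add_Suc)
  have "(t + real (l ^ n * M)) / real l ^ Suc j = t / real l ^ Suc j + real (l ^ d * M)"
    using l_pos by (simp add: d power_add field_simps)
  then show "(1 / real l ^ Suc j) ^ k *\<^sub>R (matrix_pow A j *v nth_vderiv k \<phi> ((t + real (l ^ n * M)) / real l ^ Suc j)) =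
     (1 / real l ^ Suc j) ^ k *\<^sub>R (matrix_pow A j *v nth_vderiv k \<phi> (t / real l ^ Suc j))"
    by (simp only: periodic_add_nat[of "nth_vderiv k \<phi>", OF phi_deriv_periodic[OF k]])
qed

text \<open>The first \<open>q\<close> summands form \<open>s\<^sub>q\<close>; the factor \<open>A\<^sup>q\<close> can be taken out of the others.  This is the cocycle
  relation \<open>S(x, ab) = S(x, a) + A\<^sup>q S(\<tau>\<^sub>a^(-q) x, b)\<close>.\<close>

lemma s_add: "s (q + n) k t = s q k t + (1 / real l ^ q) ^ k *\<^sub>R (matrix_pow A q *v s n k (t / real l ^ q))"
proof -
  have "s (q + n) k t = s q k t + (\<Sum>j<n. (1 / real l ^ Suc (q + j)) ^ k *\<^sub>R
      (matrix_pow A (q + j) *v nth_vderiv k \<phi> (t / real l ^ Suc (q + j))))"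
    unfolding graph_sum_def by (induction n) (simp_all add: add_ac)
  also have "(\<Sum>j<n. (1 / real l ^ Suc (q + j)) ^ k *\<^sub>R
      (matrix_pow A (q + j) *v nth_vderiv k \<phi> (t / real l ^ Suc (q + j))))
    = (1 / real l ^ q) ^ k *\<^sub>R (matrix_pow A q *v s n k (t / real l ^ q))"
    unfolding graph_sum_def vec.sum scaleR_sum_right
  proof (rule sum.cong[OF refl])
    fix j
    have "(1 / real l ^ Suc (q + j)) ^ k = (1 / real l ^ q) ^ k * (1 / real l ^ Suc j) ^ k"
      by (simp add: power_add power_mult_distrib power_divide)
    moreover have "t / real l ^ Suc (q + j) = t / real l ^ q / real l ^ Suc j"
      by (simp add: power_add mult_ac)
    ultimately show "(1 / real l ^ Suc (q + j)) ^ k *\<^sub>R (matrix_pow A (q + j) *v nth_vderiv k \<phi> (t / real l ^ Suc (q + j)))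
      = (1 / real l ^ q) ^ k *\<^sub>R (matrix_pow A q *v ((1 / real l ^ Suc j) ^ k *\<^sub>R (matrix_pow A j *v nth_vderiv k \<phi> (t / real l ^ q / real l ^ Suc j))))"
      by (simp only: matrix_pow_add matrix_vector_mult_scaleR scaleR_scaleR matrix_vector_mul_assoc)
  qed
  finally show ?thesis .
qed

lemma inner_matrix_pow: "\<eta> \<bullet> (matrix_pow A q *v w) = B q \<eta> \<bullet> w"
  by (simp add: transpose_matrix_vector dot_lmul_matrix)

text \<open>Words of length \<open>q + n\<close> correspond to pairs \<open>(N, N')\<close>.  The code \<open>N\<close> of the prefix alone determines the
  first term, by periodicity, and \<open>N'\<close> appears only in the second one, whose derivatives carry a factor
  \<open>1 / l^q\<close>.\<close>

lemma inner_s_add: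
  assumes k: "k \<le> r"
  shows "\<eta> \<bullet> s (q + n) k (x + real (N + l ^ q * N')) =
    \<eta> \<bullet> s q k (x + real N) + (1 / real l ^ q) ^ k * (B q \<eta> \<bullet> s n k ((x + real N) / real l ^ q + real N'))"
proof -
  have "s q k (x + real (N + l ^ q * N')) = s q k (x + real N)"
    using s_periodic[OF k, of q "x + real N" N'] by (simp add: add.assoc)
  moreover have "(x + real (N + l ^ q * N')) / real l ^ q = (x + real N) / real l ^ q + real N'"
    using l_pos by (simp add: field_simps)
  ultimately show ?thesis by (simp only: s_add inner_add_right inner_scaleR_right inner_matrix_pow)
qed

lemma fibre_char_continuous: "continuous_on UNIV (fibre_char n \<eta>)"
  unfolding fibre_char_def
  by (intro continuous_intros continuous_on_compose2[OF s_continuous]) auto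

lemma fibre_char_continuous_compose: "continuous_on S f \<Longrightarrow> continuous_on S (\<lambda>x. fibre_char n \<eta> (f x))"
  by (rule continuous_on_compose2[OF fibre_char_continuous]) auto

text \<open>Translation by one permutes the summands cyclically.\<close>

lemma fibre_char_periodic: "fibre_char n \<eta> (t + 1) = fibre_char n \<eta> t"
proof -
  let ?g = "\<lambda>N. cyc (\<eta> \<bullet> s n 0 (t + real N))"
  have "(\<Sum>N<l ^ n. cyc (\<eta> \<bullet> s n 0 (t + 1 + real N))) = (\<Sum>N<l ^ n. ?g (Suc N))"
    by (simp add: add_ac)
  also have "\<dots> = (\<Sum>N<Suc (l ^ n). ?g N) - ?g 0"
    by (subst sum.lessThan_Suc_shift) simp
  also have "\<dots> = (\<Sum>N<l ^ n. ?g N)"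
    using s_periodic[of 0 n t 1] by simp
  finally show ?thesis by (simp add: fibre_char_def)
qed

lemma cmod_fibre_char_le: "cmod (fibre_char n \<eta> t) \<le> 1"
proof -
  have "cmod (\<Sum>N<l ^ n. cyc (\<eta> \<bullet> s n 0 (t + real N))) \<le> (\<Sum>N<l ^ n. 1)"
    by (rule sum_norm_le) simp
  then show ?thesis by (simp add: fibre_char_def norm_divide norm_power)
qed

text \<open>Group the words of length \<open>q + n\<close> by their prefix of length \<open>q\<close>.\<close>

lemma fibre_char_add: "fibre_char (q + n) \<eta> x =
  (\<Sum>N<l ^ q. cyc (\<eta> \<bullet> s q 0 (x + real N)) * fibre_char n (B q \<eta>) ((x + real N) / real l ^ q)) / of_nat (l ^ q)"
proof -
  have "(\<Sum>N<l ^ (q + n). cyc (\<eta> \<bullet> s (q + n) 0 (x + real N)))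
    = (\<Sum>N<l ^ q. \<Sum>N'<l ^ n. cyc (\<eta> \<bullet> s (q + n) 0 (x + real (N + l ^ q * N'))))"
    unfolding power_add by (rule sum_lessThan_mult)
  also have "\<dots> = (\<Sum>N<l ^ q. cyc (\<eta> \<bullet> s q 0 (x + real N)) *
      (\<Sum>N'<l ^ n. cyc (B q \<eta> \<bullet> s n 0 ((x + real N) / real l ^ q + real N'))))"
    by (simp only: inner_s_add[OF le0] cyc_add sum_distrib_left power_0 mult_1)
  also have "\<dots> = (\<Sum>N<l ^ q. cyc (\<eta> \<bullet> s q 0 (x + real N)) * fibre_char n (B q \<eta>) ((x + real N) / real l ^ q)) * of_nat (l ^ n)"
    by (simp add: fibre_char_def sum_distrib_right)
  finally show ?thesis
    by (simp add: fibre_char_def[of "q + n"] power_add)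
qed

lemma fibre_energy_nonneg: "0 \<le> fibre_energy n \<eta>"
  unfolding fibre_energy_def by (rule integral_nonneg) (auto intro!: integrable_continuous_real continuous_intros fibre_char_continuous_compose)

lemma fibre_energy_le_1: "fibre_energy n \<eta> \<le> 1"
proof -
  have "fibre_energy n \<eta> \<le> integral {0..1} (\<lambda>x::real. 1::real)"
    unfolding fibre_energy_def
    by (intro integral_le)
      (auto intro!: integrable_continuous_real continuous_intros fibre_char_continuous_compose power_le_one cmod_fibre_char_le)
  then show ?thesis by simp
qed

end

section \<open>Words with non-stationary phase\<close>

lemma parabola_ge:
  fixes y L :: real
  assumes "0 < L" "L / 2 \<le> y" "y \<le> 3 * L / 2"
  shows "3 / 4 \<le> y * (2 * L - y) / L\<^sup>2"
proof -
  have "0 \<le> (y - L / 2) * (3 * L / 2 - y)" using assms by (intro mult_nonneg_nonneg) auto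
  then have "3 / 4 * L\<^sup>2 \<le> y * (2 * L - y)" by (simp add: power2_eq_square field_simps)
  then show ?thesis using assms(1) by (simp add: pos_le_divide_eq)
qed

text \<open>For fixed \<open>q\<close> the comparability of \<open>|\<eta>|\<close> and \<open>|(A\<^sup>q)\<^sup>T\<eta>|\<close> is all that matters, so the
  constant is left unspecified.\<close>

lemma norm_le_transpose_matrix:
  fixes M :: "real ^ 'd ^ 'd"
  assumes "invertible M"
  shows "\<exists>K>0. \<forall>\<eta>. norm \<eta> \<le> K * norm (transpose M *v \<eta>)"
proof -
  obtain M1 where "M ** M1 = mat 1"
    using assms by (auto simp: invertible_def)
  then have "transpose M1 ** transpose M = mat 1"
    by (metis matrix_transpose_mul transpose_mat)
  then obtain M' where "M' ** transpose M = mat 1" by blast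
  then have eq: "M' *v (transpose M *v \<eta>) = \<eta>" for \<eta>
    by (simp only: matrix_vector_mul_assoc matrix_vector_mul_lid)
  have "norm \<eta> \<le> (opnorm M' + 1) * norm (transpose M *v \<eta>)" for \<eta>
  proof -
    have "norm \<eta> \<le> opnorm M' * norm (transpose M *v \<eta>)"
      using norm_matrix_vector_le_opnorm[of M' "transpose M *v \<eta>"] unfolding eq .
    also have "\<dots> \<le> (opnorm M' + 1) * norm (transpose M *v \<eta>)"
      by (intro mult_right_mono) auto
    finally show ?thesis .
  qed
  moreover have "0 < opnorm M' + 1" using opnorm_nonneg[of M'] by linarith
  ultimately show ?thesis by blast
qed

context solenoidal
begin

lemma phase_tower:
  assumes "j < r"
  shows "((\<lambda>x. \<eta> \<bullet> s n j (x + T)) has_real_derivative (\<eta> \<bullet> s n (Suc j) (x + T))) (at x)"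
proof -
  have "(s n j has_vector_derivative s n (Suc j) (x + T)) (at (x + T))"
    by (rule s_has_vector_derivative[OF assms])
  moreover have "((\<lambda>x. x + T) has_vector_derivative 1) (at x)"
    by (auto intro!: derivative_eq_intros)
  ultimately have "((s n j \<circ> (\<lambda>x. x + T)) has_vector_derivative (1 *\<^sub>R s n (Suc j) (x + T))) (at x)"
    by (intro vector_diff_chain_at)
  then have "((\<lambda>x. s n j (x + T)) has_vector_derivative s n (Suc j) (x + T)) (at x)"
    by (simp add: o_def)
  from bounded_linear.has_vector_derivative[OF bounded_linear_inner_right this]
  show ?thesis by (simp add: has_real_derivative_iff_has_vector_derivative)
qed

lemma inner_s_le: "k \<le> r \<Longrightarrow> \<bar>\<eta> \<bullet> s n k t\<bar> \<le> norm \<eta> * alpha A \<kappa>"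
  by (rule order_trans[OF Cauchy_Schwarz_ineq2]) (intro mult_left_mono norm_s_le norm_ge_zero)

lemma phase_Ck_bounded:
  "Ck_bounded J {} (r - 2) (norm \<eta> * alpha A \<kappa>) (\<lambda>x. \<eta> \<bullet> s n 2 (x + T))"
proof -
  have "Ck_bounded J {} (r - 2) (norm \<eta> * alpha A \<kappa>) ((\<lambda>j x. \<eta> \<bullet> s n (j + 2) (x + T)) 0)"
  proof (rule Ck_bounded_tower)
    show "((\<lambda>x. \<eta> \<bullet> s n (j + 2) (x + T)) has_real_derivative (\<eta> \<bullet> s n (Suc j + 2) (x + T))) (at x)"
      if "j < r - 2" for j x
      using phase_tower[of "j + 2"] that by simp
    show "continuous_on UNIV (\<lambda>x. \<eta> \<bullet> s n (r - 2 + 2) (x + T))"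
      using r2 by (intro continuous_intros continuous_on_compose2[OF s_continuous]) auto
    show "\<bar>\<eta> \<bullet> s n (j + 2) (x + T)\<bar> \<le> norm \<eta> * alpha A \<kappa>" if "j \<le> r - 2" for j x
      using that r2 by (intro inner_s_le) simp
  qed
  then show ?thesis by (simp add: numeral_2_eq_2)
qed

text \<open>A cutoff to an arc of length \<open>2L\<close>, scaled to have maximum one.  It is at least \<open>(3/4)^(r-1)\<close> on the middle
  half of the arc, a bound independent of \<open>L\<close>; this keeps the constant in front of \<open>M(q)\<close>
  independent of \<open>q\<close>.\<close>

definition bump :: "real \<Rightarrow> real \<Rightarrow> real \<Rightarrow> real" where
  "bump L u x = ((x - u) * (u + 2 * L - x) / L\<^sup>2) ^ (r - 1)"

text \<open>The bound from \<open>Ck_bounded_bump\<close> with both exponents equal to \<open>r - 1\<close>, rescaled.  It depends on the arc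
  only through its length.\<close>

definition bump_const :: "real \<Rightarrow> real" where
  "bump_const L = (1 / L ^ 2) ^ (r - 1) * real (2 * (r - 1)) ^ (r - 1)"

lemma bump_Ck_bounded:
  assumes L: "0 < L" "2 * L \<le> 1"
  shows "Ck_bounded {u..u + 2 * L} {u, u + 2 * L} (r - 1) (bump_const L) (bump L u)"
proof -
  have "Ck_bounded {u..u + 2 * L} {u, u + 2 * L} (r - 1) (\<bar>(1 / L ^ 2) ^ (r - 1)\<bar> * real ((r - 1) + (r - 1)) ^ (r - 1))
     (\<lambda>x. (1 / L ^ 2) ^ (r - 1) * ((x - u) ^ (r - 1) * (u + 2 * L - x) ^ (r - 1)))"
    using L by (intro Ck_bounded_cmult Ck_bounded_bump) auto
  moreover have "(\<lambda>x. (1 / L ^ 2) ^ (r - 1) * ((x - u) ^ (r - 1) * (u + 2 * L - x) ^ (r - 1))) = bump L u"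
    by (simp add: bump_def fun_eq_iff power_mult_distrib power_divide)
  moreover have "\<bar>(1 / L ^ 2) ^ (r - 1)\<bar> * real ((r - 1) + (r - 1)) ^ (r - 1) = bump_const L"
  proof -
    have "0 \<le> (1 / L ^ 2) ^ (r - 1)" by simp
    then show ?thesis by (simp only: bump_const_def abs_of_nonneg mult_2)
  qed
  ultimately show ?thesis by simp
qed

lemma bump_continuous: "L \<noteq> 0 \<Longrightarrow> continuous_on S (bump L u)"
  unfolding bump_def by (intro continuous_intros) auto

lemma bump_ends: "bump L u u = 0" "bump L u (u + 2 * L) = 0"
  using r2 by (auto simp: bump_def power_0_left)

lemma bump_bounds:
  assumes L: "0 < L" and x: "x \<in> {u..u + 2 * L}"
  shows "0 \<le> bump L u x" "bump L u x \<le> 1"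
proof -
  have 1: "0 \<le> (x - u) * (u + 2 * L - x) / L\<^sup>2" using L x by (intro divide_nonneg_nonneg mult_nonneg_nonneg) auto
  have "0 \<le> (x - u - L)\<^sup>2" by simp
  then have "(x - u) * (u + 2 * L - x) \<le> 1 * L\<^sup>2" by (simp add: power2_eq_square algebra_simps)
  then have 2: "(x - u) * (u + 2 * L - x) / L\<^sup>2 \<le> 1" using L by (simp add: pos_divide_le_eq)
  show "0 \<le> bump L u x" "bump L u x \<le> 1"
    unfolding bump_def using 1 2 by (auto intro: power_le_one)
qed

lemma bump_ge:
  assumes L: "0 < L" and x: "x \<in> {u + L / 2..u + 3 * L / 2}"
  shows "(3 / 4) ^ (r - 1) \<le> bump L u x"
proof -
  have "3 / 4 \<le> (x - u) * (2 * L - (x - u)) / L\<^sup>2"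
    using L x by (intro parabola_ge) auto
  then show ?thesis unfolding bump_def by (intro power_mono) (auto simp: algebra_simps)
qed

text \<open>A good word keeps \<open>|\<xi> + \<eta>\<sqdot>s\<^sub>q'|\<close> above \<open>2c\<close> for \<open>c = \<alpha> |(A^q)\<^sup>T \<eta>| / l^q\<close>, and any continuation of the word
  changes the phase derivative by at most \<open>c\<close>.  So all phases that occur in \<open>fibre_char\<close> are
  non-stationary with the same constant, and the bound for each continuation passes to their average.\<close>

lemma good_words_sum:
  fixes q n N :: nat and \<eta> :: "real ^ 'd" and L u \<Lambda> :: real and X :: "int set"
  assumes L: "0 < L" "2 * L \<le> 1" and X: "finite X"
    and \<Lambda>: "0 \<le> \<Lambda>" "norm \<eta> * real l ^ q \<le> \<Lambda> * norm (B q \<eta>)" and \<eta>: "\<eta> \<noteq> 0"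
    and good: "\<And>\<xi> x. \<xi> \<in> X \<Longrightarrow> x \<in> {u..u + 2 * L} \<Longrightarrow>
      2 * alpha A \<kappa> / real l ^ q * norm (B q \<eta>) \<le> \<bar>real_of_int \<xi> + \<eta> \<bullet> s q 1 (x + real N)\<bar>"
  shows "(\<Sum>\<xi>\<in>X. (cmod (integral {u..u + 2 * L} (\<lambda>x. cyc (\<xi> * x) *
      (of_real (bump L u x) * (cyc (\<eta> \<bullet> s q 0 (x + real N)) * fibre_char n (B q \<eta>) ((x + real N) / real l ^ q))))))\<^sup>2)
    \<le> (osc_const \<Lambda> (r - 1) 0 * bump_const L / (alpha A \<kappa> / real l ^ q * norm (B q \<eta>)) ^ (r - 1))\<^sup>2"
proof -
  define c where "c = alpha A \<kappa> / real l ^ q * norm (B q \<eta>)"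
  define K where "K = osc_const \<Lambda> (r - 1) 0 * bump_const L / c ^ (r - 1)"
  have "norm (B q \<eta>) \<noteq> 0"
  proof
    assume "norm (B q \<eta>) = 0"
    then have "norm \<eta> * real l ^ q \<le> 0" using \<Lambda>(2) by simp
    moreover have "0 < norm \<eta> * real l ^ q" using \<eta> l_pos by simp
    ultimately show False by linarith
  qed
  then have c: "0 < c" unfolding c_def using alpha_pos l_pos by (intro mult_pos_pos divide_pos_pos) auto
  let ?J = "{u..u + 2 * L}"
  define I where "I N' \<xi> = integral ?J (\<lambda>x. cyc (real_of_int \<xi> * x + \<eta> \<bullet> s (q + n) 0 (x + real (N + l ^ q * N'))) *
      of_real (1 / (real_of_int \<xi> + \<eta> \<bullet> s (q + n) 1 (x + real (N + l ^ q * N'))) ^ 0 * bump L u x))" for N' and \<xi> :: int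
  have osc: "(\<Sum>\<xi>\<in>X. (cmod (I N' \<xi>))\<^sup>2) \<le> K\<^sup>2" for N'
  proof -
    let ?T = "real (N + l ^ q * N')"
    have 1: "((\<lambda>x. \<eta> \<bullet> s (q + n) 0 (x + ?T)) has_real_derivative (\<eta> \<bullet> s (q + n) 1 (x + ?T))) (at x within ?J)" for x
      using phase_tower[of 0 \<eta> "q + n" ?T x] r2 by (simp add: has_field_derivative_at_within)
    have 2: "((\<lambda>x. \<eta> \<bullet> s (q + n) 1 (x + ?T)) has_real_derivative (\<eta> \<bullet> s (q + n) 2 (x + ?T))) (at x within ?J)" for x
      using phase_tower[of 1 \<eta> "q + n" ?T x] r2
      by (simp add: has_field_derivative_at_within numeral_2_eq_2)
    have 3: "c \<le> \<bar>real_of_int \<xi> + \<eta> \<bullet> s (q + n) 1 (x + ?T)\<bar>" if "\<xi> \<in> X" "x \<in> ?J" for \<xi> x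
    proof -
      have "\<bar>B q \<eta> \<bullet> s n 1 ((x + real N) / real l ^ q + real N')\<bar> \<le> norm (B q \<eta>) * alpha A \<kappa>"
        using r2 by (intro inner_s_le) simp
      then have "(1 / real l ^ q) ^ 1 * \<bar>B q \<eta> \<bullet> s n 1 ((x + real N) / real l ^ q + real N')\<bar>
          \<le> (1 / real l ^ q) ^ 1 * (norm (B q \<eta>) * alpha A \<kappa>)"
        by (intro mult_left_mono) auto
      also have "\<dots> = c" by (simp add: c_def)
      finally have "\<bar>(1 / real l ^ q) ^ 1 * (B q \<eta> \<bullet> s n 1 ((x + real N) / real l ^ q + real N'))\<bar> \<le> c"
        by (simp add: abs_mult)
      moreover have "2 * c \<le> \<bar>real_of_int \<xi> + \<eta> \<bullet> s q 1 (x + real N)\<bar>"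
        using good[OF that] by (simp add: c_def)
      moreover have "\<eta> \<bullet> s (q + n) 1 (x + ?T) = \<eta> \<bullet> s q 1 (x + real N) +
          (1 / real l ^ q) ^ 1 * (B q \<eta> \<bullet> s n 1 ((x + real N) / real l ^ q + real N'))"
        using r2 by (intro inner_s_add) simp
      ultimately show ?thesis by linarith
    qed
    have "norm \<eta> * alpha A \<kappa> = norm \<eta> * real l ^ q * (alpha A \<kappa> / real l ^ q)" using l2 by simp
    also have "\<dots> \<le> \<Lambda> * norm (B q \<eta>) * (alpha A \<kappa> / real l ^ q)"
      using \<Lambda>(2) alpha_pos by (intro mult_right_mono) (auto intro: less_imp_le)
    also have "\<dots> = \<Lambda> * c" by (simp add: c_def)
    \<comment> \<open>\<open>r - 1\<close> integrations by parts use \<open>r - 2\<close> derivatives of the second derivative of the phase\<close>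
    finally have 4: "Ck_bounded ?J {} (r - 1 - 1) (\<Lambda> * c) (\<lambda>x. \<eta> \<bullet> s (q + n) 2 (x + ?T))"
      using Ck_bounded_mono[OF phase_Ck_bounded] by (simp add: numeral_2_eq_2)
    have "(\<Sum>\<xi>\<in>X. (cmod (I N' \<xi>))\<^sup>2) \<le> (osc_const \<Lambda> (r - 1) 0 * bump_const L / c ^ (r - 1 + 0))\<^sup>2"
      unfolding I_def
      by (rule oscillatory_sum[OF _ _ c \<Lambda>(1) X 1 2 3 4 bump_Ck_bounded[OF L]]) (use L in auto)
    then show ?thesis by (simp add: K_def)
  qed
  have avg: "integral ?J (\<lambda>x. cyc (\<xi> * x) *
      (of_real (bump L u x) * (cyc (\<eta> \<bullet> s q 0 (x + real N)) * fibre_char n (B q \<eta>) ((x + real N) / real l ^ q))))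
    = (\<Sum>N'<l ^ n. I N' \<xi>) / of_nat (l ^ n)" for \<xi> :: int
  proof -
    have "cyc (\<xi> * x) * (of_real (bump L u x) * (cyc (\<eta> \<bullet> s q 0 (x + real N)) * fibre_char n (B q \<eta>) ((x + real N) / real l ^ q)))
      = (\<Sum>N'<l ^ n. cyc (real_of_int \<xi> * x + \<eta> \<bullet> s (q + n) 0 (x + real (N + l ^ q * N'))) *
      of_real (1 / (real_of_int \<xi> + \<eta> \<bullet> s (q + n) 1 (x + real (N + l ^ q * N'))) ^ 0 * bump L u x)) / of_nat (l ^ n)" for x :: real
    proof -
      have "cyc (real_of_int \<xi> * x + \<eta> \<bullet> s (q + n) 0 (x + real (N + l ^ q * N'))) *
         of_real (1 / (real_of_int \<xi> + \<eta> \<bullet> s (q + n) 1 (x + real (N + l ^ q * N'))) ^ 0 * bump L u x)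
       = cyc (\<xi> * x) * of_real (bump L u x) * cyc (\<eta> \<bullet> s q 0 (x + real N)) *
         cyc (B q \<eta> \<bullet> s n 0 ((x + real N) / real l ^ q + real N'))" for N'
        by (simp only: inner_s_add[OF le0] cyc_add power_0 mult_1 div_by_1) (simp only: mult_ac)
      then show ?thesis by (simp only: fibre_char_def sum_distrib_left[symmetric] times_divide_eq_right mult.assoc)
    qed
    then have "integral ?J (\<lambda>x. cyc (\<xi> * x) *
      (of_real (bump L u x) * (cyc (\<eta> \<bullet> s q 0 (x + real N)) * fibre_char n (B q \<eta>) ((x + real N) / real l ^ q))))
      = integral ?J (\<lambda>x. (\<Sum>N'<l ^ n. cyc (real_of_int \<xi> * x + \<eta> \<bullet> s (q + n) 0 (x + real (N + l ^ q * N'))) *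
      of_real (1 / (real_of_int \<xi> + \<eta> \<bullet> s (q + n) 1 (x + real (N + l ^ q * N'))) ^ 0 * bump L u x)) / of_nat (l ^ n))"
      by simp
    also have "\<dots> = (\<Sum>N'<l ^ n. I N' \<xi>) / of_nat (l ^ n)"
    proof (intro integral_unique has_integral_divide has_integral_sum finite_lessThan)
      fix N'
      show "((\<lambda>x. cyc (real_of_int \<xi> * x + \<eta> \<bullet> s (q + n) 0 (x + real (N + l ^ q * N'))) *
        of_real (1 / (real_of_int \<xi> + \<eta> \<bullet> s (q + n) 1 (x + real (N + l ^ q * N'))) ^ 0 * bump L u x)) has_integral I N' \<xi>) ?J"
        unfolding I_def power_0 div_by_1 mult_1 using L(1)
        by (intro integrable_integral integrable_continuous_real continuous_intros bump_continuous
            continuous_on_compose2[OF s_continuous]) auto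
    qed
    finally show ?thesis .
  qed
  have "(\<Sum>\<xi>\<in>X. (cmod ((\<Sum>N'<l ^ n. I N' \<xi>) / of_nat (l ^ n)))\<^sup>2)
    \<le> (\<Sum>\<xi>\<in>X. (\<Sum>N'<l ^ n. (cmod (I N' \<xi>))\<^sup>2) / real (l ^ n))"
  proof (rule sum_mono)
    fix \<xi>
    have pos: "0 < real (l ^ n)" by simp
    have "(cmod ((\<Sum>N'<l ^ n. I N' \<xi>) / of_nat (l ^ n)))\<^sup>2 = (cmod (\<Sum>N'<l ^ n. I N' \<xi>))\<^sup>2 / (real (l ^ n))\<^sup>2"
      by (simp only: norm_divide norm_of_nat power_divide)
    also have "\<dots> \<le> (real (l ^ n) * (\<Sum>N'<l ^ n. (cmod (I N' \<xi>))\<^sup>2)) / (real (l ^ n))\<^sup>2"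
      using cmod_sum_squared_le[of "{..<l ^ n}" "\<lambda>N'. I N' \<xi>"]
      by (intro divide_right_mono) simp_all
    also have "\<dots> = (\<Sum>N'<l ^ n. (cmod (I N' \<xi>))\<^sup>2) / real (l ^ n)"
      using pos by (simp add: power2_eq_square del: of_nat_power)
    finally show "(cmod ((\<Sum>N'<l ^ n. I N' \<xi>) / of_nat (l ^ n)))\<^sup>2 \<le> (\<Sum>N'<l ^ n. (cmod (I N' \<xi>))\<^sup>2) / real (l ^ n)" .
  qed
  also have "\<dots> = (\<Sum>N'<l ^ n. \<Sum>\<xi>\<in>X. (cmod (I N' \<xi>))\<^sup>2) / real (l ^ n)"
    unfolding sum_divide_distrib[symmetric] by (subst sum.swap) (rule refl)
  also have "\<dots> \<le> (\<Sum>N'<l ^ n. K\<^sup>2) / real (l ^ n)"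
    by (intro divide_right_mono sum_mono osc) auto
  also have "\<dots> = K\<^sup>2" by simp
  finally show ?thesis unfolding avg K_def c_def .
qed

end

section \<open>The recursive inequality for a fixed frequency\<close>

context solenoidal
begin

text \<open>The points \<open>(x + N) / l^q\<close> are the preimages of \<open>x\<close> under the \<open>q\<close>-th iterate of the base map.\<close>

definition preimage_energy :: "nat \<Rightarrow> nat \<Rightarrow> real ^ 'd \<Rightarrow> real \<Rightarrow> real" where
  "preimage_energy q n \<eta> x = (\<Sum>N<l ^ q. (cmod (fibre_char n (B q \<eta>) ((x + real N) / real l ^ q)))\<^sup>2)"

lemma preimage_energy_continuous: "continuous_on S (preimage_energy q n \<eta>)"
  unfolding preimage_energy_def using l2
  by (intro continuous_intros fibre_char_continuous_compose) auto

lemma preimage_energy_periodic: "preimage_energy q n \<eta> (x + 1) = preimage_energy q n \<eta> x"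
proof -
  let ?g = "\<lambda>N. (cmod (fibre_char n (B q \<eta>) ((x + real N) / real l ^ q)))\<^sup>2"
  have "preimage_energy q n \<eta> (x + 1) = (\<Sum>N<l ^ q. ?g (Suc N))"
    unfolding preimage_energy_def by (intro sum.cong) (simp_all add: add_ac)
  also have "\<dots> = (\<Sum>N<Suc (l ^ q). ?g N) - ?g 0"
    by (subst sum.lessThan_Suc_shift) simp
  also have "?g (l ^ q) = ?g 0"
  proof -
    have "(x + real (l ^ q)) / real l ^ q = x / real l ^ q + 1" using l2 by (simp add: add_divide_distrib)
    then show ?thesis by (simp add: fibre_char_periodic)
  qed
  then have "(\<Sum>N<Suc (l ^ q). ?g N) - ?g 0 = (\<Sum>N<l ^ q. ?g N)" by simp
  finally show ?thesis by (simp add: preimage_energy_def)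
qed

lemma integral_preimage_energy:
  "integral {0..1} (preimage_energy q n \<eta>) = real (l ^ q) * fibre_energy n (B q \<eta>)"
proof -
  have "integral {0..1} (preimage_energy q n \<eta>)
     = integral {0..1} (\<lambda>x. \<Sum>N<l ^ q. (cmod (fibre_char n (B q \<eta>) ((x + real N) / real (l ^ q))))\<^sup>2)"
    by (simp add: preimage_energy_def[abs_def])
  also have "\<dots> = real (l ^ q) * integral {0..1} (\<lambda>x. (cmod (fibre_char n (B q \<eta>) x))\<^sup>2)"
    by (rule integral_sum_preimages)
       (auto intro!: continuous_intros fibre_char_continuous_compose simp: fibre_char_periodic)
  finally show ?thesis by (simp add: fibre_energy_def)
qed

text \<open>Cauchy-Schwarz is applied separately to both groups, so that the bad one costs only its own
  cardinality.\<close>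

lemma split_bad_good:
  fixes w :: "nat \<Rightarrow> complex"
  assumes bad: "Bd \<subseteq> {..<\<beta>}" "card Bd \<le> M"
  shows "(cmod (\<Sum>N<\<beta>. w N))\<^sup>2 \<le> 2 * (real M * (\<Sum>N<\<beta>. (cmod (w N))\<^sup>2)
     + real \<beta> * (\<Sum>N<\<beta>. if N \<notin> Bd then (cmod (w N))\<^sup>2 else 0))"
proof -
  have fin: "finite Bd" using bad(1) by (rule finite_subset) simp
  have "(\<Sum>N<\<beta>. w N) = (\<Sum>N\<in>Bd. w N) + (\<Sum>N\<in>{N\<in>{..<\<beta>}. N \<notin> Bd}. w N)"
  proof -
    have "{..<\<beta>} = Bd \<union> {N\<in>{..<\<beta>}. N \<notin> Bd}" using bad(1) by auto
    then have "(\<Sum>N<\<beta>. w N) = sum w (Bd \<union> {N\<in>{..<\<beta>}. N \<notin> Bd})" by (rule arg_cong)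
    also have "\<dots> = (\<Sum>N\<in>Bd. w N) + (\<Sum>N\<in>{N\<in>{..<\<beta>}. N \<notin> Bd}. w N)"
      using fin by (intro sum.union_disjoint) auto
    finally show ?thesis .
  qed
  then have "(cmod (\<Sum>N<\<beta>. w N))\<^sup>2 \<le> 2 * ((cmod (\<Sum>N\<in>Bd. w N))\<^sup>2 + (cmod (\<Sum>N\<in>{N\<in>{..<\<beta>}. N \<notin> Bd}. w N))\<^sup>2)"
    using norm_add_sq_le by simp
  also have "(cmod (\<Sum>N\<in>Bd. w N))\<^sup>2 \<le> real M * (\<Sum>N<\<beta>. (cmod (w N))\<^sup>2)"
  proof -
    have "(cmod (\<Sum>N\<in>Bd. w N))\<^sup>2 \<le> real (card Bd) * (\<Sum>N\<in>Bd. (cmod (w N))\<^sup>2)"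
      by (rule cmod_sum_squared_le[OF fin])
    also have "\<dots> \<le> real M * (\<Sum>N<\<beta>. (cmod (w N))\<^sup>2)"
      using bad by (intro mult_mono sum_mono2) (auto intro: sum_nonneg)
    finally show ?thesis .
  qed
  also have "(cmod (\<Sum>N\<in>{N\<in>{..<\<beta>}. N \<notin> Bd}. w N))\<^sup>2
     \<le> real \<beta> * (\<Sum>N<\<beta>. if N \<notin> Bd then (cmod (w N))\<^sup>2 else 0)"
  proof -
    have "card {N\<in>{..<\<beta>}. N \<notin> Bd} \<le> card {..<\<beta>}" by (intro card_mono) auto
    then have "real (card {N\<in>{..<\<beta>}. N \<notin> Bd}) \<le> real \<beta>" by simp
    moreover have "(cmod (\<Sum>N\<in>{N\<in>{..<\<beta>}. N \<notin> Bd}. w N))\<^sup>2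
      \<le> real (card {N\<in>{..<\<beta>}. N \<notin> Bd}) * (\<Sum>N\<in>{N\<in>{..<\<beta>}. N \<notin> Bd}. (cmod (w N))\<^sup>2)"
      by (intro cmod_sum_squared_le) simp
    moreover have "(\<Sum>N\<in>{N\<in>{..<\<beta>}. N \<notin> Bd}. (cmod (w N))\<^sup>2) = (\<Sum>N<\<beta>. if N \<notin> Bd then (cmod (w N))\<^sup>2 else 0)"
      by (rule sum.inter_filter) simp
    moreover have "0 \<le> (\<Sum>N\<in>{N\<in>{..<\<beta>}. N \<notin> Bd}. (cmod (w N))\<^sup>2)" by (intro sum_nonneg) simp
    ultimately show ?thesis
      by (auto intro: order_trans[OF _ mult_right_mono])
  qed
  finally show ?thesis by simp
qed

text \<open>On one arc: approximate Parseval identity, then \<open>split_bad_good\<close> at every frequency.  The bad words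
  are summed over all frequencies by Bessel's inequality and the good ones by \<open>good_words_sum\<close>.\<close>

lemma local_estimate:
  fixes q p n k :: nat and \<eta> :: "real ^ 'd" and \<Lambda> :: real
  defines "L \<equiv> 1 / real l ^ p"
  defines "u \<equiv> real k * L - L / 2"
  defines "K \<equiv> osc_const \<Lambda> (r - 1) 0 * bump_const L / (alpha A \<kappa> / real l ^ q * norm (B q \<eta>)) ^ (r - 1)"
  assumes k: "k < l ^ p" and p: "1 \<le> p" and \<eta>: "\<eta> \<noteq> 0"
    and \<Lambda>: "0 \<le> \<Lambda>" "norm \<eta> * real l ^ q \<le> \<Lambda> * norm (B q \<eta>)"
  shows "integral {real k * L..(real k + 1) * L} (\<lambda>x. (cmod (fibre_char (q + n) \<eta> x))\<^sup>2)
    \<le> (16 / 9) ^ (r - 1) * (2 * real (M_pq l A \<phi> \<kappa> p q) / (real (l ^ q))\<^sup>2 *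
        integral {u..u + 2 * L} (preimage_energy q n \<eta>) + 2 * K\<^sup>2)"
proof -
  define \<beta> where "\<beta> = l ^ q"
  have \<beta>: "0 < \<beta>" by (simp add: \<beta>_def)
  define M where "M = M_pq l A \<phi> \<kappa> p q"
  let ?J = "{u..u + 2 * L}"
  \<comment> \<open>the arc must not be longer than one period; here \<open>p \<ge> 1\<close> enters\<close>
  have "2 ^ 1 \<le> real l ^ 1" using l2 by simp
  also have "\<dots> \<le> real l ^ p" using l2 p by (intro power_increasing) auto
  finally have L: "0 < L" "2 * L \<le> 1" using l2 by (auto simp: L_def)
  define W where "W N x = of_real (bump L u x) * (cyc (\<eta> \<bullet> s q 0 (x + real N)) * fibre_char n (B q \<eta>) ((x + real N) / real l ^ q))" for N and x :: real
  define f where "f x = of_real (bump L u x) * fibre_char (q + n) \<eta> x" for x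
  have W_cont: "continuous_on S (W N)" for S N
    unfolding W_def using L l2
    by (intro continuous_intros bump_continuous fibre_char_continuous_compose continuous_on_compose2[OF s_continuous]) auto
  have f_cont: "continuous_on S f" for S
    unfolding f_def using L by (intro continuous_intros bump_continuous fibre_char_continuous_compose) auto
  have f_eq: "f x = (\<Sum>N<\<beta>. W N x) / of_nat \<beta>" for x
    unfolding f_def fibre_char_add W_def \<beta>_def by (simp add: sum_distrib_left)
  define w where "w N \<xi> = integral ?J (\<lambda>x. cyc (real_of_int \<xi> * x) * W N x)" for N and \<xi> :: int
  have coeff: "integral ?J (\<lambda>x. cyc (real_of_int \<xi> * x) * f x) = (\<Sum>N<\<beta>. w N \<xi>) / of_nat \<beta>" for \<xi>
  proof -
    have "((\<lambda>x. (\<Sum>N<\<beta>. cyc (real_of_int \<xi> * x) * W N x) / of_nat \<beta>) has_integral (\<Sum>N<\<beta>. w N \<xi>) / of_nat \<beta>) ?J"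
      unfolding w_def
      by (intro has_integral_divide has_integral_sum finite_lessThan integrable_integral
          integrable_continuous_real continuous_intros W_cont)
    then show ?thesis by (intro integral_unique) (simp add: f_eq sum_distrib_left)
  qed
  define \<epsilon> where "\<epsilon> = 2 * alpha A \<kappa> / real l ^ q * norm (B q \<eta>)"
  define Bd where "Bd \<xi> = bad_codes l A \<phi> q ?J \<epsilon> \<xi> \<eta>" for \<xi>
  have Bd: "Bd \<xi> \<subseteq> {..<\<beta>}" for \<xi> by (auto simp: Bd_def bad_codes_def \<beta>_def)
  have card_Bd: "card (Bd \<xi>) \<le> M" for \<xi>
    unfolding Bd_def \<epsilon>_def M_def
  proof (rule card_bad_codes_le[where \<phi> = \<phi>, OF _ phi_periodic _ k])
    show "\<phi> differentiable (at x)" for x using phi_differentiable[of 0] r2 by simp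
    show "?J \<subseteq> {(real k - 1) / real l ^ p..<(real k + 2) / real l ^ p}"
      using L(1) by (auto simp: u_def L_def field_simps)
  qed (use l2 in simp)
  have bessel: "(\<Sum>\<xi>\<in>X. (cmod (w N \<xi>))\<^sup>2) \<le> integral ?J (\<lambda>x. (cmod (fibre_char n (B q \<eta>) ((x + real N) / real l ^ q)))\<^sup>2)"
    if "finite X" for X N
  proof -
    have "(\<Sum>\<xi>\<in>X. (cmod (w N \<xi>))\<^sup>2) \<le> integral ?J (\<lambda>x. (cmod (W N x))\<^sup>2)"
      unfolding w_def using L that by (intro bessel_inequality W_cont) auto
    also have "\<dots> \<le> integral ?J (\<lambda>x. (cmod (fibre_char n (B q \<eta>) ((x + real N) / real l ^ q)))\<^sup>2)"
    proof (intro integral_le integrable_continuous_real continuous_intros W_cont fibre_char_continuous_compose)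
      fix x assume x: "x \<in> ?J"
      have "cmod (W N x) = \<bar>bump L u x\<bar> * cmod (fibre_char n (B q \<eta>) ((x + real N) / real l ^ q))"
        by (simp add: W_def norm_mult)
      also have "\<dots> \<le> 1 * cmod (fibre_char n (B q \<eta>) ((x + real N) / real l ^ q))"
        using bump_bounds[OF L(1) x] by (intro mult_right_mono) auto
      finally show "(cmod (W N x))\<^sup>2 \<le> (cmod (fibre_char n (B q \<eta>) ((x + real N) / real l ^ q)))\<^sup>2"
        by (intro power_mono) auto
    qed (use l2 in auto)
    finally show ?thesis .
  qed
  have main: "integral ?J (\<lambda>x. (cmod (f x))\<^sup>2)
     \<le> 2 * real M / (real \<beta>)\<^sup>2 * integral ?J (preimage_energy q n \<eta>) + 2 * K\<^sup>2"
  proof (rule field_le_epsilon)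
    fix e :: real assume "0 < e"
    obtain X :: "int set" where X: "finite X" and le: "integral ?J (\<lambda>x. (cmod (f x))\<^sup>2)
        \<le> (\<Sum>\<xi>\<in>X. (cmod (integral ?J (\<lambda>x. cyc (\<xi> * x) * f x)))\<^sup>2) + e"
      using parseval_approx[OF f_cont _ _ _ _ \<open>0 < e\<close>, of u "u + 2 * L"] L bump_ends
      by (auto simp: f_def)
    have "(\<Sum>\<xi>\<in>X. (cmod (integral ?J (\<lambda>x. cyc (\<xi> * x) * f x)))\<^sup>2)
      \<le> (\<Sum>\<xi>\<in>X. 2 * (real M * (\<Sum>N<\<beta>. (cmod (w N \<xi>))\<^sup>2)
         + real \<beta> * (\<Sum>N<\<beta>. if N \<notin> Bd \<xi> then (cmod (w N \<xi>))\<^sup>2 else 0)) / (real \<beta>)\<^sup>2)"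
    proof (rule sum_mono)
      fix \<xi>
      have "(cmod (integral ?J (\<lambda>x. cyc (\<xi> * x) * f x)))\<^sup>2 = (cmod (\<Sum>N<\<beta>. w N \<xi>))\<^sup>2 / (real \<beta>)\<^sup>2"
        unfolding coeff by (simp add: norm_divide power_divide)
      also have "\<dots> \<le> 2 * (real M * (\<Sum>N<\<beta>. (cmod (w N \<xi>))\<^sup>2)
         + real \<beta> * (\<Sum>N<\<beta>. if N \<notin> Bd \<xi> then (cmod (w N \<xi>))\<^sup>2 else 0)) / (real \<beta>)\<^sup>2"
        by (intro divide_right_mono split_bad_good Bd card_Bd) simp
      finally show "(cmod (integral ?J (\<lambda>x. cyc (\<xi> * x) * f x)))\<^sup>2 \<le> 2 * (real M * (\<Sum>N<\<beta>. (cmod (w N \<xi>))\<^sup>2)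
         + real \<beta> * (\<Sum>N<\<beta>. if N \<notin> Bd \<xi> then (cmod (w N \<xi>))\<^sup>2 else 0)) / (real \<beta>)\<^sup>2" .
    qed
    also have "\<dots> = 2 * (real M * (\<Sum>N<\<beta>. \<Sum>\<xi>\<in>X. (cmod (w N \<xi>))\<^sup>2)
         + real \<beta> * (\<Sum>N<\<beta>. \<Sum>\<xi>\<in>X. if N \<notin> Bd \<xi> then (cmod (w N \<xi>))\<^sup>2 else 0)) / (real \<beta>)\<^sup>2"
      by (subst (1 2) sum.swap) (simp only: sum_divide_distrib[symmetric] sum_distrib_left[symmetric] sum.distrib)
    also have "\<dots> \<le> 2 * (real M * integral ?J (preimage_energy q n \<eta>)
         + real \<beta> * (\<Sum>N<\<beta>. K\<^sup>2)) / (real \<beta>)\<^sup>2"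
    proof (intro divide_right_mono mult_left_mono add_mono sum_mono)
      have "(\<Sum>N<\<beta>. \<Sum>\<xi>\<in>X. (cmod (w N \<xi>))\<^sup>2)
         \<le> (\<Sum>N<\<beta>. integral ?J (\<lambda>x. (cmod (fibre_char n (B q \<eta>) ((x + real N) / real l ^ q)))\<^sup>2))"
        by (intro sum_mono bessel X)
      also have "\<dots> = integral ?J (preimage_energy q n \<eta>)"
        unfolding preimage_energy_def \<beta>_def using l2
        by (intro integral_sum[symmetric] finite_lessThan integrable_continuous_real continuous_intros fibre_char_continuous_compose) auto
      finally show "(\<Sum>N<\<beta>. \<Sum>\<xi>\<in>X. (cmod (w N \<xi>))\<^sup>2) \<le> integral ?J (preimage_energy q n \<eta>)" .
      fix N assume N: "N \<in> {..<\<beta>}"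
      have "(\<Sum>\<xi>\<in>X. if N \<notin> Bd \<xi> then (cmod (w N \<xi>))\<^sup>2 else 0) = (\<Sum>\<xi>\<in>{\<xi>\<in>X. N \<notin> Bd \<xi>}. (cmod (w N \<xi>))\<^sup>2)"
        by (rule sum.inter_filter[OF X, symmetric])
      also have "\<dots> \<le> K\<^sup>2"
        unfolding w_def W_def K_def
      proof (rule good_words_sum[OF L _ \<Lambda> \<eta>])
        fix \<xi> x assume "\<xi> \<in> {\<xi>\<in>X. N \<notin> Bd \<xi>}" "x \<in> ?J"
        with N show "2 * alpha A \<kappa> / real l ^ q * norm (B q \<eta>) \<le> \<bar>real_of_int \<xi> + \<eta> \<bullet> s q 1 (x + real N)\<bar>"
          by (force simp: Bd_def bad_codes_def \<epsilon>_def \<beta>_def not_less)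
      qed (use X in auto)
      finally show "(\<Sum>\<xi>\<in>X. if N \<notin> Bd \<xi> then (cmod (w N \<xi>))\<^sup>2 else 0) \<le> K\<^sup>2" .
    qed auto
    also have "\<dots> = 2 * real M / (real \<beta>)\<^sup>2 * integral ?J (preimage_energy q n \<eta>) + 2 * K\<^sup>2"
    proof -
      have "2 * (x + b * (b * y)) / b\<^sup>2 = 2 * (x / b\<^sup>2) + 2 * y" if "0 < b" for b x y :: real
        using that by (simp add: power2_eq_square field_simps)
      from this[of "real \<beta>" "real M * integral ?J (preimage_energy q n \<eta>)" "K\<^sup>2"] \<beta>
      show ?thesis by (simp only: sum_constant card_lessThan of_nat_0_less_iff mult.assoc times_divide_eq_left times_divide_eq_right simp_thms)
    qed
    finally show "integral ?J (\<lambda>x. (cmod (f x))\<^sup>2)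
      \<le> 2 * real M / (real \<beta>)\<^sup>2 * integral ?J (preimage_energy q n \<eta>) + 2 * K\<^sup>2 + e"
      using le by simp
  qed
  have cont_sq: "continuous_on S (\<lambda>x. (cmod (fibre_char (q + n) \<eta> x))\<^sup>2)" for S
    by (intro continuous_intros fibre_char_continuous_compose)
  have "integral {real k * L..(real k + 1) * L} (\<lambda>x. (cmod (fibre_char (q + n) \<eta> x))\<^sup>2)
     \<le> integral {real k * L..(real k + 1) * L} (\<lambda>x. (16 / 9) ^ (r - 1) * (cmod (f x))\<^sup>2)"
  proof (intro integral_le integrable_continuous_real cont_sq continuous_intros f_cont)
    fix x assume x: "x \<in> {real k * L..(real k + 1) * L}"
    have "x \<in> {u + L / 2..u + 3 * L / 2}"
      using x by (auto simp: u_def algebra_simps)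
    from bump_ge[OF L(1) this] have "((3 / 4) ^ (r - 1))\<^sup>2 \<le> (bump L u x)\<^sup>2"
      by (intro power_mono) auto
    then have "(16 / 9) ^ (r - 1) * ((3 / 4) ^ (r - 1))\<^sup>2 \<le> (16 / 9) ^ (r - 1) * (bump L u x)\<^sup>2"
      by (intro mult_left_mono) auto
    moreover have "(16 / 9) ^ (r - 1) * ((3 / 4) ^ (r - 1))\<^sup>2 = (1::real)"
    proof -
      have "(16 / 9) ^ (r - 1) * ((3 / 4) ^ (r - 1))\<^sup>2 = ((16 / 9) * (3 / 4) * (3 / 4) :: real) ^ (r - 1)"
        by (simp only: power2_eq_square power_mult_distrib mult.assoc)
      also have "\<dots> = (1::real)" by simp
      finally show ?thesis .
    qed
    ultimately have "1 \<le> (16 / 9) ^ (r - 1) * (bump L u x)\<^sup>2" by (simp only:)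
    then have "1 * (cmod (fibre_char (q + n) \<eta> x))\<^sup>2 \<le> (16 / 9) ^ (r - 1) * (bump L u x)\<^sup>2 * (cmod (fibre_char (q + n) \<eta> x))\<^sup>2"
      by (rule mult_right_mono) simp
    then show "(cmod (fibre_char (q + n) \<eta> x))\<^sup>2 \<le> (16 / 9) ^ (r - 1) * (cmod (f x))\<^sup>2"
      by (simp add: f_def norm_mult power_mult_distrib mult.assoc)
  qed
  also have "\<dots> = (16 / 9) ^ (r - 1) * integral {real k * L..(real k + 1) * L} (\<lambda>x. (cmod (f x))\<^sup>2)"
    by simp
  also have "\<dots> \<le> (16 / 9) ^ (r - 1) * integral ?J (\<lambda>x. (cmod (f x))\<^sup>2)"
    using L(1) by (intro mult_left_mono integral_subset_le integrable_continuous_real continuous_intros f_cont)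
      (auto simp: u_def algebra_simps)
  also have "\<dots> \<le> (16 / 9) ^ (r - 1) * (2 * real M / (real \<beta>)\<^sup>2 * integral ?J (preimage_energy q n \<eta>) + 2 * K\<^sup>2)"
    by (intro mult_left_mono main) simp
  finally show ?thesis by (simp add: M_def \<beta>_def)
qed

text \<open>Add up \<open>local_estimate\<close> over the \<open>l\<^sup>p\<close> cells.  The arcs cover the circle twice, and the preimages of \<open>x\<close>
  under \<open>\<tau>\<^sup>q\<close> turn the integral of \<open>preimage_energy\<close> into \<open>l\<^sup>q\<close> times \<open>fibre_energy\<close>.\<close>

lemma fibre_energy_recursion:
  "\<exists>C\<ge>0. \<forall>n \<eta>. \<eta> \<noteq> 0 \<longrightarrow> fibre_energy (q + n) \<eta> \<le> 4 * (16 / 9) ^ (r - 1) * real (M_q l A \<phi> \<kappa> q) / real l ^ q * fibre_energy n (B q \<eta>)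
     + C / norm \<eta> ^ (2 * (r - 1))"
proof -
  obtain p where p: "1 \<le> p" and M: "M_pq l A \<phi> \<kappa> p q = M_q l A \<phi> \<kappa> q"
    using M_q_attained by blast
  obtain K0 where K0: "0 < K0" "\<And>\<eta>. norm \<eta> \<le> K0 * norm (B q \<eta>)"
    using norm_le_transpose_matrix[OF invertible_matrix_pow[OF inv], of q] by blast
  \<comment> \<open>the second derivatives of the phases are at most \<open>\<Lambda>\<close> times the lower bound for the first ones\<close>
  define \<Lambda> where "\<Lambda> = K0 * real l ^ q"
  define L where "L = 1 / real l ^ p"
  have L: "0 < L" "real (l ^ p) * L = 1" using l2 by (auto simp: L_def)
  have \<Lambda>: "0 \<le> \<Lambda>" using K0 by (simp add: \<Lambda>_def)
  define a where "a = alpha A \<kappa> / real l ^ q / K0"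
  have a: "0 < a" using alpha_pos K0 l2 by (simp add: a_def)
  define C1 where "C1 = osc_const \<Lambda> (r - 1) 0 * bump_const L"
  define C where "C = (16 / 9) ^ (r - 1) * real (l ^ p) * (2 * (C1 / a ^ (r - 1))\<^sup>2)"
  show ?thesis
  proof (intro exI[of _ C] conjI allI impI)
    show "0 \<le> C" by (simp add: C_def)
    fix n and \<eta> :: "real ^ 'd" assume \<eta>: "\<eta> \<noteq> 0"
    define K where "K = C1 / (alpha A \<kappa> / real l ^ q * norm (B q \<eta>)) ^ (r - 1)"
    define c0 :: real where "c0 = (16 / 9) ^ (r - 1)"
    define M' where "M' = 2 * real (M_q l A \<phi> \<kappa> q) / (real (l ^ q))\<^sup>2"
    have \<Lambda>\<eta>: "norm \<eta> * real l ^ q \<le> \<Lambda> * norm (B q \<eta>)"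
      using mult_right_mono[OF K0(2)[of \<eta>], of "real l ^ q"] by (simp add: \<Lambda>_def mult_ac)
    have "fibre_energy (q + n) \<eta> = (\<Sum>k<l ^ p. integral {real k * L..(real k + 1) * L} (\<lambda>x. (cmod (fibre_char (q + n) \<eta> x))\<^sup>2))"
      unfolding fibre_energy_def using L
      by (intro sum_integral_overlapping(2)[symmetric]) (auto intro!: continuous_intros fibre_char_continuous_compose simp: fibre_char_periodic)
    also have "\<dots> \<le> (\<Sum>k<l ^ p. c0 * (M' * integral {real k * L - L / 2..real k * L + 3 * L / 2} (preimage_energy q n \<eta>) + 2 * K\<^sup>2))"
    proof (rule sum_mono)
      fix k assume "k \<in> {..<l ^ p}"
      then have k: "k < l ^ p" by simp
      have "real k * L - L / 2 + 2 * L = real k * L + 3 * L / 2" by simp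
      with local_estimate[OF k p \<eta> \<Lambda> \<Lambda>\<eta>, of n]
      show "integral {real k * L..(real k + 1) * L} (\<lambda>x. (cmod (fibre_char (q + n) \<eta> x))\<^sup>2)
        \<le> c0 * (M' * integral {real k * L - L / 2..real k * L + 3 * L / 2} (preimage_energy q n \<eta>) + 2 * K\<^sup>2)"
        unfolding L_def[symmetric] M c0_def M'_def K_def C1_def by (simp only:)
    qed
    also have "\<dots> = c0 * (M' * (\<Sum>k<l ^ p. integral {real k * L - L / 2..real k * L + 3 * L / 2} (preimage_energy q n \<eta>))
        + real (l ^ p) * (2 * K\<^sup>2))"
    proof -
      have "(\<Sum>k<l ^ p. c0 * (M' * g k + d)) = c0 * (M' * (\<Sum>k<l ^ p. g k) + real (l ^ p) * d)" for g d
        by (simp add: sum_distrib_left[symmetric] sum.distrib)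
      then show ?thesis .
    qed
    also have "(\<Sum>k<l ^ p. integral {real k * L - L / 2..real k * L + 3 * L / 2} (preimage_energy q n \<eta>))
        = 2 * (real (l ^ q) * fibre_energy n (B q \<eta>))"
      unfolding integral_preimage_energy[symmetric]
      by (intro sum_integral_overlapping(1) preimage_energy_continuous preimage_energy_periodic L)
    also have "c0 * (M' * (2 * (real (l ^ q) * fibre_energy n (B q \<eta>))) + real (l ^ p) * (2 * K\<^sup>2))
       = 4 * c0 * real (M_q l A \<phi> \<kappa> q) / real l ^ q * fibre_energy n (B q \<eta>) + c0 * real (l ^ p) * (2 * K\<^sup>2)"
      using l2 by (simp add: M'_def power2_eq_square field_simps)
    also have "c0 * real (l ^ p) * (2 * K\<^sup>2) \<le> c0 * real (l ^ p) * (2 * ((C1 / a ^ (r - 1))\<^sup>2 / norm \<eta> ^ (2 * (r - 1))))"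
    proof (intro mult_left_mono)
      have "norm \<eta> / K0 \<le> norm (B q \<eta>)" using K0 by (simp add: pos_divide_le_eq mult.commute)
      then have "alpha A \<kappa> / real l ^ q * (norm \<eta> / K0) \<le> alpha A \<kappa> / real l ^ q * norm (B q \<eta>)"
        using alpha_pos by (intro mult_left_mono) (auto intro: less_imp_le)
      then have le: "a * norm \<eta> \<le> alpha A \<kappa> / real l ^ q * norm (B q \<eta>)" by (simp add: a_def)
      have C1: "0 \<le> C1" unfolding C1_def bump_const_def by (intro mult_nonneg_nonneg osc_const_nonneg \<Lambda>) auto
      have "K \<le> C1 / (a * norm \<eta>) ^ (r - 1)" "0 \<le> K"
      proof -
        have pos: "0 < a * norm \<eta>" using a \<eta> by simp
        have "C1 / z ^ (r - 1) \<le> C1 / (a * norm \<eta>) ^ (r - 1) \<and> 0 \<le> C1 / z ^ (r - 1)" if "a * norm \<eta> \<le> z" for z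
        proof -
          have *: "C1 / z ^ (r - 1) \<le> C1 / y ^ (r - 1) \<and> 0 \<le> C1 / z ^ (r - 1)" if "0 < y" "y \<le> z" for y
            using that C1
            by (intro conjI divide_left_mono power_mono mult_pos_pos zero_less_power divide_nonneg_nonneg zero_le_power) linarith+
          show ?thesis by (rule *[OF pos that])
        qed
        from this[OF le] show "K \<le> C1 / (a * norm \<eta>) ^ (r - 1)" "0 \<le> K"
          unfolding K_def by blast+
      qed
      then have "K\<^sup>2 \<le> (C1 / (a * norm \<eta>) ^ (r - 1))\<^sup>2" by (intro power_mono)
      also have "\<dots> = (C1 / a ^ (r - 1))\<^sup>2 / norm \<eta> ^ (2 * (r - 1))"
        by (simp add: power_mult_distrib power_divide power_mult[symmetric] mult.commute[of 2])
      finally show "K\<^sup>2 \<le> (C1 / a ^ (r - 1))\<^sup>2 / norm \<eta> ^ (2 * (r - 1))" .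
    qed (auto simp: c0_def)
    also have "c0 * real (l ^ p) * (2 * ((C1 / a ^ (r - 1))\<^sup>2 / norm \<eta> ^ (2 * (r - 1)))) = C / norm \<eta> ^ (2 * (r - 1))"
      by (simp add: C_def c0_def)
    finally show "fibre_energy (q + n) \<eta> \<le> 4 * (16 / 9) ^ (r - 1) * real (M_q l A \<phi> \<kappa> q) / real l ^ q * fibre_energy n (B q \<eta>)
      + C / norm \<eta> ^ (2 * (r - 1))" by (simp add: c0_def)
  qed
qed

end

section \<open>Linear changes of variables in Euclidean space\<close>

lemma nn_integral_translation:
  fixes c :: "'a::euclidean_space"
  assumes [measurable]: "f \<in> borel_measurable borel"
  shows "(\<integral>\<^sup>+x. f (c + x) \<partial>lborel) = (\<integral>\<^sup>+x. f x \<partial>lborel)"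
  by (subst (2) lborel_distr_plus[of c, symmetric]) (simp add: nn_integral_distr)

lemma Basis_real_vec: "(Basis :: (real ^ 'd) set) = range (\<lambda>i. axis i 1)"
  by (auto simp: Basis_vec_def)

lemma prod_Basis_real_vec: "(\<Prod>b\<in>(Basis :: (real ^ 'd) set). g b) = (\<Prod>i\<in>UNIV. g (axis i 1))"
  unfolding Basis_real_vec by (subst prod.reindex) (auto simp: inj_on_def axis_eq_axis)

lemma sum_Basis_real_vec: "(\<Sum>b\<in>(Basis :: (real ^ 'd) set). g b) = (\<Sum>i\<in>UNIV. g (axis i 1))"
  unfolding Basis_real_vec by (subst sum.reindex) (auto simp: inj_on_def axis_eq_axis)

lemma matrix_vector_measurable [measurable]:
  "(\<lambda>y. (M :: real ^ 'n ^ 'm) *v y) \<in> borel_measurable borel"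
  by (intro borel_measurable_continuous_onI linear_continuous_on matrix_vector_mul_bounded_linear)

text \<open>Fubini: in the variable along \<open>b\<close> the shear is a translation by an amount that depends on the other
  coordinates only.\<close>

lemma nn_integral_shear:
  fixes b e :: "'a::euclidean_space"
  assumes b: "b \<in> Basis" and e: "e \<in> Basis" and ne: "b \<noteq> e" and [measurable]: "f \<in> borel_measurable borel"
  shows "(\<integral>\<^sup>+y. f (y + (c * (y \<bullet> e)) *\<^sub>R b) \<partial>lborel) = (\<integral>\<^sup>+y. f y \<partial>lborel)"
proof -
  interpret product_sigma_finite "\<lambda>_::'a. lborel :: real measure" by standard
  define I where "I = Basis - {b}"
  have I: "finite I" "b \<notin> I" "insert b I = Basis" "e \<in> I" using b e ne by (auto simp: I_def)
  define \<sigma> where "\<sigma> g = (\<Sum>a\<in>Basis. g a *\<^sub>R a)" for g :: "'a \<Rightarrow> real"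
  have \<sigma>_meas [measurable]: "\<sigma> \<in> borel_measurable (\<Pi>\<^sub>M a\<in>insert b I. lborel)"
    unfolding \<sigma>_def I(3) by measurable
  have split: "(\<integral>\<^sup>+y. h y \<partial>lborel) = (\<integral>\<^sup>+x. (\<integral>\<^sup>+t. h (\<sigma> (x(b := t))) \<partial>lborel) \<partial>(\<Pi>\<^sub>M a\<in>I. lborel))"
    if [measurable]: "h \<in> borel_measurable borel" for h :: "'a \<Rightarrow> ennreal"
  proof -
    have "(\<integral>\<^sup>+y. h y \<partial>lborel) = (\<integral>\<^sup>+g. h (\<sigma> g) \<partial>(\<Pi>\<^sub>M a\<in>insert b I. lborel))"
      unfolding I(3) by (subst lborel_eq, subst nn_integral_distr) (auto simp: \<sigma>_def)
    also have "\<dots> = (\<integral>\<^sup>+x. (\<integral>\<^sup>+t. h (\<sigma> (x(b := t))) \<partial>lborel) \<partial>(\<Pi>\<^sub>M a\<in>I. lborel))"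
      by (rule product_nn_integral_insert[OF I(1,2)]) measurable
    finally show ?thesis .
  qed
  have shift: "\<sigma> (x(b := t)) + (c * (\<sigma> (x(b := t)) \<bullet> e)) *\<^sub>R b = \<sigma> (x(b := c * x e + t))" for x t
  proof -
    have s: "\<sigma> (x(b := t)) = (\<Sum>a\<in>I. x a *\<^sub>R a) + t *\<^sub>R b" for t
    proof -
      have "\<sigma> (x(b := t)) = (\<Sum>a\<in>insert b I. (x(b := t)) a *\<^sub>R a)" by (simp only: \<sigma>_def I(3))
      also have "\<dots> = t *\<^sub>R b + (\<Sum>a\<in>I. (x(b := t)) a *\<^sub>R a)" using I(1,2) by simp
      also have "(\<Sum>a\<in>I. (x(b := t)) a *\<^sub>R a) = (\<Sum>a\<in>I. x a *\<^sub>R a)" using I(2) by (intro sum.cong) auto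
      finally show ?thesis by (simp only: add.commute)
    qed
    have "\<sigma> (x(b := t)) \<bullet> e = x e"
      unfolding \<sigma>_def using e ne by (subst inner_sum_left_Basis) auto
    then show ?thesis by (simp add: s algebra_simps)
  qed
  have "(\<integral>\<^sup>+y. f (y + (c * (y \<bullet> e)) *\<^sub>R b) \<partial>lborel)
    = (\<integral>\<^sup>+x. (\<integral>\<^sup>+t. f (\<sigma> (x(b := c * x e + t))) \<partial>lborel) \<partial>(\<Pi>\<^sub>M a\<in>I. lborel))"
    by (subst split) (auto simp: shift)
  also have "\<dots> = (\<integral>\<^sup>+x. (\<integral>\<^sup>+t. f (\<sigma> (x(b := t))) \<partial>lborel) \<partial>(\<Pi>\<^sub>M a\<in>I. lborel))"
  proof (rule nn_integral_cong)
    fix x :: "'a \<Rightarrow> real" assume x: "x \<in> space (\<Pi>\<^sub>M a\<in>I. lborel)"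
    have "(\<lambda>t. x(b := t)) \<in> lborel \<rightarrow>\<^sub>M (\<Pi>\<^sub>M a\<in>insert b I. lborel)"
      using x by (intro measurable_fun_upd[where J = I]) auto
    from measurable_compose[OF this \<sigma>_meas]
    have "(\<lambda>t. f (\<sigma> (x(b := t)))) \<in> borel_measurable borel" by simp
    from nn_integral_translation[OF this, of "c * x e"]
    show "(\<integral>\<^sup>+t. f (\<sigma> (x(b := c * x e + t))) \<partial>lborel) = (\<integral>\<^sup>+t. f (\<sigma> (x(b := t))) \<partial>lborel)" .
  qed
  also have "\<dots> = (\<integral>\<^sup>+y. f y \<partial>lborel)" by (subst split) auto
  finally show ?thesis .
qed

lemma nn_integral_permute:
  fixes p :: "'d::finite \<Rightarrow> 'd"
  assumes p: "p permutes UNIV" and f [measurable]: "f \<in> borel_measurable borel"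
  shows "(\<integral>\<^sup>+y. f (\<chi> i. y $ p i) \<partial>(lborel :: (real ^ 'd) measure)) = (\<integral>\<^sup>+y. f y \<partial>lborel)"
proof -
  have meas [measurable]: "(\<lambda>y :: real ^ 'd. \<chi> i. y $ p i) \<in> borel_measurable borel"
    by (intro borel_measurable_continuous_onI continuous_intros)
  have "lborel = distr lborel borel (\<lambda>y :: real ^ 'd. \<chi> i. y $ p i)"
  proof (rule lborel_eqI)
    fix l u :: "real ^ 'd" assume le: "\<And>b. b \<in> Basis \<Longrightarrow> l \<bullet> b \<le> u \<bullet> b"
    define q where "q = inv p"
    have q: "p (q i) = i" "q (p i) = i" for i
      using permutes_inverses[OF p] by (auto simp: q_def)
    have le': "l $ i \<le> u $ i" for i using le[of "axis i 1"] by (auto simp: Basis_real_vec inner_axis)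
    have pre: "(\<lambda>y :: real ^ 'd. \<chi> i. y $ p i) -` box l u = box (\<chi> i. l $ q i) (\<chi> i. u $ q i)"
      by (auto simp: mem_box_cart) (metis q)+
    have "emeasure lborel (box (\<chi> i. l $ q i) (\<chi> i. u $ q i)) = ennreal (\<Prod>i\<in>UNIV. u $ q i - l $ q i)"
    proof -
      have "(\<chi> i. l $ q i) \<bullet> b \<le> (\<chi> i. u $ q i) \<bullet> b" if "b \<in> Basis" for b :: "real ^ 'd"
        using that le' by (auto simp: Basis_real_vec inner_axis)
      from emeasure_lborel_box[OF this] show ?thesis
        by (simp add: prod_Basis_real_vec inner_axis)
    qed
    also have "(\<Prod>i\<in>UNIV. u $ q i - l $ q i) = (\<Prod>i\<in>UNIV. u $ i - l $ i)"
      using prod.permute[OF permutes_inv[OF p], of "\<lambda>i. u $ i - l $ i"] by (simp add: o_def q_def)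
    finally show "emeasure (distr lborel borel (\<lambda>y :: real ^ 'd. \<chi> i. y $ p i)) (box l u) = ennreal (\<Prod>b\<in>Basis. (u - l) \<bullet> b)"
      by (simp add: emeasure_distr pre prod_Basis_real_vec inner_axis)
  qed simp
  then show ?thesis
  proof -
    assume eq: "lborel = distr lborel borel (\<lambda>y :: real ^ 'd. \<chi> i. y $ p i)"
    have "(\<integral>\<^sup>+y. f y \<partial>lborel) = (\<integral>\<^sup>+y. f y \<partial>distr lborel borel (\<lambda>y :: real ^ 'd. \<chi> i. y $ p i))"
      by (rule arg_cong[where f = "\<lambda>M. integral\<^sup>N M f", OF eq])
    then show ?thesis by (simp add: nn_integral_distr)
  qed
qed

lemma nn_integral_diagonal:
  fixes M :: "real ^ 'd ^ 'd"
  assumes diag: "\<And>i j. i \<noteq> j \<Longrightarrow> M $ i $ j = 0" and nz: "det M \<noteq> 0" and [measurable]: "f \<in> borel_measurable borel"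
  shows "(\<integral>\<^sup>+x. f x \<partial>lborel) = ennreal \<bar>det M\<bar> * (\<integral>\<^sup>+y. f (M *v y) \<partial>lborel)"
proof -
  define c where "c b = (M *v b) \<bullet> b" for b :: "real ^ 'd"
  have c: "c (axis i 1) = M $ i $ i" for i
    by (simp add: c_def inner_axis matrix_vector_mult_basis column_def)
  have det: "det M = (\<Prod>i\<in>UNIV. M $ i $ i)" using diag by (rule det_diagonal)
  have "c b \<noteq> 0" if "b \<in> Basis" for b
    using that nz unfolding det Basis_real_vec by (auto simp: c)
  from lborel_affine_euclidean[of c 0, OF this]
  have 1: "lborel = density (distr lborel borel (\<lambda>x. 0 + (\<Sum>j\<in>Basis. (c j * (x \<bullet> j)) *\<^sub>R j))) (\<lambda>_. ennreal (\<Prod>j\<in>Basis. \<bar>c j\<bar>))"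
    by simp
  have 2: "(\<lambda>x. 0 + (\<Sum>j\<in>Basis. (c j * (x \<bullet> j)) *\<^sub>R j)) = (\<lambda>x. M *v x)"
  proof
    fix x :: "real ^ 'd"
    have "(\<Sum>j\<in>Basis. (c j * (x \<bullet> j)) *\<^sub>R j) $ i = (M *v x) $ i" for i
    proof -
      have "(\<Sum>j\<in>Basis. (c j * (x \<bullet> j)) *\<^sub>R j) $ i = (\<Sum>j\<in>UNIV. M $ j $ j * x $ j * (axis j 1 :: real ^ 'd) $ i)"
        by (simp add: sum_Basis_real_vec c inner_axis)
      also have "\<dots> = (\<Sum>j\<in>UNIV. if j = i then M $ i $ i * x $ i else 0)"
        by (intro sum.cong) (auto simp: axis_def)
      also have "\<dots> = (\<Sum>j\<in>UNIV. M $ i $ j * x $ j)"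
      proof -
        have "(\<Sum>j\<in>UNIV. M $ i $ j * x $ j) = (\<Sum>j\<in>UNIV. if j = i then M $ i $ i * x $ i else 0)"
          using diag by (intro sum.cong) auto
        then show ?thesis by simp
      qed
      finally show ?thesis by (simp add: matrix_vector_mult_def)
    qed
    then show "0 + (\<Sum>j\<in>Basis. (c j * (x \<bullet> j)) *\<^sub>R j) = M *v x" by (simp add: vec_eq_iff)
  qed
  have 3: "(\<Prod>j\<in>Basis. \<bar>c j\<bar>) = \<bar>det M\<bar>"
    by (simp add: prod_Basis_real_vec c det abs_prod)
  show ?thesis
    by (subst 1) (simp add: 2[unfolded add_0] 3 nn_integral_density nn_integral_distr nn_integral_cmult)
qed

text \<open>Every matrix is a product of elementary ones and of matrices that are diagonal or have a zero row;
  both sides are multiplicative in the matrix, and the determinant excludes zero rows.\<close>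

lemma nn_integral_matrix:
  fixes M :: "real ^ 'd ^ 'd"
  assumes nz: "det M \<noteq> 0" and f: "f \<in> borel_measurable borel"
  shows "(\<integral>\<^sup>+x. f x \<partial>lborel) = ennreal \<bar>det M\<bar> * (\<integral>\<^sup>+y. f (M *v y) \<partial>lborel)"
proof -
  have "det M \<noteq> 0 \<longrightarrow> (\<forall>f\<in>borel_measurable borel. (\<integral>\<^sup>+x. f x \<partial>lborel) = ennreal \<bar>det M\<bar> * (\<integral>\<^sup>+y. f (M *v y) \<partial>lborel))"
  proof (induction M rule: induct_matrix_elementary)
    case (1 A B)
    show ?case
    proof (intro impI ballI)
      fix f :: "real ^ 'd \<Rightarrow> ennreal" assume nz: "det (A ** B) \<noteq> 0" and f [measurable]: "f \<in> borel_measurable borel"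
      from nz have nz': "det A \<noteq> 0" "det B \<noteq> 0" by (auto simp: det_mul)
      have "(\<integral>\<^sup>+x. f x \<partial>lborel) = ennreal \<bar>det A\<bar> * (\<integral>\<^sup>+y. f (A *v y) \<partial>lborel)"
        using 1 nz' f by blast
      also have "(\<integral>\<^sup>+y. f (A *v y) \<partial>lborel) = ennreal \<bar>det B\<bar> * (\<integral>\<^sup>+y. f (A *v (B *v y)) \<partial>lborel)"
      proof -
        have "(\<lambda>y. f (A *v y)) \<in> borel_measurable borel" by measurable
        from bspec[OF mp[OF 1(2) nz'(2)] this] show ?thesis .
      qed
      finally show "(\<integral>\<^sup>+x. f x \<partial>lborel) = ennreal \<bar>det (A ** B)\<bar> * (\<integral>\<^sup>+y. f (A ** B *v y) \<partial>lborel)"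
        by (simp add: det_mul abs_mult ennreal_mult mult.assoc matrix_vector_mul_assoc)
    qed
  next
    case (2 A i)
    then show ?case by (simp add: det_zero_row)
  next
    case (3 A)
    then show ?case using nn_integral_diagonal[of A] by blast
  next
    case (4 m n)
    let ?p = "Transposition.transpose m n"
    have p: "?p permutes UNIV" by (rule permutes_swap_id) auto
    have "\<bar>det (\<chi> i j. mat 1 $ i $ ?p j :: real ^ 'd ^ 'd)\<bar> = 1"
      using det_permute_columns[OF p, of "mat 1 :: real ^ 'd ^ 'd"] by (simp add: sign_def)
    moreover have "(\<chi> i j. mat 1 $ i $ ?p j :: real ^ 'd ^ 'd) *v y = (\<chi> i. y $ ?p i)" for y
    proof -
      have "(\<Sum>j\<in>UNIV. (if i = ?p j then 1 else 0) * y $ j) = y $ ?p i" for i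
      proof -
        have "(\<Sum>j\<in>UNIV. (if i = ?p j then 1 else 0) * y $ j) = (\<Sum>j\<in>UNIV. if j = ?p i then y $ j else 0)"
          by (intro sum.cong) (auto simp: transpose_eq_iff)
        then show ?thesis by simp
      qed
      then show ?thesis by (simp add: vec_eq_iff matrix_vector_mult_def mat_def)
    qed
    ultimately show ?case using nn_integral_permute[OF p] by simp
  next
    case (5 m n c)
    let ?M = "\<chi> i j. if i = m \<and> j = n then c else of_bool (i = j) :: real ^ 'd ^ 'd"
    have M: "?M = (\<chi> k. if k = m then row m (mat 1) + c *s row n (mat 1) else row k (mat 1))"
      using 5 by (auto simp: vec_eq_iff row_def mat_def)
    have det: "det ?M = 1"
      unfolding M by (subst det_row_operation[OF 5]) simp
    have Mv: "?M *v y = y + (c * (y \<bullet> axis n 1)) *\<^sub>R axis m 1" for y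
    proof -
      have "(\<Sum>j\<in>UNIV. (if i = m \<and> j = n then c else of_bool (i = j)) * y $ j) = y $ i + c * y $ n * (axis m 1 :: real ^ 'd) $ i" for i
      proof -
        have "(\<Sum>j\<in>UNIV. (if i = m \<and> j = n then c else of_bool (i = j)) * y $ j)
          = (\<Sum>j\<in>UNIV. (if j = i then y $ j else 0) + (if j = n then (if i = m then c * y $ n else 0) else 0))"
          using 5 by (intro sum.cong) auto
        then show ?thesis by (simp add: sum.distrib axis_def)
      qed
      then show ?thesis by (simp add: vec_eq_iff matrix_vector_mult_def inner_axis)
    qed
    have ax: "(axis m 1 :: real ^ 'd) \<in> Basis" "(axis n 1 :: real ^ 'd) \<in> Basis" "(axis m 1 :: real ^ 'd) \<noteq> axis n 1"
      using 5 by (auto simp: Basis_real_vec axis_eq_axis)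
    show ?case
    proof (intro impI ballI)
      fix f :: "real ^ 'd \<Rightarrow> ennreal" assume f: "f \<in> borel_measurable borel"
      show "(\<integral>\<^sup>+x. f x \<partial>lborel) = ennreal \<bar>det ?M\<bar> * (\<integral>\<^sup>+y. f (?M *v y) \<partial>lborel)"
        using nn_integral_shear[OF ax f, of c] by (simp only: det Mv abs_one ennreal_1 mult_1)
    qed
  qed
  then show ?thesis using nz f by blast
qed

section \<open>Gaussian integrals and an integrable tail\<close>

text \<open>The standard normal density, written as a product so that integrals over Euclidean space factor.\<close>

definition gauss :: "'a::euclidean_space \<Rightarrow> real" where
  "gauss x = (\<Prod>b\<in>Basis. std_normal_density (x \<bullet> b))"

lemma gauss_measurable [measurable]: "gauss \<in> borel_measurable borel"
  unfolding gauss_def by measurable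

lemma gauss_nonneg: "0 \<le> gauss x"
  unfolding gauss_def by (intro prod_nonneg) simp

lemma std_normal_density_le_1: "std_normal_density x \<le> 1"
proof -
  have "1 \<le> sqrt (2 * pi)" using pi_gt3 by simp
  moreover have "exp (- x\<^sup>2 / 2) \<le> 1" by simp
  ultimately have "1 / sqrt (2 * pi) * exp (- x\<^sup>2 / 2) \<le> 1 * 1"
    by (intro mult_mono) auto
  then show ?thesis by (simp add: std_normal_density_def)
qed

lemma gauss_le_1: "gauss x \<le> 1"
  unfolding gauss_def by (intro prod_le_1) (auto simp: std_normal_density_le_1)

lemma power2_norm_Basis: "(norm (x :: 'a::euclidean_space))\<^sup>2 = (\<Sum>b\<in>Basis. (x \<bullet> b)\<^sup>2)"
  unfolding power2_norm_eq_inner by (subst euclidean_inner) (simp add: power2_eq_square)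

lemma gauss_eq: "gauss (x :: 'a::euclidean_space) = exp (- (norm x)\<^sup>2 / 2) / sqrt (2 * pi) ^ DIM('a)"
proof -
  have "exp (- (norm x)\<^sup>2 / 2) = (\<Prod>b\<in>Basis. exp (- (x \<bullet> b)\<^sup>2 / 2))"
    by (simp add: power2_norm_Basis exp_sum[symmetric] sum_negf sum_divide_distrib)
  then show ?thesis
    by (simp add: gauss_def std_normal_density_def prod_dividef)
qed

lemma nn_integral_gauss: "(\<integral>\<^sup>+x. ennreal (gauss (x :: 'a::euclidean_space)) \<partial>lborel) = 1"
proof -
  have "(\<integral>\<^sup>+x. ennreal (gauss (x :: 'a)) \<partial>lborel) = (\<integral>\<^sup>+x. (\<Prod>b\<in>Basis. ennreal (std_normal_density (x \<bullet> b))) \<partial>(lborel :: 'a measure))"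
    by (simp add: gauss_def prod_ennreal)
  also have "\<dots> = (\<Prod>b\<in>(Basis :: 'a set). (\<integral>\<^sup>+x. ennreal (std_normal_density x) \<partial>lborel))"
    by (rule nn_integral_lborel_prod) auto
  also have "(\<integral>\<^sup>+x. ennreal (std_normal_density x) \<partial>lborel) = 1"
    using integral_std_normal_moment_even[of 0] integrable_std_normal_moment[of 0]
    by (subst nn_integral_eq_integral) auto
  finally show ?thesis by simp
qed

lemma integrable_gauss: "integrable lborel (gauss :: 'a::euclidean_space \<Rightarrow> real)"
  by (rule integrableI_nonneg) (auto simp: gauss_nonneg nn_integral_gauss)

text \<open>The integrand with \<open>cos\<close> replaced by the complex exponential is a product over the coordinates, and
  each factor is the characteristic function of the standard normal distribution.\<close>

lemma fourier_gauss:
  fixes s :: "'a::euclidean_space"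
  shows "(\<integral>x. gauss x * cos (x \<bullet> s) \<partial>lborel) = exp (- (norm s)\<^sup>2 / 2)"
proof -
  interpret product_sigma_finite "\<lambda>_::'a. lborel :: real measure" by standard
  define h :: "'a \<Rightarrow> real \<Rightarrow> complex" where "h b t = of_real (std_normal_density t) * iexp ((s \<bullet> b) * t)" for b t
  have h_int: "integrable lborel (h b)" for b
  proof (rule Bochner_Integration.integrable_bound[of lborel std_normal_density])
    show "integrable lborel std_normal_density" using integrable_std_normal_moment[of 0] by simp
    show "h b \<in> borel_measurable lborel" unfolding h_def by measurable
  qed (simp add: h_def norm_mult)
  have h_val: "(\<integral>t. h b t \<partial>lborel) = of_real (exp (- (s \<bullet> b)\<^sup>2 / 2))" for b
  proof -
    have "(\<integral>t. h b t \<partial>lborel) = char std_normal_distribution (s \<bullet> b)"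
      unfolding char_def h_def
      by (subst integral_density) (auto simp: scaleR_conv_of_real)
    then show ?thesis by (simp add: char_std_normal_distribution)
  qed
  have prod: "(\<Prod>b\<in>Basis. h b (x \<bullet> b)) = of_real (gauss x) * iexp (x \<bullet> s)" for x
  proof -
    have "(\<Prod>b\<in>Basis. iexp ((s \<bullet> b) * (x \<bullet> b))) = iexp (\<Sum>b\<in>Basis. (s \<bullet> b) * (x \<bullet> b))"
      by (simp add: exp_sum[symmetric] sum_distrib_left)
    then show ?thesis
      by (simp add: h_def gauss_def prod.distrib euclidean_inner[of x s] mult.commute)
  qed
  have "(\<integral>x. of_real (gauss x) * iexp (x \<bullet> s) \<partial>lborel) = (\<integral>x. (\<Prod>b\<in>Basis. h b (x \<bullet> b)) \<partial>(lborel :: 'a measure))"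
    by (simp add: prod)
  also have "\<dots> = (\<integral>f. (\<Prod>b\<in>Basis. h b ((\<Sum>c\<in>Basis. f c *\<^sub>R c) \<bullet> b)) \<partial>(\<Pi>\<^sub>M b\<in>(Basis :: 'a set). lborel))"
    by (subst lborel_eq, subst integral_distr) (auto simp: h_def)
  also have "\<dots> = (\<integral>f. (\<Prod>b\<in>Basis. h b (f b)) \<partial>(\<Pi>\<^sub>M b\<in>(Basis :: 'a set). lborel))"
    by (intro Bochner_Integration.integral_cong prod.cong refl) (simp add: inner_sum_left_Basis)
  also have "\<dots> = (\<Prod>b\<in>Basis. (\<integral>t. h b t \<partial>lborel))"
    by (rule product_integral_prod) (auto simp: h_int)
  also have "\<dots> = of_real (exp (- (norm s)\<^sup>2 / 2))"
  proof -
    have "exp (- (norm s)\<^sup>2 / 2) = (\<Prod>b\<in>Basis. exp (- (s \<bullet> b)\<^sup>2 / 2))"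
      by (simp add: power2_norm_Basis exp_sum[symmetric] sum_negf sum_divide_distrib)
    then show ?thesis by (simp only: h_val of_real_prod)
  qed
  finally have eq: "(\<integral>x. of_real (gauss x) * iexp (x \<bullet> s) \<partial>lborel) = of_real (exp (- (norm s)\<^sup>2 / 2))" .
  have "integrable lborel (\<lambda>x. of_real (gauss x) * iexp (x \<bullet> s))"
    by (rule Bochner_Integration.integrable_bound[OF integrable_gauss]) (auto simp: norm_mult gauss_nonneg)
  from integral_Re[OF this] show ?thesis unfolding eq by (simp add: Re_exp)
qed

lemma nn_integral_abs_powr_finite:
  fixes p :: real assumes p: "1 < p"
  shows "(\<integral>\<^sup>+t. ennreal (((1 + \<bar>t\<bar>) / 2) powr (- p)) \<partial>lborel) < \<infinity>"
proof -
  define g where "g t = ((1 + \<bar>t\<bar>) / 2) powr (- p)" for t :: real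
  define F where "F t = ((1 + t) / 2) powr (1 - p) * (2 / (1 - p))" for t :: real
  have [measurable]: "g \<in> borel_measurable borel" unfolding g_def by measurable
  have "(\<integral>\<^sup>+t. ennreal (g t) * indicator {0..} t \<partial>lborel) = 0 - F 0"
  proof (rule nn_integral_FTC_atLeast)
    show "(F has_real_derivative g t) (at t)" if "0 \<le> t" for t
    proof -
      have "(F has_real_derivative ((1 - p) * ((1 + t) / 2) powr (1 - p - 1) * (1 / 2)) * (2 / (1 - p))) (at t)"
        unfolding F_def using that by (auto intro!: derivative_eq_intros)
      moreover have "((1 - p) * y * (1 / 2)) * (2 / (1 - p)) = y" for y using p by (simp add: field_simps)
      ultimately show ?thesis using that by (simp add: g_def)
    qed
    show "(F \<longlongrightarrow> 0) at_top"
      unfolding F_def using p by real_asymp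
  qed (auto simp: g_def)
  then have 1: "(\<integral>\<^sup>+t. ennreal (g t) * indicator {0..} t \<partial>lborel) < \<infinity>" by simp
  have "(\<integral>\<^sup>+t. ennreal (g t) * indicator {..0} t \<partial>lborel) = (\<integral>\<^sup>+t. ennreal (g t) * indicator {0..} t \<partial>lborel)"
    by (subst nn_integral_real_affine[where c = "-1" and t = 0])
       (auto simp: g_def intro!: nn_integral_cong split: split_indicator)
  with 1 have 2: "(\<integral>\<^sup>+t. ennreal (g t) * indicator {..0} t \<partial>lborel) < \<infinity>" by simp
  have "(\<integral>\<^sup>+t. ennreal (g t) \<partial>lborel) \<le> (\<integral>\<^sup>+t. ennreal (g t) * indicator {0..} t + ennreal (g t) * indicator {..0} t \<partial>lborel)"
    by (intro nn_integral_mono) (auto split: split_indicator)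
  also have "\<dots> = (\<integral>\<^sup>+t. ennreal (g t) * indicator {0..} t \<partial>lborel) + (\<integral>\<^sup>+t. ennreal (g t) * indicator {..0} t \<partial>lborel)"
    by (rule nn_integral_add) auto
  also have "\<dots> < \<infinity>" using 1 2 by simp
  finally show ?thesis unfolding g_def .
qed

text \<open>For \<open>|x| \<ge> 1\<close> every coordinate satisfies \<open>|x| \<ge> (1 + |x\<^sub>b|) / 2\<close>.  Distributing the power \<open>d + 1\<close> evenly
  over the \<open>d\<close> coordinates leaves in each a one-dimensional integral with exponent \<open>1 + 1/d > 1\<close>.\<close>

lemma nn_integral_norm_power_tail:
  assumes m: "DIM('a::euclidean_space) + 1 \<le> m"
  shows "(\<integral>\<^sup>+x. ennreal (1 / norm x ^ m) * indicator {x. 1 \<le> norm x} x \<partial>(lborel :: 'a measure)) < \<infinity>"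
proof -
  define d where "d = DIM('a)"
  define p where "p = 1 + 1 / real d"
  have d: "0 < d" by (simp add: d_def)
  have p: "1 < p" using d by (simp add: p_def)
  let ?g = "\<lambda>t::real. ((1 + \<bar>t\<bar>) / 2) powr (- p)"
  have "(\<integral>\<^sup>+x. ennreal (1 / norm x ^ m) * indicator {x. 1 \<le> norm x} x \<partial>(lborel :: 'a measure))
     \<le> (\<integral>\<^sup>+x. (\<Prod>b\<in>Basis. ennreal (?g (x \<bullet> b))) \<partial>(lborel :: 'a measure))"
  proof (rule nn_integral_mono)
    fix x :: 'a
    show "ennreal (1 / norm x ^ m) * indicator {x. 1 \<le> norm x} x \<le> (\<Prod>b\<in>Basis. ennreal (?g (x \<bullet> b)))"
    proof (cases "1 \<le> norm x")
      case True
      have "1 / norm x ^ m \<le> 1 / norm x ^ (d + 1)"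
        using True m by (intro divide_left_mono power_increasing mult_pos_pos zero_less_power) (auto simp: d_def)
      also have "\<dots> = norm x powr (- real (d + 1))"
        using True powr_realpow[of "norm x" "d + 1"] by (simp only: powr_minus divide_inverse mult_1)
      also have "- real (d + 1) = (- p) * real d" using d by (simp add: p_def field_simps)
      also have "norm x powr ((- p) * real d) = (norm x powr (- p)) ^ d"
      proof -
        have "norm x powr ((- p) * real d) = (norm x powr (- p)) powr real d" by (simp only: powr_powr)
        also have "\<dots> = (norm x powr (- p)) ^ d" using True by (intro powr_realpow powr_gt_zero[THEN iffD2]) auto
        finally show ?thesis .
      qed
      also have "\<dots> = (\<Prod>b\<in>(Basis :: 'a set). norm x powr (- p))"
        by (simp add: d_def)
      also have "\<dots> \<le> (\<Prod>b\<in>Basis. ?g (x \<bullet> b))"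
      proof (rule prod_mono, safe)
        fix b :: 'a assume "b \<in> Basis"
        then have "(1 + \<bar>x \<bullet> b\<bar>) / 2 \<le> norm x" using True Basis_le_norm[of b x] by simp
        then show "norm x powr (- p) \<le> ?g (x \<bullet> b)"
          using p by (intro powr_mono2') auto
      qed simp
      finally show ?thesis using True by (simp add: prod_ennreal ennreal_leI)
    qed simp
  qed
  also have "\<dots> = (\<Prod>b\<in>(Basis :: 'a set). (\<integral>\<^sup>+t. ennreal (?g t) \<partial>lborel))"
    by (rule nn_integral_lborel_prod) auto
  also have "\<dots> < \<infinity>"
    using nn_integral_abs_powr_finite[OF p] by (simp add: power_less_top_ennreal)
  finally show ?thesis .
qed

section \<open>Boundedness of the energy\<close>

(* Frequencies stay in the form \<open>B q \<eta>\<close> under simplification. *)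
declare transpose_matrix_vector [simp del]

context solenoidal
begin

text \<open>Continuity in \<open>\<eta>\<close> is used for measurability only.\<close>

lemma fibre_energy_continuous: "continuous_on UNIV (fibre_energy n)"
proof -
  have "continuous_on (UNIV \<times> cbox 0 1) (\<lambda>(\<eta>, x). (cmod (fibre_char n \<eta> x))\<^sup>2)"
    unfolding fibre_char_def case_prod_unfold
    by (intro continuous_intros continuous_on_compose2[OF s_continuous]) auto
  from integral_continuous_on_param[OF this] show ?thesis
    unfolding fibre_energy_def by simp
qed

lemma fibre_energy_measurable [measurable]: "fibre_energy n \<in> borel_measurable borel"
  by (intro borel_measurable_continuous_onI fibre_energy_continuous)

lemma B_measurable [measurable]: "B q \<in> borel_measurable borel"
  by (rule matrix_vector_measurable)

lemma B_add: "B (q + n) \<eta> = B n (B q \<eta>)"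
  by (simp only: matrix_pow_add matrix_transpose_mul matrix_vector_mul_assoc)

lemma det_A: "det A \<noteq> 0"
  using inv by (simp add: invertible_det_nz)

lemma det_B: "det (transpose (matrix_pow A q)) = det A ^ q"
  by (simp add: det_matrix_pow)

text \<open>Up to a constant factor, the square of the \<open>L\<^sup>2\<close> norm of the density of the \<open>n\<close>-th image of the Gaussian
  data; see \<open>push_density_energy\<close>.\<close>

definition energy :: "nat \<Rightarrow> ennreal" where
  "energy n = (\<integral>\<^sup>+\<eta>. ennreal (gauss (B n \<eta>) * fibre_energy n \<eta>) \<partial>lborel)"

lemma nn_integral_B:
  assumes [measurable]: "f \<in> borel_measurable borel"
  shows "(\<integral>\<^sup>+\<eta>. f (B q \<eta>) \<partial>lborel) = ennreal (1 / \<bar>det A\<bar> ^ q) * (\<integral>\<^sup>+\<eta>. f \<eta> \<partial>lborel)"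
proof -
  have pos: "0 < \<bar>det A\<bar> ^ q" using det_A by simp
  have "(\<integral>\<^sup>+\<eta>. f \<eta> \<partial>lborel) = ennreal (\<bar>det A\<bar> ^ q) * (\<integral>\<^sup>+\<eta>. f (B q \<eta>) \<partial>lborel)"
    using nn_integral_matrix[of "transpose (matrix_pow A q)" f] det_A unfolding det_B by (simp add: power_abs)
  then have "ennreal (1 / \<bar>det A\<bar> ^ q) * (\<integral>\<^sup>+\<eta>. f \<eta> \<partial>lborel)
    = (ennreal (1 / \<bar>det A\<bar> ^ q) * ennreal (\<bar>det A\<bar> ^ q)) * (\<integral>\<^sup>+\<eta>. f (B q \<eta>) \<partial>lborel)"
    by (simp add: mult.assoc)
  also have "ennreal (1 / \<bar>det A\<bar> ^ q) * ennreal (\<bar>det A\<bar> ^ q) = 1"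
    using pos by (simp add: ennreal_mult[symmetric])
  finally show ?thesis by simp
qed

lemma energy_finite: "energy n < \<infinity>"
proof -
  have "energy n \<le> (\<integral>\<^sup>+\<eta>. ennreal (gauss (B n \<eta>)) \<partial>lborel)"
    unfolding energy_def
    by (intro nn_integral_mono ennreal_leI) (use mult_left_mono[OF fibre_energy_le_1 gauss_nonneg] in simp)
  also have "\<dots> = ennreal (1 / \<bar>det A\<bar> ^ n)"
    by (subst nn_integral_B[where f = "\<lambda>\<eta>. ennreal (gauss \<eta>)"]) (auto simp: nn_integral_gauss)
  finally have "energy n \<le> ennreal (1 / \<bar>det A\<bar> ^ n)" .
  then show ?thesis by (rule le_less_trans) simp
qed

text \<open>Integrate \<open>fibre_energy_recursion\<close>.  The weight composes, \<open>B (q + n) = B n \<circ> B q\<close>, so substituting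
  \<open>B q \<eta>\<close> reproduces \<open>energy n\<close> with the Jacobian \<open>1 / |det A|^q\<close>.  Small frequencies are bounded trivially and
  the error term is integrable over the large ones.\<close>

lemma energy_recursion:
  assumes r: "real r \<ge> (real CARD('d) + 3) / 2"
  shows "\<exists>C'. \<forall>n. energy (q + n) \<le>
    ennreal (4 * (16 / 9) ^ (r - 1) * real (M_q l A \<phi> \<kappa> q) / (real l * \<bar>det A\<bar>) ^ q) * energy n + ennreal C'"
proof -
  define \<theta> where "\<theta> = 4 * (16 / 9) ^ (r - 1) * real (M_q l A \<phi> \<kappa> q) / real l ^ q"
  have \<theta>: "0 \<le> \<theta>" by (simp add: \<theta>_def)
  obtain C where C: "0 \<le> C" "\<And>n \<eta>. \<eta> \<noteq> 0 \<Longrightarrow> fibre_energy (q + n) \<eta> \<le> \<theta> * fibre_energy n (B q \<eta>) + C / norm \<eta> ^ (2 * (r - 1))"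
    using fibre_energy_recursion[of q] unfolding \<theta>_def by blast
  \<comment> \<open>the only use of the relation between smoothness and dimension\<close>
  define m where "m = 2 * (r - 1)"
  have m: "DIM(real ^ 'd) + 1 \<le> m"
  proof -
    have "real (CARD('d) + 3) \<le> real (2 * r)" using r by simp
    then have "CARD('d) + 3 \<le> 2 * r" by (simp only: of_nat_le_iff)
    then show ?thesis by (simp add: m_def)
  qed
  define T where "T = (\<integral>\<^sup>+x. ennreal (1 / norm x ^ m) * indicator {x. 1 \<le> norm x} x \<partial>(lborel :: (real ^ 'd) measure))"
  have T: "T < \<infinity>" unfolding T_def by (rule nn_integral_norm_power_tail[OF m])
  define V where "V = emeasure lborel (ball (0 :: real ^ 'd) 1)"
  have V: "V < \<infinity>" unfolding V_def by (intro emeasure_bounded_finite) simp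
  have rec: "energy (q + n) \<le> ennreal (\<theta> / \<bar>det A\<bar> ^ q) * energy n + (ennreal C * T + V)" for n
  proof -
    have "energy (q + n) \<le> (\<integral>\<^sup>+\<eta>. ennreal \<theta> * ennreal (gauss (B n (B q \<eta>)) * fibre_energy n (B q \<eta>))
       + (ennreal C * (ennreal (1 / norm \<eta> ^ m) * indicator {x. 1 \<le> norm x} \<eta>) + indicator (ball 0 1) \<eta>) \<partial>lborel)"
      unfolding energy_def
    proof (rule nn_integral_mono)
      fix \<eta> :: "real ^ 'd"
      have g: "0 \<le> gauss (B n (B q \<eta>))" "gauss (B n (B q \<eta>)) \<le> 1" by (rule gauss_nonneg gauss_le_1)+
      show "ennreal (gauss (B (q + n) \<eta>) * fibre_energy (q + n) \<eta>) \<le> ennreal \<theta> * ennreal (gauss (B n (B q \<eta>)) * fibre_energy n (B q \<eta>))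
        + (ennreal C * (ennreal (1 / norm \<eta> ^ m) * indicator {x. 1 \<le> norm x} \<eta>) + indicator (ball 0 1) \<eta>)"
      proof (cases "1 \<le> norm \<eta>")
        case True
        then have "\<eta> \<noteq> 0" by auto
        have "gauss (B n (B q \<eta>)) * fibre_energy (q + n) \<eta> \<le> gauss (B n (B q \<eta>)) * (\<theta> * fibre_energy n (B q \<eta>) + C / norm \<eta> ^ m)"
          unfolding m_def by (intro mult_left_mono C(2) g \<open>\<eta> \<noteq> 0\<close>)
        also have "\<dots> = \<theta> * (gauss (B n (B q \<eta>)) * fibre_energy n (B q \<eta>)) + gauss (B n (B q \<eta>)) * (C / norm \<eta> ^ m)"
          by (simp only: distrib_left mult_ac)
        also have "\<dots> \<le> \<theta> * (gauss (B n (B q \<eta>)) * fibre_energy n (B q \<eta>)) + 1 * (C / norm \<eta> ^ m)"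
          using C(1) by (intro add_left_mono mult_right_mono g) simp
        finally have "ennreal (gauss (B (q + n) \<eta>) * fibre_energy (q + n) \<eta>)
          \<le> ennreal (\<theta> * (gauss (B n (B q \<eta>)) * fibre_energy n (B q \<eta>)) + C * (1 / norm \<eta> ^ m))"
          unfolding B_add by (intro ennreal_leI) simp
        also have "\<dots> = ennreal \<theta> * ennreal (gauss (B n (B q \<eta>)) * fibre_energy n (B q \<eta>)) + ennreal C * ennreal (1 / norm \<eta> ^ m)"
        proof -
          have "ennreal (\<theta> * x + C * y) = ennreal \<theta> * ennreal x + ennreal C * ennreal y" if "0 \<le> x" "0 \<le> y" for x y
            using \<theta> C(1) that by (simp add: ennreal_mult)
          from this[of "gauss (B n (B q \<eta>)) * fibre_energy n (B q \<eta>)" "1 / norm \<eta> ^ m"] show ?thesis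
            using mult_nonneg_nonneg[OF g(1) fibre_energy_nonneg] by simp
        qed
        finally show ?thesis using True by simp
      next
        case False
        have "gauss (B (q + n) \<eta>) * fibre_energy (q + n) \<eta> \<le> 1 * 1"
          by (intro mult_mono gauss_le_1 fibre_energy_le_1 fibre_energy_nonneg) simp
        then have "ennreal (gauss (B (q + n) \<eta>) * fibre_energy (q + n) \<eta>) \<le> 1" by (simp add: ennreal_le_1)
        then show ?thesis using False by (simp add: add_increasing)
      qed
    qed
    also have "\<dots> = ennreal \<theta> * (\<integral>\<^sup>+\<eta>. ennreal (gauss (B n (B q \<eta>)) * fibre_energy n (B q \<eta>)) \<partial>lborel) + (ennreal C * T + V)"
    proof -
      define h1 where "h1 \<eta> = ennreal (gauss (B n (B q \<eta>)) * fibre_energy n (B q \<eta>))" for \<eta>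
      define h2 :: "real ^ 'd \<Rightarrow> ennreal" where "h2 \<eta> = ennreal (1 / norm \<eta> ^ m) * indicator {x. 1 \<le> norm x} \<eta>" for \<eta>
      have h1: "h1 \<in> borel_measurable lborel" unfolding h1_def by measurable
      have h2: "h2 \<in> borel_measurable lborel" unfolding h2_def by measurable
      have b: "(indicator (ball 0 1) :: real ^ 'd \<Rightarrow> ennreal) \<in> borel_measurable lborel"
        by (intro borel_measurable_indicator) simp
      have "(\<integral>\<^sup>+\<eta>. ennreal \<theta> * h1 \<eta> + (ennreal C * h2 \<eta> + indicator (ball 0 1) \<eta>) \<partial>lborel)
        = (\<integral>\<^sup>+\<eta>. ennreal \<theta> * h1 \<eta> \<partial>lborel) + (\<integral>\<^sup>+\<eta>. ennreal C * h2 \<eta> + indicator (ball 0 1) \<eta> \<partial>lborel)"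
        using h1 h2 b by (intro nn_integral_add borel_measurable_add borel_measurable_times) auto
      also have "(\<integral>\<^sup>+\<eta>. ennreal C * h2 \<eta> + indicator (ball 0 1) \<eta> \<partial>lborel)
        = (\<integral>\<^sup>+\<eta>. ennreal C * h2 \<eta> \<partial>lborel) + V"
        unfolding V_def using h2 b by (subst nn_integral_add) (auto intro: borel_measurable_times)
      also have "(\<integral>\<^sup>+\<eta>. ennreal \<theta> * h1 \<eta> \<partial>lborel) = ennreal \<theta> * integral\<^sup>N lborel h1"
        by (rule nn_integral_cmult[OF h1])
      also have "(\<integral>\<^sup>+\<eta>. ennreal C * h2 \<eta> \<partial>lborel) = ennreal C * integral\<^sup>N lborel h2"
        by (rule nn_integral_cmult[OF h2])
      finally have "(\<integral>\<^sup>+\<eta>. ennreal \<theta> * h1 \<eta> + (ennreal C * h2 \<eta> + indicator (ball 0 1) \<eta>) \<partial>lborel)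
        = ennreal \<theta> * integral\<^sup>N lborel h1 + (ennreal C * integral\<^sup>N lborel h2 + V)"
        by (simp only: add.assoc)
      then show ?thesis unfolding T_def h1_def h2_def .
    qed
    also have "(\<integral>\<^sup>+\<eta>. ennreal (gauss (B n (B q \<eta>)) * fibre_energy n (B q \<eta>)) \<partial>lborel) = ennreal (1 / \<bar>det A\<bar> ^ q) * energy n"
      unfolding energy_def by (rule nn_integral_B[where f = "\<lambda>\<eta>. ennreal (gauss (B n \<eta>) * fibre_energy n \<eta>)"]) measurable
    also have "ennreal \<theta> * (ennreal (1 / \<bar>det A\<bar> ^ q) * energy n) = ennreal (\<theta> / \<bar>det A\<bar> ^ q) * energy n"
      using \<theta> by (simp add: mult.assoc[symmetric] ennreal_mult[symmetric])
    finally show ?thesis .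
  qed
  have "ennreal C * T + V < \<infinity>" using T V by (simp add: ennreal_mult_less_top)
  then obtain C' where "ennreal C * T + V = ennreal C'"
    by (cases "ennreal C * T + V") auto
  moreover have "\<theta> / \<bar>det A\<bar> ^ q = 4 * (16 / 9) ^ (r - 1) * real (M_q l A \<phi> \<kappa> q) / (real l * \<bar>det A\<bar>) ^ q"
    by (simp add: \<theta>_def power_mult_distrib)
  ultimately show ?thesis using rec by (intro exI[of _ C']) (metis (no_types, lifting))
qed

text \<open>With \<open>b = l |det A| > 1\<close>, dispersion with exponent \<open>\<beta> = (ln b) / 2\<close> gives \<open>M(q) \<le> b^(q/2)\<close> for large \<open>q\<close>.\<close>

lemma contraction_time:
  assumes disp: "derivative_dispersion l A \<phi> \<kappa>" and det: "\<bar>det A\<bar> > 1 / real l"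
  shows "\<exists>q\<ge>1. c * real (M_q l A \<phi> \<kappa> q) / (real l * \<bar>det A\<bar>) ^ q \<le> 1 / 2"
proof -
  define b where "b = real l * \<bar>det A\<bar>"
  have b: "1 < b" using det l2 by (simp add: b_def divide_less_eq mult.commute)
  define \<beta> where "\<beta> = ln b / 2"
  have \<beta>: "0 < \<beta>" using b by (simp add: \<beta>_def)
  have "limsup (\<lambda>q. ereal (ln (real (M_q l A \<phi> \<kappa> q)) / real q)) < ereal \<beta>"
    using disp \<beta> by (auto simp: derivative_dispersion_def cond_D_beta_def)
  then have ev: "eventually (\<lambda>q. ereal (ln (real (M_q l A \<phi> \<kappa> q)) / real q) < ereal \<beta>) sequentially"
    by (rule Limsup_lessD)
  have "(\<lambda>q. \<bar>c\<bar> * (1 / sqrt b) ^ q) \<longlonglongrightarrow> \<bar>c\<bar> * 0"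
    using b by (intro tendsto_mult_left LIMSEQ_power_zero) simp
  then have "eventually (\<lambda>q. \<bar>c\<bar> * (1 / sqrt b) ^ q < 1 / 2) sequentially"
    by (rule order_tendstoD(2)) simp
  with ev have "eventually (\<lambda>q. ereal (ln (real (M_q l A \<phi> \<kappa> q)) / real q) < ereal \<beta> \<and> \<bar>c\<bar> * (1 / sqrt b) ^ q < 1 / 2 \<and> 1 \<le> q) sequentially"
    using eventually_ge_at_top[of 1] by eventually_elim auto
  then obtain q where q: "ln (real (M_q l A \<phi> \<kappa> q)) / real q < \<beta>" "\<bar>c\<bar> * (1 / sqrt b) ^ q < 1 / 2" "1 \<le> q"
    by (auto simp: eventually_sequentially)
  have "real (M_q l A \<phi> \<kappa> q) \<le> sqrt b ^ q"
  proof (cases "M_q l A \<phi> \<kappa> q = 0")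
    case False
    have "ln (real (M_q l A \<phi> \<kappa> q)) < \<beta> * real q" using q by (simp add: divide_less_eq)
    then have "real (M_q l A \<phi> \<kappa> q) < exp (\<beta> * real q)" using False by (metis exp_less_cancel_iff exp_ln of_nat_0_less_iff neq0_conv)
    also have "\<dots> = exp \<beta> ^ q" by (simp add: exp_of_nat_mult[symmetric] mult.commute)
    also have "exp \<beta> = sqrt b" using b by (simp add: \<beta>_def ln_sqrt[symmetric])
    finally show ?thesis by simp
  qed (use b in simp)
  then have "\<bar>c\<bar> * real (M_q l A \<phi> \<kappa> q) / b ^ q \<le> \<bar>c\<bar> * sqrt b ^ q / b ^ q"
    using b by (intro divide_right_mono mult_left_mono) auto
  also have "\<dots> = \<bar>c\<bar> * (1 / sqrt b) ^ q"
  proof -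
    have "b ^ q = sqrt b ^ q * sqrt b ^ q" using b by (simp add: power_mult_distrib[symmetric])
    then show ?thesis using b by (simp add: power_divide)
  qed
  finally have "\<bar>c\<bar> * real (M_q l A \<phi> \<kappa> q) / b ^ q < 1 / 2" using q(2) by linarith
  moreover have "c * real (M_q l A \<phi> \<kappa> q) / b ^ q \<le> \<bar>c\<bar> * real (M_q l A \<phi> \<kappa> q) / b ^ q"
    using b by (intro divide_right_mono mult_right_mono) auto
  ultimately have "c * real (M_q l A \<phi> \<kappa> q) / b ^ q \<le> 1 / 2" by linarith
  with q(3) show ?thesis by (auto simp: b_def)
qed

text \<open>A step of length \<open>q\<close> maps the bound \<open>R\<close> to \<open>R/2 + |C|\<close>, which is at most \<open>R\<close> as soon as \<open>R \<ge> 2|C|\<close>; the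
  first \<open>q\<close> energies are finite and are added to \<open>R\<close>.\<close>

lemma energy_bounded:
  assumes disp: "derivative_dispersion l A \<phi> \<kappa>" and det: "\<bar>det A\<bar> > 1 / real l"
    and r: "real r \<ge> (real CARD('d) + 3) / 2"
  shows "\<exists>R\<ge>0. \<forall>n. energy n \<le> ennreal R"
proof -
  obtain q where q: "1 \<le> q" "4 * (16 / 9) ^ (r - 1) * real (M_q l A \<phi> \<kappa> q) / (real l * \<bar>det A\<bar>) ^ q \<le> 1 / 2"
    using contraction_time[OF disp det] by blast
  obtain C where C: "\<And>n. energy (q + n) \<le>
    ennreal (4 * (16 / 9) ^ (r - 1) * real (M_q l A \<phi> \<kappa> q) / (real l * \<bar>det A\<bar>) ^ q) * energy n + ennreal C"
    using energy_recursion[OF r, of q] by blast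
  define R0 where "R0 = (\<Sum>i<q. enn2real (energy i))"
  define R where "R = R0 + 2 * \<bar>C\<bar>"
  have R0: "0 \<le> R0" by (simp add: R0_def sum_nonneg)
  have "energy n \<le> ennreal R" for n
  proof (induction n rule: less_induct)
    case (less n)
    show ?case
    proof (cases "n < q")
      case True
      have "energy n = ennreal (enn2real (energy n))" using energy_finite[of n] by simp
      also have "enn2real (energy n) \<le> R0"
        unfolding R0_def using True by (intro member_le_sum) auto
      then have "ennreal (enn2real (energy n)) \<le> ennreal R" by (intro ennreal_leI) (simp add: R_def)
      finally show ?thesis .
    next
      case False
      then obtain k where k: "n = q + k" by (metis le_add_diff_inverse not_less)
      have "energy n \<le> ennreal (1 / 2) * ennreal R + ennreal C"
        unfolding k
      proof (rule order_trans[OF C add_right_mono[OF mult_mono]])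
        show "ennreal (4 * (16 / 9) ^ (r - 1) * real (M_q l A \<phi> \<kappa> q) / (real l * \<bar>det A\<bar>) ^ q) \<le> ennreal (1 / 2)"
          by (rule ennreal_leI[OF q(2)])
        show "energy k \<le> ennreal R" using less.IH[of k] k q(1) by simp
      qed simp_all
      also have "\<dots> \<le> ennreal (1 / 2) * ennreal R + ennreal \<bar>C\<bar>"
        by (intro add_left_mono ennreal_leI) simp
      also have "\<dots> = ennreal (1 / 2 * R + \<bar>C\<bar>)"
        using R0 by (subst ennreal_mult[symmetric]) (auto simp: R_def ennreal_plus[symmetric] simp del: ennreal_plus)
      also have "\<dots> \<le> ennreal R" using R0 by (intro ennreal_leI) (simp add: R_def)
      finally show ?thesis .
    qed
  qed
  then show ?thesis using R0 by (intro exI[of _ R]) (auto simp: R_def)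
qed

end

section \<open>Densities of pushed forward Gaussian data\<close>

text \<open>The variance is chosen so that the autocorrelation at \<open>v\<close> is proportional to \<open>exp (- |2\<pi>v|\<^sup>2 / 2)\<close>, which is the
  characteristic function of \<open>gauss\<close> at \<open>2\<pi>v\<close>.\<close>

definition bell :: "'a::euclidean_space \<Rightarrow> real" where
  "bell y = exp (- (4 * pi\<^sup>2 * (norm y)\<^sup>2))"

lemma bell_measurable [measurable]: "bell \<in> borel_measurable borel"
  unfolding bell_def by measurable

lemma bell_nonneg: "0 \<le> bell y" by (simp add: bell_def)

definition bell_mass :: "'a::euclidean_space itself \<Rightarrow> ennreal" where
  "bell_mass _ = (\<integral>\<^sup>+y. ennreal (exp (- (8 * pi\<^sup>2 * (norm (y :: 'a))\<^sup>2))) \<partial>lborel)"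

lemma bell_mass_finite: "bell_mass TYPE('a::euclidean_space) < \<infinity>"
proof -
  have "bell_mass TYPE('a) \<le> (\<integral>\<^sup>+y. ennreal (sqrt (2 * pi) ^ DIM('a)) * ennreal (gauss (y :: 'a)) \<partial>lborel)"
    unfolding bell_mass_def
  proof (rule nn_integral_mono)
    fix y :: 'a
    have "1 \<le> 16 * pi\<^sup>2"
    proof -
      have "1 \<le> pi\<^sup>2" using pi_gt3 by (intro one_le_power) simp
      then show ?thesis by simp
    qed
    then have "1 * (norm y)\<^sup>2 \<le> 16 * pi\<^sup>2 * (norm y)\<^sup>2" by (intro mult_right_mono) auto
    then have "exp (- (8 * pi\<^sup>2 * (norm y)\<^sup>2)) \<le> exp (- (norm y)\<^sup>2 / 2)" by simp
    also have "\<dots> = sqrt (2 * pi) ^ DIM('a) * gauss y" by (simp add: gauss_eq)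
    finally show "ennreal (exp (- (8 * pi\<^sup>2 * (norm y)\<^sup>2))) \<le> ennreal (sqrt (2 * pi) ^ DIM('a)) * ennreal (gauss y)"
      by (simp add: ennreal_mult[symmetric] gauss_nonneg ennreal_leI)
  qed
  also have "\<dots> = ennreal (sqrt (2 * pi) ^ DIM('a))"
    by (simp add: nn_integral_cmult nn_integral_gauss)
  finally show ?thesis by (rule le_less_trans) simp
qed

text \<open>The parallelogram law \<open>|y|\<^sup>2 + |y - v|\<^sup>2 = 2|y - v/2|\<^sup>2 + |v|\<^sup>2/2\<close> separates the variables.\<close>

lemma bell_autocorrelation:
  fixes v :: "'a::euclidean_space"
  shows "(\<integral>\<^sup>+y. ennreal (bell y * bell (y - v)) \<partial>lborel)
     = bell_mass TYPE('a) * ennreal (\<integral>\<eta>. gauss \<eta> * cos (2 * pi * (\<eta> \<bullet> v)) \<partial>lborel)"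
proof -
  let ?g = "\<lambda>y :: 'a. ennreal (exp (- (8 * pi\<^sup>2 * (norm y)\<^sup>2)))"
  have "bell y * bell (y - v) = exp (- (8 * pi\<^sup>2 * (norm (- (v /\<^sub>R 2) + y))\<^sup>2)) * exp (- (norm ((2 * pi) *\<^sub>R v))\<^sup>2 / 2)" for y
  proof -
    have "(norm y)\<^sup>2 + (norm (y - v))\<^sup>2 = 2 * (norm (- (v /\<^sub>R 2) + y))\<^sup>2 + (norm v)\<^sup>2 / 2"
      by (simp add: power2_norm_eq_inner inner_diff_left inner_diff_right inner_add_left inner_add_right inner_commute field_simps)
    then have "4 * pi\<^sup>2 * ((norm y)\<^sup>2 + (norm (y - v))\<^sup>2) = 4 * pi\<^sup>2 * (2 * (norm (- (v /\<^sub>R 2) + y))\<^sup>2 + (norm v)\<^sup>2 / 2)"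
      by (rule arg_cong)
    then show ?thesis
      by (simp only: bell_def exp_add[symmetric] norm_scaleR power_mult_distrib) (simp add: algebra_simps)
  qed
  then have "(\<integral>\<^sup>+y. ennreal (bell y * bell (y - v)) \<partial>lborel)
    = (\<integral>\<^sup>+y. ?g (- (v /\<^sub>R 2) + y) * ennreal (exp (- (norm ((2 * pi) *\<^sub>R v))\<^sup>2 / 2)) \<partial>lborel)"
    by (simp add: ennreal_mult)
  also have "\<dots> = (\<integral>\<^sup>+y. ?g (- (v /\<^sub>R 2) + y) \<partial>lborel) * ennreal (exp (- (norm ((2 * pi) *\<^sub>R v))\<^sup>2 / 2))"
    by (rule nn_integral_multc) simp
  also have "(\<integral>\<^sup>+y. ?g (- (v /\<^sub>R 2) + y) \<partial>lborel) = bell_mass TYPE('a)"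
    unfolding bell_mass_def by (rule nn_integral_translation) simp
  also have "exp (- (norm ((2 * pi) *\<^sub>R v))\<^sup>2 / 2) = (\<integral>\<eta>. gauss \<eta> * cos (\<eta> \<bullet> ((2 * pi) *\<^sub>R v)) \<partial>lborel)"
    by (rule fourier_gauss[symmetric])
  finally show ?thesis by (simp add: mult.assoc)
qed

lemma nn_integral_circle_expand:
  assumes m: "0 < m" and [measurable]: "\<Phi> \<in> borel_measurable borel"
  shows "(\<integral>\<^sup>+x. \<Phi> (real m * x) * indicator {0..<1} x \<partial>lborel)
    = ennreal (1 / real m) * (\<Sum>N<m. \<integral>\<^sup>+x. \<Phi> (x + real N) * indicator {0..<1} x \<partial>lborel)"
proof -
  have "(\<Sum>N<m. \<integral>\<^sup>+x. \<Phi> (x + real N) * indicator {0..<1} x \<partial>lborel)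
    = (\<Sum>N<m. \<integral>\<^sup>+x. \<Phi> x * indicator {real N..<real N + 1} x \<partial>lborel)"
  proof (rule sum.cong[OF refl])
    fix N
    have "(\<integral>\<^sup>+x. \<Phi> (real N + x) * indicator {real N..<real N + 1} (real N + x) \<partial>lborel)
      = (\<integral>\<^sup>+x. \<Phi> x * indicator {real N..<real N + 1} x \<partial>lborel)"
      by (rule nn_integral_translation) simp
    moreover have "\<Phi> (real N + x) * indicator {real N..<real N + 1} (real N + x) = \<Phi> (x + real N) * indicator {0..<1} x" for x
      by (auto simp: add.commute split: split_indicator)
    ultimately show "(\<integral>\<^sup>+x. \<Phi> (x + real N) * indicator {0..<1} x \<partial>lborel)
      = (\<integral>\<^sup>+x. \<Phi> x * indicator {real N..<real N + 1} x \<partial>lborel)" by simp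
  qed
  also have "\<dots> = (\<integral>\<^sup>+x. (\<Sum>N<m. \<Phi> x * indicator {real N..<real N + 1} x) \<partial>lborel)"
    by (rule nn_integral_sum[symmetric]) simp
  also have "\<dots> = (\<integral>\<^sup>+x. \<Phi> x * indicator {0..<real m} x \<partial>lborel)"
  proof (rule nn_integral_cong)
    fix x :: real
    have "(\<Sum>N<m. indicator {real N..<real N + 1} x :: ennreal) = indicator {0..<real m} x"
    proof (induction m)
      case (Suc m)
      then show ?case by (auto split: split_indicator)
    qed simp
    then show "(\<Sum>N<m. \<Phi> x * indicator {real N..<real N + 1} x) = \<Phi> x * indicator {0..<real m} x"
      by (simp add: sum_distrib_left[symmetric])
  qed
  also have "\<dots> = ennreal (real m) * (\<integral>\<^sup>+x. \<Phi> (0 + real m * x) * indicator {0..<real m} (0 + real m * x) \<partial>lborel)"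
    using m by (subst nn_integral_real_affine[where c = "real m" and t = 0]) auto
  also have "(\<lambda>x. \<Phi> (0 + real m * x) * indicator {0..<real m} (0 + real m * x)) = (\<lambda>x. \<Phi> (real m * x) * indicator {0..<1} x)"
    using m by (auto simp: fun_eq_iff zero_le_mult_iff split: split_indicator)
  finally have "ennreal (1 / real m) * (\<Sum>N<m. \<integral>\<^sup>+x. \<Phi> (x + real N) * indicator {0..<1} x \<partial>lborel)
    = (ennreal (1 / real m) * ennreal (real m)) * (\<integral>\<^sup>+x. \<Phi> (real m * x) * indicator {0..<1} x \<partial>lborel)"
    by (simp add: mult.assoc)
  also have "ennreal (1 / real m) * ennreal (real m) = 1" using m by (simp add: ennreal_mult[symmetric])
  finally show ?thesis by simp
qed

lemma cyc_measurable [measurable]: "cyc \<in> borel_measurable borel"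
  by (intro borel_measurable_continuous_onI continuous_on_cyc continuous_on_id)

lemma cmod_sum_cyc_squared:
  "(\<Sum>N<m. \<Sum>N'<m. cos (2 * pi * (a N - a N'))) = (cmod (\<Sum>N<m. cyc (a N)))\<^sup>2"
proof -
  have "complex_of_real ((cmod (\<Sum>N<m. cyc (a N)))\<^sup>2) = (\<Sum>N<m. \<Sum>N'<m. cyc (a N - a N'))"
    unfolding complex_norm_square
    by (simp add: cnj_cyc sum_product cyc_add[symmetric])
  then have "(cmod (\<Sum>N<m. cyc (a N)))\<^sup>2 = Re (\<Sum>N<m. \<Sum>N'<m. cyc (a N - a N'))"
    by (metis Re_complex_of_real)
  then show ?thesis by (simp add: cyc_def)
qed

context solenoidal
begin

text \<open>After \<open>i\<close> steps the fibre coordinate is the affine image of \<open>y\<close> with translation part \<open>s\<^sub>i(l\<^sup>i x)\<close>: the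
  lifted base point \<open>l\<^sup>i x\<close> already contains the code of the word that leads back to \<open>x\<close>.\<close>

lemma T_iterate:
  assumes x: "x \<in> {0..<1}"
  shows "(T_map l A \<phi> ^^ i) (x, y) = (frac (real l ^ i * x), matrix_pow A i *v y + s i 0 (real l ^ i * x))"
proof (induction i)
  case 0
  then show ?case using x by (simp add: graph_sum_def frac_eq)
next
  case (Suc i)
  let ?t = "real l ^ i * x"
  have "?t = frac ?t + real (nat \<lfloor>?t\<rfloor>)" using x by (simp add: frac_def)
  then have \<phi>: "\<phi> (frac ?t) = \<phi> ?t"
    using periodic_add_nat[of \<phi> "frac ?t" "nat \<lfloor>?t\<rfloor>", OF phi_periodic] by simp
  have t: "real l ^ Suc i * x / real l = ?t" using l2 by simp
  have "s (1 + i) 0 (real l ^ Suc i * x) = s 1 0 (real l ^ Suc i * x) + matrix_pow A 1 *v s i 0 (real l ^ Suc i * x / real l)"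
    using s_add[of 1 i 0 "real l ^ Suc i * x"] by simp
  also have "s 1 0 (real l ^ Suc i * x) = \<phi> ?t"
    unfolding graph_sum_def using t by simp
  also have "matrix_pow A 1 = A" using matrix_pow_Suc[of A 0] by simp
  finally have s: "s (Suc i) 0 (real l ^ Suc i * x) = \<phi> ?t + A *v s i 0 ?t" unfolding t by simp
  have "(T_map l A \<phi> ^^ Suc i) (x, y) = T_map l A \<phi> (frac ?t, matrix_pow A i *v y + s i 0 ?t)"
    using Suc.IH by simp
  also have "\<dots> = (frac (real l * frac ?t), A *v (matrix_pow A i *v y + s i 0 ?t) + \<phi> (frac ?t))"
    by (simp add: T_map_def tau_def)
  also have "\<dots> = (frac (real l ^ Suc i * x), matrix_pow A (Suc i) *v y + s (Suc i) 0 (real l ^ Suc i * x))"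
    unfolding s \<phi> frac_mult_frac
    by (simp add: matrix_vector_right_distrib matrix_vector_mul_assoc matrix_pow_Suc mult.assoc add_ac)
  finally show ?case .
qed

lemma s_measurable [measurable]: "s n 0 \<in> borel_measurable borel"
  by (intro borel_measurable_continuous_onI s_continuous) simp

definition inv_pow :: "nat \<Rightarrow> real ^ 'd ^ 'd" where
  "inv_pow i = matrix_inv (matrix_pow A i)"

lemma inv_pow: "matrix_pow A i ** inv_pow i = mat 1" "inv_pow i ** matrix_pow A i = mat 1"
  using invertible_matrix_pow[OF inv, of i]
  unfolding inv_pow_def matrix_inv_def invertible_def by (metis (mono_tags, lifting) someI_ex)+

lemma det_inv_pow: "\<bar>det (inv_pow i)\<bar> * \<bar>det A\<bar> ^ i = 1" "det (inv_pow i) \<noteq> 0"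
proof -
  have "det (inv_pow i) * det A ^ i = 1"
    using arg_cong[OF inv_pow(2), of det i] by (simp add: det_mul det_matrix_pow)
  then show "\<bar>det (inv_pow i)\<bar> * \<bar>det A\<bar> ^ i = 1" "det (inv_pow i) \<noteq> 0"
    by (auto simp flip: abs_mult power_abs)
qed

text \<open>The density, in the fibre over \<open>x\<close>, of the image under the \<open>i\<close>-th iterate of Lebesgue measure on the
  circle times the weight \<open>bell\<close>; see \<open>pushforward_density\<close>.\<close>

definition push_density :: "nat \<Rightarrow> real \<Rightarrow> real ^ 'd \<Rightarrow> real" where
  "push_density i x w = \<bar>det (inv_pow i)\<bar> / real (l ^ i) *
     (\<Sum>N<l ^ i. bell (inv_pow i *v (w - s i 0 (x + real N))))"

lemma push_density_measurable [measurable]: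
  "(\<lambda>(x, w). push_density i x w) \<in> borel_measurable (borel \<Otimes>\<^sub>M borel)"
  unfolding push_density_def case_prod_unfold by measurable

lemma nn_integral_bell_product:
  fixes a b :: "real ^ 'd"
  shows "ennreal \<bar>det (inv_pow i)\<bar> * (\<integral>\<^sup>+w. ennreal (bell (inv_pow i *v (w - a)) * bell (inv_pow i *v (w - b))) \<partial>lborel)
    = bell_mass TYPE(real ^ 'd) * ennreal (\<integral>\<eta>. gauss \<eta> * cos (2 * pi * (\<eta> \<bullet> (inv_pow i *v (b - a)))) \<partial>lborel)"
proof -
  let ?g = "\<lambda>y. ennreal (bell y * bell (y - inv_pow i *v (b - a)))"
  let ?f = "\<lambda>w. ennreal (bell (inv_pow i *v (w - a)) * bell (inv_pow i *v (w - b)))"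
  have f: "?f \<in> borel_measurable borel" by measurable
  have g: "?g \<in> borel_measurable borel" by measurable
  have "?f (a + v) = ?g (inv_pow i *v v)" for v
  proof -
    have "a + v - a = v" "a + v - b = v - (b - a)" by simp_all
    then show ?thesis by (simp only: matrix_vector_mult_diff_distrib)
  qed
  then have "(\<integral>\<^sup>+w. ?f w \<partial>lborel) = (\<integral>\<^sup>+v. ?g (inv_pow i *v v) \<partial>lborel)"
    using nn_integral_translation[OF f, of a] by simp
  then have "ennreal \<bar>det (inv_pow i)\<bar> * (\<integral>\<^sup>+w. ?f w \<partial>lborel) = (\<integral>\<^sup>+y. ?g y \<partial>lborel)"
    unfolding nn_integral_matrix[OF det_inv_pow(2)[of i] g] by (rule arg_cong)
  then show ?thesis unfolding bell_autocorrelation .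
qed

text \<open>Plancherel for a mixture of translates of one Gaussian: the square of the sum is a double sum of
  autocorrelations, each of them is a Fourier integral by \<open>bell_autocorrelation\<close>, and summing the
  cosines of all differences gives the square of the absolute value of \<open>fibre_char\<close>.\<close>

lemma push_density_energy_fibre:
  "(\<integral>\<^sup>+w. ennreal ((push_density i x w)\<^sup>2) \<partial>lborel)
    = bell_mass TYPE(real ^ 'd) * (\<integral>\<^sup>+\<eta>. ennreal (gauss (B i \<eta>) * (cmod (fibre_char i \<eta> x))\<^sup>2) \<partial>lborel)"
proof -
  define L where "L = l ^ i"
  have L: "0 < L" by (simp add: L_def)
  define \<delta> where "\<delta> = \<bar>det (inv_pow i)\<bar>"
  define p where "p N = s i 0 (x + real N)" for N
  define Z where "Z = bell_mass TYPE(real ^ 'd)"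
  define c where "c N N' = (\<integral>\<eta>. gauss \<eta> * cos (2 * pi * (\<eta> \<bullet> (inv_pow i *v (p N - p N')))) \<partial>lborel)" for N N'
  have \<delta>: "0 < \<delta>" using det_inv_pow(2)[of i] by (simp add: \<delta>_def)
  have int: "integrable lborel (\<lambda>\<eta>. gauss \<eta> * cos (2 * pi * (\<eta> \<bullet> v)))" for v :: "real ^ 'd"
    by (rule Bochner_Integration.integrable_bound[OF integrable_gauss])
       (auto simp: abs_mult gauss_nonneg mult_left_le abs_cos_le_one)
  have c_nonneg: "0 \<le> c N N'" for N N'
  proof -
    have "c N N' = exp (- (norm ((2 * pi) *\<^sub>R (inv_pow i *v (p N - p N'))))\<^sup>2 / 2)"
      unfolding c_def by (subst fourier_gauss[symmetric]) simp
    then show ?thesis by simp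
  qed
  have sq: "(push_density i x w)\<^sup>2 = (\<delta> / (real L)\<^sup>2) * (\<Sum>N'<L. \<Sum>N<L. \<delta> * (bell (inv_pow i *v (w - p N')) * bell (inv_pow i *v (w - p N))))" for w
    by (simp add: push_density_def \<delta>_def[symmetric] L_def[symmetric] p_def[symmetric] power2_eq_square
        sum_product sum_distrib_left mult_ac)
  have "(\<integral>\<^sup>+w. ennreal ((push_density i x w)\<^sup>2) \<partial>lborel)
    = (\<integral>\<^sup>+w. ennreal (\<delta> / (real L)\<^sup>2) * (\<Sum>N'<L. \<Sum>N<L. ennreal \<delta> * ennreal (bell (inv_pow i *v (w - p N')) * bell (inv_pow i *v (w - p N)))) \<partial>lborel)"
  proof (rule nn_integral_cong)
    fix w
    define t where "t N' N = bell (inv_pow i *v (w - p N')) * bell (inv_pow i *v (w - p N))" for N' N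
    have t: "0 \<le> t N' N" for N' N by (simp add: t_def bell_nonneg)
    have "(\<Sum>N'<L. \<Sum>N<L. ennreal \<delta> * ennreal (t N' N)) = ennreal (\<Sum>N'<L. \<Sum>N<L. \<delta> * t N' N)"
      using \<delta> t by (simp add: ennreal_mult[symmetric] sum_ennreal sum_nonneg)
    moreover have "ennreal (\<delta> / (real L)\<^sup>2 * (\<Sum>N'<L. \<Sum>N<L. \<delta> * t N' N)) = ennreal (\<delta> / (real L)\<^sup>2) * ennreal (\<Sum>N'<L. \<Sum>N<L. \<delta> * t N' N)"
      using \<delta> t by (intro ennreal_mult sum_nonneg) auto
    ultimately show "ennreal ((push_density i x w)\<^sup>2) = ennreal (\<delta> / (real L)\<^sup>2) * (\<Sum>N'<L. \<Sum>N<L. ennreal \<delta> * ennreal (bell (inv_pow i *v (w - p N')) * bell (inv_pow i *v (w - p N))))"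
      unfolding sq t_def by simp
  qed
  also have "\<dots> = ennreal (\<delta> / (real L)\<^sup>2) * (\<Sum>N'<L. \<Sum>N<L. ennreal \<delta> * (\<integral>\<^sup>+w. ennreal (bell (inv_pow i *v (w - p N')) * bell (inv_pow i *v (w - p N))) \<partial>lborel))"
    by (simp add: nn_integral_cmult nn_integral_sum)
  also have "\<dots> = ennreal (\<delta> / (real L)\<^sup>2) * (\<Sum>N'<L. \<Sum>N<L. Z * ennreal (c N N'))"
    unfolding \<delta>_def nn_integral_bell_product Z_def c_def ..
  also have "\<dots> = Z * ennreal \<delta> * ennreal ((\<Sum>N'<L. \<Sum>N<L. c N N') / (real L)\<^sup>2)"
  proof -
    have "(\<Sum>N'<L. \<Sum>N<L. Z * ennreal (c N N')) = Z * ennreal (\<Sum>N'<L. \<Sum>N<L. c N N')"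
      by (simp add: sum_distrib_left[symmetric] sum_ennreal c_nonneg sum_nonneg)
    moreover have "ennreal (\<delta> / (real L)\<^sup>2) * ennreal y = ennreal \<delta> * ennreal (y / (real L)\<^sup>2)" if "0 \<le> y" for y
      using \<delta> that by (simp add: ennreal_mult[symmetric])
    moreover have "0 \<le> (\<Sum>N'<L. \<Sum>N<L. c N N')" using c_nonneg by (intro sum_nonneg)
    ultimately have "ennreal (\<delta> / (real L)\<^sup>2) * (\<Sum>N'<L. \<Sum>N<L. Z * ennreal (c N N'))
      = Z * (ennreal \<delta> * ennreal ((\<Sum>N'<L. \<Sum>N<L. c N N') / (real L)\<^sup>2))"
      by (metis mult.left_commute)
    then show ?thesis by (simp only: mult.assoc)
  qed
  also have "(\<Sum>N'<L. \<Sum>N<L. c N N') / (real L)\<^sup>2 = (\<integral>\<eta>. gauss \<eta> * (cmod (fibre_char i (transpose (inv_pow i) *v \<eta>) x))\<^sup>2 \<partial>lborel)"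
  proof -
    have "(\<Sum>N'<L. \<Sum>N<L. c N N') / (real L)\<^sup>2
      = (\<integral>\<eta>. (\<Sum>N'<L. \<Sum>N<L. gauss \<eta> * cos (2 * pi * (\<eta> \<bullet> (inv_pow i *v (p N - p N'))))) / (real L)\<^sup>2 \<partial>lborel)"
      unfolding c_def by (simp add: Bochner_Integration.integral_sum int)
    also have "\<dots> = (\<integral>\<eta>. gauss \<eta> * (cmod (fibre_char i (transpose (inv_pow i) *v \<eta>) x))\<^sup>2 \<partial>lborel)"
    proof (rule Bochner_Integration.integral_cong[OF refl])
      fix \<eta> :: "real ^ 'd"
      define a where "a N = (transpose (inv_pow i) *v \<eta>) \<bullet> p N" for N
      have "\<eta> \<bullet> (inv_pow i *v (p N - p N')) = a N - a N'" for N N'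
        by (simp add: a_def transpose_matrix_vector dot_lmul_matrix matrix_vector_mult_diff_distrib inner_diff_right)
      then have "(\<Sum>N'<L. \<Sum>N<L. gauss \<eta> * cos (2 * pi * (\<eta> \<bullet> (inv_pow i *v (p N - p N')))))
        = gauss \<eta> * (\<Sum>N'<L. \<Sum>N<L. cos (2 * pi * (a N - a N')))"
        by (simp add: sum_distrib_left)
      also have "(\<Sum>N'<L. \<Sum>N<L. cos (2 * pi * (a N - a N'))) = (cmod (\<Sum>N<L. cyc (a N)))\<^sup>2"
        by (subst sum.swap) (rule cmod_sum_cyc_squared)
      also have "(\<Sum>N<L. cyc (a N)) = fibre_char i (transpose (inv_pow i) *v \<eta>) x * of_nat L"
        using L by (simp add: fibre_char_def a_def p_def L_def)
      finally show "(\<Sum>N'<L. \<Sum>N<L. gauss \<eta> * cos (2 * pi * (\<eta> \<bullet> (inv_pow i *v (p N - p N'))))) / (real L)\<^sup>2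
        = gauss \<eta> * (cmod (fibre_char i (transpose (inv_pow i) *v \<eta>) x))\<^sup>2"
        using L by (simp add: norm_mult power_mult_distrib)
    qed
    finally show ?thesis .
  qed
  also have "ennreal (\<integral>\<eta>. gauss \<eta> * (cmod (fibre_char i (transpose (inv_pow i) *v \<eta>) x))\<^sup>2 \<partial>lborel)
    = (\<integral>\<^sup>+\<eta>. ennreal (gauss \<eta> * (cmod (fibre_char i (transpose (inv_pow i) *v \<eta>) x))\<^sup>2) \<partial>lborel)"
  proof (rule nn_integral_eq_integral[symmetric])
    have meas: "(\<lambda>\<eta>. fibre_char i (transpose (inv_pow i) *v \<eta>) x) \<in> borel_measurable borel"
      unfolding fibre_char_def by measurable
    show "integrable lborel (\<lambda>\<eta>. gauss \<eta> * (cmod (fibre_char i (transpose (inv_pow i) *v \<eta>) x))\<^sup>2)"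
      using meas by (intro Bochner_Integration.integrable_bound[OF integrable_gauss])
         (auto simp: abs_mult gauss_nonneg intro!: mult_left_le power_le_one cmod_fibre_char_le)
  qed (auto simp: gauss_nonneg)
  also have "Z * ennreal \<delta> * \<dots> = Z * (\<integral>\<^sup>+\<eta>. ennreal (gauss (B i \<eta>) * (cmod (fibre_char i \<eta> x))\<^sup>2) \<partial>lborel)"
  proof -
    have meas: "(\<lambda>\<eta>. ennreal (gauss \<eta> * (cmod (fibre_char i (transpose (inv_pow i) *v \<eta>) x))\<^sup>2)) \<in> borel_measurable borel"
      unfolding fibre_char_def by measurable
    have id: "transpose (inv_pow i) *v (B i \<eta>) = \<eta>" for \<eta>
      by (simp only: matrix_vector_mul_assoc matrix_transpose_mul[symmetric] inv_pow transpose_mat matrix_vector_mul_lid)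
    have "(\<integral>\<^sup>+\<eta>. ennreal (gauss (B i \<eta>) * (cmod (fibre_char i \<eta> x))\<^sup>2) \<partial>lborel)
      = ennreal (1 / \<bar>det A\<bar> ^ i) * (\<integral>\<^sup>+\<eta>. ennreal (gauss \<eta> * (cmod (fibre_char i (transpose (inv_pow i) *v \<eta>) x))\<^sup>2) \<partial>lborel)"
      using nn_integral_B[OF meas, of i] unfolding id .
    moreover have "1 / \<bar>det A\<bar> ^ i = \<delta>"
      using det_inv_pow(1)[of i] det_A by (simp add: \<delta>_def field_simps)
    ultimately show ?thesis by (simp add: mult.assoc)
  qed
  finally show ?thesis by (simp add: Z_def)
qed

lemma push_density_energy:
  "(\<integral>\<^sup>+x. (\<integral>\<^sup>+w. ennreal ((push_density i x w)\<^sup>2) \<partial>lborel) * indicator {0..<1} x \<partial>lborel)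
    \<le> bell_mass TYPE(real ^ 'd) * energy i"
proof -
  have meas [measurable]: "(\<lambda>(x, \<eta>). ennreal (gauss (B i \<eta>) * (cmod (fibre_char i \<eta> x))\<^sup>2)) \<in> borel_measurable (borel \<Otimes>\<^sub>M borel)"
    unfolding fibre_char_def case_prod_unfold by measurable
  have "(\<integral>\<^sup>+x. (\<integral>\<^sup>+w. ennreal ((push_density i x w)\<^sup>2) \<partial>lborel) * indicator {0..<1} x \<partial>lborel)
    = bell_mass TYPE(real ^ 'd) * (\<integral>\<^sup>+x. (\<integral>\<^sup>+\<eta>. ennreal (gauss (B i \<eta>) * (cmod (fibre_char i \<eta> x))\<^sup>2) * indicator {0..<1} x \<partial>lborel) \<partial>lborel)"
    unfolding push_density_energy_fibre
    by (simp add: nn_integral_cmult nn_integral_multc mult.assoc)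
  also have "(\<integral>\<^sup>+x. (\<integral>\<^sup>+\<eta>. ennreal (gauss (B i \<eta>) * (cmod (fibre_char i \<eta> x))\<^sup>2) * indicator {0..<1} x \<partial>lborel) \<partial>lborel)
    = (\<integral>\<^sup>+\<eta>. (\<integral>\<^sup>+x. ennreal (gauss (B i \<eta>) * (cmod (fibre_char i \<eta> x))\<^sup>2) * indicator {0..<1} x \<partial>lborel) \<partial>lborel)"
    by (rule lborel_pair.Fubini') measurable
  also have "\<dots> \<le> energy i"
    unfolding energy_def
  proof (rule nn_integral_mono)
    fix \<eta> :: "real ^ 'd"
    have "((\<lambda>x. gauss (B i \<eta>) * (cmod (fibre_char i \<eta> x))\<^sup>2) has_integral (gauss (B i \<eta>) * fibre_energy i \<eta>)) {0..1}"
      unfolding fibre_energy_def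
      by (intro has_integral_mult_right integrable_integral integrable_continuous_real continuous_intros fibre_char_continuous_compose)
    then have "(\<integral>\<^sup>+x. ennreal (gauss (B i \<eta>) * (cmod (fibre_char i \<eta> x))\<^sup>2) * indicator {0..1} x \<partial>lborel) = ennreal (gauss (B i \<eta>) * fibre_energy i \<eta>)"
      by (rule nn_integral_has_integral_lebesgue'[rotated]) (simp add: gauss_nonneg)
    moreover have "(\<integral>\<^sup>+x. ennreal (gauss (B i \<eta>) * (cmod (fibre_char i \<eta> x))\<^sup>2) * indicator {0..<1} x \<partial>lborel)
      \<le> (\<integral>\<^sup>+x. ennreal (gauss (B i \<eta>) * (cmod (fibre_char i \<eta> x))\<^sup>2) * indicator {0..1} x \<partial>lborel)"
      by (intro nn_integral_mono) (auto split: split_indicator)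
    ultimately show "(\<integral>\<^sup>+x. ennreal (gauss (B i \<eta>) * (cmod (fibre_char i \<eta> x))\<^sup>2) * indicator {0..<1} x \<partial>lborel)
      \<le> ennreal (gauss (B i \<eta>) * fibre_energy i \<eta>)" by simp
  qed
  finally show ?thesis by (simp add: mult_left_mono)
qed

end

section \<open>Integration over the cylinder\<close>

lemma space_lebesgue_cyl: "space (lebesgue_cyl :: (real \<times> (real ^ 'd)) measure) = {0..<1} \<times> UNIV"
  by (simp add: lebesgue_cyl_def space_pair_measure space_restrict_space)

lemma measurable_id_lebesgue_cyl:
  "(\<lambda>z. z) \<in> (lebesgue_cyl :: (real \<times> (real ^ 'd)) measure) \<rightarrow>\<^sub>M borel"
proof -
  have 1: "(\<lambda>x. x) \<in> restrict_space lborel {0..<1::real} \<rightarrow>\<^sub>M borel"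
    by (rule measurable_restrict_space1) simp
  have "(\<lambda>z. (fst z, snd z)) \<in> restrict_space lborel {0..<1::real} \<Otimes>\<^sub>M (lborel :: (real ^ 'd) measure) \<rightarrow>\<^sub>M borel \<Otimes>\<^sub>M borel"
    using measurable_compose[OF measurable_fst 1] by (intro measurable_Pair) auto
  then show ?thesis by (simp add: lebesgue_cyl_def borel_prod)
qed

lemma measurable_lebesgue_cyl:
  "g \<in> borel_measurable borel \<Longrightarrow> g \<in> borel_measurable (lebesgue_cyl :: (real \<times> (real ^ 'd)) measure)"
  by (rule measurable_compose[OF measurable_id_lebesgue_cyl])

lemma borel_Int_cyl_sets:
  assumes "S \<in> sets borel" shows "S \<inter> ({0..<1} \<times> UNIV) \<in> sets (lebesgue_cyl :: (real \<times> (real ^ 'd)) measure)"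
  using measurable_sets[OF measurable_id_lebesgue_cyl assms] by (simp add: space_lebesgue_cyl)

lemma sets_lebesgue_cyl_borel:
  assumes "S \<in> sets (lebesgue_cyl :: (real \<times> (real ^ 'd)) measure)" shows "S \<in> sets borel"
proof -
  have "sets (lebesgue_cyl :: (real \<times> (real ^ 'd)) measure) = sets (restrict_space borel {0..<1::real} \<Otimes>\<^sub>M borel)"
    unfolding lebesgue_cyl_def by (intro sets_pair_measure_cong sets_restrict_space_cong) simp_all
  also have "\<dots> \<subseteq> sets (borel \<Otimes>\<^sub>M borel)"
  proof (rule sets_pair_in_sets)
    fix a :: "real set" and b :: "(real ^ 'd) set"
    assume "a \<in> sets (restrict_space borel {0..<1})" "b \<in> sets borel"
    then show "a \<times> b \<in> sets (borel \<Otimes>\<^sub>M borel)"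
      by (intro pair_measureI) (auto simp: sets_restrict_space_iff)
  qed
  finally show ?thesis using assms unfolding borel_prod by blast
qed

lemma nn_integral_lebesgue_cyl:
  fixes g :: "real \<times> (real ^ 'd) \<Rightarrow> ennreal"
  assumes g: "g \<in> borel_measurable borel"
  shows "(\<integral>\<^sup>+z. g z \<partial>lebesgue_cyl) = (\<integral>\<^sup>+x. (\<integral>\<^sup>+y. g (x, y) \<partial>lborel) * indicator {0..<1} x \<partial>lborel)"
proof -
  have "(\<integral>\<^sup>+z. g z \<partial>lebesgue_cyl) = (\<integral>\<^sup>+x. (\<integral>\<^sup>+y. g (x, y) \<partial>lborel) \<partial>restrict_space lborel {0..<1})"
    using measurable_lebesgue_cyl[OF g] unfolding lebesgue_cyl_def by (rule lborel.nn_integral_fst[symmetric])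
  then show ?thesis by (simp add: nn_integral_restrict_space)
qed

lemma nn_integral_strip_finite:
  "(\<integral>\<^sup>+z. indicator {z. norm (snd z) \<le> \<rho>} z \<partial>(lebesgue_cyl :: (real \<times> (real ^ 'd)) measure)) < \<infinity>"
proof -
  have "closed {z :: real \<times> (real ^ 'd). norm (snd z) \<le> \<rho>}"
    by (intro closed_Collect_le continuous_intros)
  then have "{z :: real \<times> (real ^ 'd). norm (snd z) \<le> \<rho>} \<in> sets borel" by simp
  then have "(\<integral>\<^sup>+z. indicator {z. norm (snd z) \<le> \<rho>} z \<partial>(lebesgue_cyl :: (real \<times> (real ^ 'd)) measure))
    = (\<integral>\<^sup>+x. (\<integral>\<^sup>+y. indicator {z. norm (snd z) \<le> \<rho>} (x, y) \<partial>(lborel :: (real ^ 'd) measure)) * indicator {0..<1} (x::real) \<partial>lborel)"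
    by (intro nn_integral_lebesgue_cyl borel_measurable_indicator)
  also have "\<dots> = (\<integral>\<^sup>+x. emeasure lborel (cball (0 :: real ^ 'd) \<rho>) * indicator {0..<1} (x::real) \<partial>lborel)"
  proof -
    have "(\<integral>\<^sup>+y. indicator {z. norm (snd z) \<le> \<rho>} (x, y) \<partial>(lborel :: (real ^ 'd) measure))
      = (\<integral>\<^sup>+y. indicator (cball 0 \<rho>) y \<partial>(lborel :: (real ^ 'd) measure))" for x :: real
      by (intro nn_integral_cong) (auto simp: dist_norm split: split_indicator)
    then show ?thesis by simp
  qed
  also have "\<dots> = emeasure lborel (cball (0 :: real ^ 'd) \<rho>)"
    by (simp add: nn_integral_cmult_indicator)
  also have "\<dots> < \<infinity>" by (intro emeasure_bounded_finite) simp
  finally show ?thesis .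
qed

text \<open>This replaces the Cauchy-Schwarz inequality between a test function and a density; the free
  parameter \<open>t\<close> is optimised at the very end.\<close>

lemma am_gm_weighted:
  fixes a b t :: real assumes "0 < t"
  shows "a * b \<le> t / 2 * a\<^sup>2 + 1 / (2 * t) * b\<^sup>2"
proof -
  have "0 \<le> (t * a - b)\<^sup>2 / (2 * t)" using assms by simp
  also have "(t * a - b)\<^sup>2 / (2 * t) = t / 2 * a\<^sup>2 + 1 / (2 * t) * b\<^sup>2 - a * b"
    using assms by (simp add: power2_eq_square field_simps)
  finally show ?thesis by simp
qed

context solenoidal
begin

context
  fixes f :: "real \<times> (real ^ 'd) \<Rightarrow> real"
  assumes f_cont: "continuous_on UNIV f" and f_per: "\<And>x y. f (x + 1, y) = f (x, y)" and f_nonneg: "\<And>z. 0 \<le> f z"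
begin

lemma f_measurable [measurable]: "f \<in> borel_measurable borel"
  by (intro borel_measurable_continuous_onI f_cont)

lemma f_measurable_pair [measurable]: "f \<in> borel_measurable (borel \<Otimes>\<^sub>M borel)"
  by (simp add: borel_prod)

lemma f_add_nat: "f (x + real N, y) = f (x, y)"
  using periodic_add_nat[of "\<lambda>x. f (x, y)"] f_per by simp

lemma f_iterate:
  assumes x: "x \<in> {0..<1}"
  shows "f ((T_map l A \<phi> ^^ i) (x, y)) = f (real l ^ i * x, matrix_pow A i *v y + s i 0 (real l ^ i * x))"
proof -
  let ?t = "real l ^ i * x"
  have "?t = frac ?t + real (nat \<lfloor>?t\<rfloor>)" using x by (simp add: frac_def)
  then have "f (?t, w) = f (frac ?t, w)" for w
    using f_add_nat[of "frac ?t" "nat \<lfloor>?t\<rfloor>" w] by simp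
  then show ?thesis unfolding T_iterate[OF x] by simp
qed

lemma lift_measurable [measurable]:
  "(\<lambda>z. f (real l ^ i * fst z, matrix_pow A i *v snd z + s i 0 (real l ^ i * fst z))) \<in> borel_measurable borel"
  by (intro borel_measurable_continuous_onI continuous_on_compose2[OF f_cont] continuous_intros
      linear_continuous_on_compose[OF _ matrix_vector_mul_linear] continuous_on_compose2[OF s_continuous]) auto

lemma iterate_measurable: "(\<lambda>z. f ((T_map l A \<phi> ^^ i) z)) \<in> borel_measurable lebesgue_cyl"
proof (subst measurable_cong)
  show "f ((T_map l A \<phi> ^^ i) z) = f (real l ^ i * fst z, matrix_pow A i *v snd z + s i 0 (real l ^ i * fst z))"
    if "z \<in> space lebesgue_cyl" for z
    using that f_iterate[of "fst z" i "snd z"] by (auto simp: space_lebesgue_cyl)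
qed (intro measurable_lebesgue_cyl lift_measurable)

lemma fibre_change_of_variables:
  "ennreal (1 / real (l ^ i)) * (\<Sum>N<l ^ i. \<integral>\<^sup>+y. ennreal (f (x + real N, matrix_pow A i *v y + s i 0 (x + real N)) * bell y) \<partial>lborel)
    = (\<integral>\<^sup>+w. ennreal (f (x, w) * push_density i x w) \<partial>lborel)"
proof -
  define \<delta> where "\<delta> = \<bar>det (inv_pow i)\<bar>"
  have \<delta>: "0 \<le> \<delta>" by (simp add: \<delta>_def)
  have f_fibre [measurable]: "(\<lambda>w. f (x, w)) \<in> borel_measurable borel"
    by (intro borel_measurable_continuous_onI continuous_on_compose2[OF f_cont] continuous_intros) auto
  have each: "(\<integral>\<^sup>+y. ennreal (f (x + real N, matrix_pow A i *v y + p) * bell y) \<partial>lborel)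
    = (\<integral>\<^sup>+w. ennreal \<delta> * ennreal (f (x, w) * bell (inv_pow i *v (w - p))) \<partial>lborel)" for N p
  proof -
    let ?g = "\<lambda>y. ennreal (f (x, matrix_pow A i *v y + p) * bell y)"
    let ?h = "\<lambda>w. ennreal (f (x, w) * bell (inv_pow i *v (w - p)))"
    have g: "?g \<in> borel_measurable borel" by measurable
    have h: "?h \<in> borel_measurable borel" by measurable
    have M: "matrix_pow A i *v (inv_pow i *v w) = w" for w
      by (simp only: matrix_vector_mul_assoc inv_pow matrix_vector_mul_lid)
    have "(\<integral>\<^sup>+y. ?g y \<partial>lborel) = ennreal \<delta> * (\<integral>\<^sup>+w. ?g (inv_pow i *v w) \<partial>lborel)"
      unfolding \<delta>_def by (rule nn_integral_matrix[OF det_inv_pow(2) g])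
    also have "(\<lambda>w. ?g (inv_pow i *v w)) = (\<lambda>w. ?h (p + w))"
      by (simp add: M add.commute)
    also have "(\<integral>\<^sup>+w. ?h (p + w) \<partial>lborel) = (\<integral>\<^sup>+w. ?h w \<partial>lborel)"
      by (rule nn_integral_translation[OF h])
    also have "ennreal \<delta> * (\<integral>\<^sup>+w. ?h w \<partial>lborel) = (\<integral>\<^sup>+w. ennreal \<delta> * ?h w \<partial>lborel)"
      using h by (intro nn_integral_cmult[symmetric]) simp
    finally show ?thesis by (simp add: f_add_nat)
  qed
  have "ennreal (1 / real (l ^ i)) * (\<Sum>N<l ^ i. \<integral>\<^sup>+y. ennreal (f (x + real N, matrix_pow A i *v y + s i 0 (x + real N)) * bell y) \<partial>lborel)
    = (\<integral>\<^sup>+w. ennreal (1 / real (l ^ i)) * (\<Sum>N<l ^ i. ennreal \<delta> * ennreal (f (x, w) * bell (inv_pow i *v (w - s i 0 (x + real N))))) \<partial>lborel)"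
    unfolding each by (subst nn_integral_cmult) (simp_all add: nn_integral_sum)
  also have "\<dots> = (\<integral>\<^sup>+w. ennreal (f (x, w) * push_density i x w) \<partial>lborel)"
  proof (rule nn_integral_cong)
    fix w
    define b where "b N = bell (inv_pow i *v (w - s i 0 (x + real N)))" for N
    have b: "0 \<le> b N" for N by (simp add: b_def bell_nonneg)
    have "(\<Sum>N<l ^ i. ennreal \<delta> * ennreal (f (x, w) * b N)) = ennreal (\<Sum>N<l ^ i. \<delta> * (f (x, w) * b N))"
      using \<delta> b f_nonneg by (simp add: ennreal_mult[symmetric] sum_ennreal)
    also have "ennreal (1 / real (l ^ i)) * \<dots> = ennreal (1 / real (l ^ i) * (\<Sum>N<l ^ i. \<delta> * (f (x, w) * b N)))"
      using \<delta> b f_nonneg by (intro ennreal_mult[symmetric] sum_nonneg) auto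
    also have "1 / real (l ^ i) * (\<Sum>N<l ^ i. \<delta> * (f (x, w) * b N)) = f (x, w) * push_density i x w"
      by (simp add: push_density_def \<delta>_def b_def sum_distrib_left mult_ac)
    finally show "ennreal (1 / real (l ^ i)) * (\<Sum>N<l ^ i. ennreal \<delta> * ennreal (f (x, w) * bell (inv_pow i *v (w - s i 0 (x + real N)))))
      = ennreal (f (x, w) * push_density i x w)" by (simp add: b_def)
  qed
  finally show ?thesis .
qed

text \<open>The base map multiplies by \<open>l\<^sup>i\<close>, so its image of the unit interval decomposes into \<open>l\<^sup>i\<close> translates of
  it, one for each word; in each fibre an affine change of variables produces one summand
  of \<open>push_density\<close>.\<close>

lemma pushforward_density:
  "(\<integral>\<^sup>+z. ennreal (f ((T_map l A \<phi> ^^ i) z) * bell (snd z)) \<partial>lebesgue_cyl)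
    = (\<integral>\<^sup>+x. (\<integral>\<^sup>+w. ennreal (f (x, w) * push_density i x w) \<partial>lborel) * indicator {0..<1} x \<partial>lborel)"
proof -
  define \<Phi> where "\<Phi> t = (\<integral>\<^sup>+y. ennreal (f (t, matrix_pow A i *v y + s i 0 t) * bell y) \<partial>lborel)" for t
  have [measurable]: "\<Phi> \<in> borel_measurable borel"
  proof -
    have "(\<lambda>z. (fst z, matrix_pow A i *v snd z + s i 0 (fst z))) \<in> borel_measurable (borel \<Otimes>\<^sub>M borel)"
      unfolding borel_prod[symmetric] by measurable
    then have "(\<lambda>(t, y). ennreal (f (t, matrix_pow A i *v y + s i 0 t) * bell y)) \<in> borel_measurable (borel \<Otimes>\<^sub>M lborel)"
      unfolding case_prod_unfold by measurable
    then show ?thesis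
      unfolding \<Phi>_def by (intro lborel.borel_measurable_nn_integral)
  qed
  have "(\<integral>\<^sup>+z. ennreal (f ((T_map l A \<phi> ^^ i) z) * bell (snd z)) \<partial>lebesgue_cyl)
    = (\<integral>\<^sup>+z. ennreal (f (real l ^ i * fst z, matrix_pow A i *v snd z + s i 0 (real l ^ i * fst z)) * bell (snd z)) \<partial>lebesgue_cyl)"
  proof (rule nn_integral_cong)
    fix z :: "real \<times> (real ^ 'd)" assume "z \<in> space lebesgue_cyl"
    then show "ennreal (f ((T_map l A \<phi> ^^ i) z) * bell (snd z))
      = ennreal (f (real l ^ i * fst z, matrix_pow A i *v snd z + s i 0 (real l ^ i * fst z)) * bell (snd z))"
      using f_iterate[of "fst z" i "snd z"] by (auto simp: space_lebesgue_cyl)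
  qed
  also have "\<dots> = (\<integral>\<^sup>+x. \<Phi> (real (l ^ i) * x) * indicator {0..<1} x \<partial>lborel)"
  proof -
    have "(\<lambda>z :: real \<times> (real ^ 'd). bell (snd z)) \<in> borel_measurable borel"
      unfolding borel_prod[symmetric] by measurable
    then have "(\<lambda>z. ennreal (f (real l ^ i * fst z, matrix_pow A i *v snd z + s i 0 (real l ^ i * fst z)) * bell (snd z))) \<in> borel_measurable borel"
      using lift_measurable[of i]
      by (intro measurable_compose[OF borel_measurable_times measurable_ennreal])
    from nn_integral_lebesgue_cyl[OF this] show ?thesis by (simp add: \<Phi>_def)
  qed
  also have "\<dots> = ennreal (1 / real (l ^ i)) * (\<Sum>N<l ^ i. \<integral>\<^sup>+x. \<Phi> (x + real N) * indicator {0..<1} x \<partial>lborel)"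
    by (rule nn_integral_circle_expand) simp_all
  also have "\<dots> = (\<integral>\<^sup>+x. (ennreal (1 / real (l ^ i)) * (\<Sum>N<l ^ i. \<Phi> (x + real N))) * indicator {0..<1} x \<partial>lborel)"
    by (simp add: nn_integral_sum[symmetric] nn_integral_cmult[symmetric] sum_distrib_right mult.assoc del: of_nat_power)
  finally show ?thesis unfolding \<Phi>_def fibre_change_of_variables .
qed

lemma pushforward_bound:
  assumes t: "0 < t"
  shows "(\<integral>\<^sup>+z. ennreal (f ((T_map l A \<phi> ^^ i) z) * bell (snd z)) \<partial>lebesgue_cyl)
    \<le> ennreal (t / 2) * (\<integral>\<^sup>+z. ennreal ((f z)\<^sup>2) \<partial>lebesgue_cyl)
      + ennreal (1 / (2 * t)) * (bell_mass TYPE(real ^ 'd) * energy i)"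
proof -
  have m1 [measurable]: "(\<lambda>(x, w). ennreal ((f (x, w))\<^sup>2)) \<in> borel_measurable (borel \<Otimes>\<^sub>M lborel)"
    unfolding case_prod_unfold by measurable
  have m2 [measurable]: "(\<lambda>(x, w). ennreal ((push_density i x w)\<^sup>2)) \<in> borel_measurable (borel \<Otimes>\<^sub>M lborel)"
    using push_density_measurable[of i] unfolding case_prod_unfold by measurable
  have fibre1: "(\<lambda>w. ennreal ((f (x, w))\<^sup>2)) \<in> borel_measurable lborel" for x
    using measurable_Pair2[OF m1, of x] by simp
  have fibre2: "(\<lambda>w. ennreal ((push_density i x w)\<^sup>2)) \<in> borel_measurable lborel" for x
    using measurable_Pair2[OF m2, of x] by simp
  have int1: "(\<lambda>x. \<integral>\<^sup>+w. ennreal ((f (x, w))\<^sup>2) \<partial>lborel) \<in> borel_measurable lborel"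
    using lborel.borel_measurable_nn_integral[OF m1] by simp
  have int2: "(\<lambda>x. \<integral>\<^sup>+w. ennreal ((push_density i x w)\<^sup>2) \<partial>lborel) \<in> borel_measurable lborel"
    using lborel.borel_measurable_nn_integral[OF m2] by simp
  have "(\<integral>\<^sup>+w. ennreal (f (x, w) * push_density i x w) \<partial>lborel)
    \<le> ennreal (t / 2) * (\<integral>\<^sup>+w. ennreal ((f (x, w))\<^sup>2) \<partial>lborel) + ennreal (1 / (2 * t)) * (\<integral>\<^sup>+w. ennreal ((push_density i x w)\<^sup>2) \<partial>lborel)" for x
  proof -
    have "(\<integral>\<^sup>+w. ennreal (f (x, w) * push_density i x w) \<partial>lborel)
      \<le> (\<integral>\<^sup>+w. ennreal (t / 2) * ennreal ((f (x, w))\<^sup>2) + ennreal (1 / (2 * t)) * ennreal ((push_density i x w)\<^sup>2) \<partial>lborel)"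
    proof (rule nn_integral_mono)
      fix w
      have "ennreal (f (x, w) * push_density i x w) \<le> ennreal (t / 2 * (f (x, w))\<^sup>2 + 1 / (2 * t) * (push_density i x w)\<^sup>2)"
        by (intro ennreal_leI am_gm_weighted t)
      then show "ennreal (f (x, w) * push_density i x w)
        \<le> ennreal (t / 2) * ennreal ((f (x, w))\<^sup>2) + ennreal (1 / (2 * t)) * ennreal ((push_density i x w)\<^sup>2)"
        using t by (simp add: ennreal_mult[symmetric] ennreal_plus[symmetric] del: ennreal_plus)
    qed
    then show ?thesis
      using fibre1 fibre2 by (simp add: nn_integral_add nn_integral_cmult)
  qed
  then have "(\<integral>\<^sup>+z. ennreal (f ((T_map l A \<phi> ^^ i) z) * bell (snd z)) \<partial>lebesgue_cyl)
    \<le> (\<integral>\<^sup>+x. (ennreal (t / 2) * (\<integral>\<^sup>+w. ennreal ((f (x, w))\<^sup>2) \<partial>lborel) + ennreal (1 / (2 * t)) * (\<integral>\<^sup>+w. ennreal ((push_density i x w)\<^sup>2) \<partial>lborel))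
        * indicator {0..<1} x \<partial>lborel)"
    unfolding pushforward_density by (intro nn_integral_mono mult_right_mono) auto
  also have "\<dots> = (\<integral>\<^sup>+x. ennreal (t / 2) * ((\<integral>\<^sup>+w. ennreal ((f (x, w))\<^sup>2) \<partial>lborel) * indicator {0..<1} x)
      + ennreal (1 / (2 * t)) * ((\<integral>\<^sup>+w. ennreal ((push_density i x w)\<^sup>2) \<partial>lborel) * indicator {0..<1} x) \<partial>lborel)"
    by (simp add: distrib_right mult.assoc)
  also have "\<dots> = ennreal (t / 2) * (\<integral>\<^sup>+x. (\<integral>\<^sup>+w. ennreal ((f (x, w))\<^sup>2) \<partial>lborel) * indicator {0..<1} x \<partial>lborel)
      + ennreal (1 / (2 * t)) * (\<integral>\<^sup>+x. (\<integral>\<^sup>+w. ennreal ((push_density i x w)\<^sup>2) \<partial>lborel) * indicator {0..<1} x \<partial>lborel)"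
    using int1 int2 by (simp add: nn_integral_add nn_integral_cmult)
  also have "(\<integral>\<^sup>+x. (\<integral>\<^sup>+w. ennreal ((f (x, w))\<^sup>2) \<partial>lborel) * indicator {0..<1} x \<partial>lborel) = (\<integral>\<^sup>+z. ennreal ((f z)\<^sup>2) \<partial>lebesgue_cyl)"
    by (rule nn_integral_lebesgue_cyl[symmetric]) measurable
  also have "ennreal (1 / (2 * t)) * (\<integral>\<^sup>+x. (\<integral>\<^sup>+w. ennreal ((push_density i x w)\<^sup>2) \<partial>lborel) * indicator {0..<1} x \<partial>lborel)
    \<le> ennreal (1 / (2 * t)) * (bell_mass TYPE(real ^ 'd) * energy i)"
    by (intro mult_left_mono push_density_energy) simp
  finally show ?thesis by (simp add: add_left_mono)
qed

end

end

section \<open>Physical measures\<close>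

text \<open>Continuous functions that decrease to the indicator of a compact set and are supported in a bounded
  neighbourhood of it.\<close>

lemma infdist_bump:
  fixes K :: "'a::heine_borel set"
  assumes K: "compact K" "K \<noteq> {}"
  defines "g \<equiv> \<lambda>n z. max 0 (1 - real (Suc n) * infdist z K)"
  shows "0 \<le> g n z" "g n z \<le> 1" "z \<in> K \<Longrightarrow> g n z = 1"
    "0 < g n z \<Longrightarrow> \<exists>k\<in>K. dist z k < 1" "continuous_on UNIV (g n)"
    "(\<lambda>n. g n z) \<longlonglongrightarrow> indicator K z"
proof -
  show "0 \<le> g n z" "g n z \<le> 1" "z \<in> K \<Longrightarrow> g n z = 1"
    using infdist_nonneg[of z K] by (auto simp: g_def)
  show "continuous_on UNIV (g n)"
    unfolding g_def by (intro continuous_intros)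
  show "\<exists>k\<in>K. dist z k < 1" if "0 < g n z"
  proof -
    have "real (Suc n) * infdist z K < 1" using that by (simp add: g_def)
    moreover have "1 * infdist z K \<le> real (Suc n) * infdist z K"
      using infdist_nonneg by (intro mult_right_mono) auto
    ultimately have "infdist z K < 1" by simp
    moreover obtain k where "k \<in> K" "infdist z K = dist z k"
      using infdist_attains_inf[OF compact_imp_closed[OF K(1)] K(2)] by blast
    ultimately show ?thesis by auto
  qed
  show "(\<lambda>n. g n z) \<longlonglongrightarrow> indicator K z"
  proof (cases "z \<in> K")
    case True
    then show ?thesis by (simp add: g_def)
  next
    case False
    then have pos: "0 < infdist z K"
      using in_closed_iff_infdist_zero[OF compact_imp_closed[OF K(1)] K(2)] infdist_nonneg[of z K]
      by (metis less_eq_real_def)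
    obtain n0 :: nat where n0: "1 / infdist z K < real n0" using reals_Archimedean2 by blast
    have "g n z = 0" if "n0 \<le> n" for n
    proof -
      have "1 < real n0 * infdist z K" using n0 pos by (simp add: divide_less_eq)
      also have "\<dots> \<le> real (Suc n) * infdist z K" using that pos by (intro mult_right_mono) auto
      finally show ?thesis by (simp add: g_def)
    qed
    then have "eventually (\<lambda>n. g n z = 0) sequentially" by (auto simp: eventually_sequentially)
    then show ?thesis using False by (simp add: tendsto_eventually)
  qed
qed

text \<open>Functions on the cylinder that are pulled back along this map are periodic in the first variable, and
  on the fundamental domain the map is injective.  Distances measured in the image respect the
  identification of the two ends of the unit interval.\<close>

definition circle_embedding :: "real \<times> (real ^ 'd) \<Rightarrow> complex \<times> (real ^ 'd)" where
  "circle_embedding z = (cyc (fst z), snd z)"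

lemma circle_embedding_continuous: "continuous_on S circle_embedding"
  unfolding circle_embedding_def by (intro continuous_intros)

lemma circle_embedding_inj:
  assumes "z \<in> {0..<1} \<times> UNIV" "w \<in> {0..<1} \<times> UNIV" "circle_embedding z = circle_embedding w"
  shows "z = w"
proof -
  have c: "cyc (fst z) = cyc (fst w)" and s: "snd z = snd w" using assms(3) by (auto simp: circle_embedding_def)
  have "cyc (fst z - fst w) = 1"
    using c cyc_uminus_mult[of "fst w"] by (simp add: cyc_add diff_conv_add_uminus mult.commute del: add_uminus_conv_diff)
  then have "cos (2 * pi * (fst z - fst w)) = 1" by (simp add: cyc_def complex_eq_iff)
  then obtain n :: int where "2 * pi * (fst z - fst w) = real_of_int n * (2 * pi)"
    unfolding cos_one_2pi_int by auto
  then have n: "fst z - fst w = n" by simp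
  have "0 \<le> fst z" "fst z < 1" "0 \<le> fst w" "fst w < 1" using assms(1,2) by auto
  with n have "\<bar>real_of_int n\<bar> < 1" by linarith
  then have "n = 0" by linarith
  with n s show ?thesis by (simp add: prod_eq_iff)
qed

context solenoidal
begin

text \<open>The basin has a bounded part \<open>P\<close> of positive finite measure.  On \<open>P\<close> the Birkhoff averages converge to
  \<open>\<integral> f d\<mu>\<close>, so Fatou's lemma bounds this number times the measure of \<open>P\<close> by the lower limit of the
  averaged integrals of \<open>f \<circ> T\<^sup>i\<close> over \<open>P\<close>; these are controlled by \<open>pushforward_bound\<close>, because \<open>bell\<close>
  has a positive minimum on \<open>P\<close>.\<close>

lemma SRB_integral_bound:
  fixes \<mu> :: "(real \<times> (real ^ 'd)) measure"
  assumes SRB: "SRB_measure (T_map l A \<phi>) \<mu>" and R: "\<And>i. energy i \<le> R"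
  shows "\<exists>m>0. \<forall>f\<in>test_functions. (\<forall>z. 0 \<le> f z) \<longrightarrow> (\<forall>t>0.
    ennreal (m * (\<integral>z. f z \<partial>\<mu>)) \<le> ennreal (t / 2) * (\<integral>\<^sup>+z. ennreal ((f z)\<^sup>2) \<partial>lebesgue_cyl)
      + ennreal (1 / (2 * t)) * (bell_mass TYPE(real ^ 'd) * R))"
proof -
  let ?T = "T_map l A \<phi>"
  let ?cyl = "lebesgue_cyl :: (real \<times> (real ^ 'd)) measure"
  define Bs where "Bs = basin ?T \<mu>"
  have pos: "0 < emeasure ?cyl Bs" using SRB by (simp add: SRB_measure_def Bs_def)
  have Bs: "Bs \<in> sets ?cyl" using pos emeasure_notin_sets by fastforce
  define P where "P k = Bs \<inter> {z. norm (snd z) \<le> real k}" for k :: nat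
  have strip: "{z :: real \<times> (real ^ 'd). norm (snd z) \<le> \<rho>} \<in> sets borel" for \<rho>
  proof -
    have "closed {z :: real \<times> (real ^ 'd). norm (snd z) \<le> \<rho>}"
      by (intro closed_Collect_le continuous_intros)
    then show ?thesis by simp
  qed
  have P: "P k \<in> sets ?cyl" for k
  proof -
    have "Bs \<subseteq> {0..<1} \<times> UNIV" using sets.sets_into_space[OF Bs] by (simp add: space_lebesgue_cyl)
    then have "P k = Bs \<inter> ({z. norm (snd z) \<le> real k} \<inter> ({0..<1} \<times> UNIV))" by (auto simp: P_def)
    then show ?thesis using Bs borel_Int_cyl_sets[OF strip] by simp
  qed
  have "\<exists>k. emeasure ?cyl (P k) \<noteq> 0"
  proof (rule ccontr)
    assume "\<not> ?thesis"
    then have "emeasure ?cyl (\<Union>k. P k) = 0" using P by (intro emeasure_UN_eq_0) auto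
    moreover have "(\<Union>k. P k) = Bs" by (auto simp: P_def) (meson real_arch_simple)
    ultimately show False using pos by simp
  qed
  then obtain k where k: "emeasure ?cyl (P k) \<noteq> 0" by blast
  have fin: "emeasure ?cyl (P k) < \<infinity>"
  proof -
    have "emeasure ?cyl (P k) = (\<integral>\<^sup>+z. indicator (P k) z \<partial>?cyl)" using P by simp
    also have "\<dots> \<le> (\<integral>\<^sup>+z. indicator {z. norm (snd z) \<le> real k} z \<partial>?cyl)"
      by (intro nn_integral_mono) (auto simp: P_def split: split_indicator)
    also have "\<dots> < \<infinity>" by (rule nn_integral_strip_finite)
    finally show ?thesis .
  qed
  define mP where "mP = enn2real (emeasure ?cyl (P k))"
  have mP: "emeasure ?cyl (P k) = ennreal mP" "0 < mP"
    using k fin by (auto simp: mP_def enn2real_positive_iff less_top zero_less_iff_neq_zero)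
  define c where "c = exp (- (4 * pi\<^sup>2 * (real k)\<^sup>2))"
  have c: "0 < c" by (simp add: c_def)
  have bell_ge: "c \<le> bell (snd z)" if "z \<in> P k" for z
  proof -
    have "(norm (snd z))\<^sup>2 \<le> (real k)\<^sup>2" using that by (intro power_mono) (auto simp: P_def)
    then show ?thesis by (simp add: c_def bell_def mult_left_mono)
  qed
  show ?thesis
  proof (intro exI[of _ "c * mP"] conjI ballI impI allI)
    show "0 < c * mP" using c mP by simp
    fix f :: "real \<times> (real ^ 'd) \<Rightarrow> real" and t :: real
    assume f: "f \<in> test_functions" and nonneg: "\<forall>z. 0 \<le> f z" and t: "0 < t"
    have fc: "continuous_on UNIV f" and fp: "\<And>x y. f (x + 1, y) = f (x, y)"
      using f by (auto simp: test_functions_def)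
    have f0: "\<And>z. 0 \<le> f z" using nonneg by blast
    define X where "X = ennreal (t / 2) * (\<integral>\<^sup>+z. ennreal ((f z)\<^sup>2) \<partial>?cyl)
      + ennreal (1 / (2 * t)) * (bell_mass TYPE(real ^ 'd) * R)"
    have J: "(\<integral>\<^sup>+z. ennreal (f ((?T ^^ i) z) * bell (snd z)) \<partial>?cyl) \<le> X" for i
    proof -
      have "ennreal (1 / (2 * t)) * (bell_mass TYPE(real ^ 'd) * energy i) \<le> ennreal (1 / (2 * t)) * (bell_mass TYPE(real ^ 'd) * R)"
        by (intro mult_left_mono R) auto
      with pushforward_bound[OF fc fp f0 t, of i] show ?thesis
        unfolding X_def by (meson add_left_mono order_trans)
    qed
    define F where "F i z = ennreal (f ((?T ^^ i) z)) * indicator (P k) z" for i z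
    have F_meas: "F i \<in> borel_measurable ?cyl" for i
      unfolding F_def using iterate_measurable[OF fc fp f0, of i] P
      by (intro borel_measurable_times_ennreal borel_measurable_indicator) auto
    have F_int: "ennreal c * (\<integral>\<^sup>+z. F i z \<partial>?cyl) \<le> X" for i
    proof -
      have "ennreal c * (\<integral>\<^sup>+z. F i z \<partial>?cyl) = (\<integral>\<^sup>+z. ennreal c * F i z \<partial>?cyl)"
        using F_meas by (rule nn_integral_cmult[symmetric])
      also have "\<dots> \<le> (\<integral>\<^sup>+z. ennreal (f ((?T ^^ i) z) * bell (snd z)) \<partial>?cyl)"
      proof (rule nn_integral_mono)
        fix z
        show "ennreal c * F i z \<le> ennreal (f ((?T ^^ i) z) * bell (snd z))"
        proof (cases "z \<in> P k")
          case True
          have "c * f ((?T ^^ i) z) \<le> f ((?T ^^ i) z) * bell (snd z)"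
            using mult_left_mono[OF bell_ge[OF True] f0[of "(?T ^^ i) z"]] by (simp add: mult.commute)
          then show ?thesis
            using True c f0 by (simp add: F_def ennreal_mult[symmetric] ennreal_leI)
        qed (simp add: F_def)
      qed
      also have "\<dots> \<le> X" by (rule J)
      finally show ?thesis .
    qed
    define u where "u n z = ennreal ((\<Sum>i<n. f ((?T ^^ i) z)) / real n) * indicator (P k) z" for n z
    have u_eq: "u n z = ennreal (1 / real n) * (\<Sum>i<n. F i z)" for n z
    proof -
      have "ennreal ((\<Sum>i<n. f ((?T ^^ i) z)) / real n) = ennreal (1 / real n * (\<Sum>i<n. f ((?T ^^ i) z)))" by simp
      also have "\<dots> = ennreal (1 / real n) * ennreal (\<Sum>i<n. f ((?T ^^ i) z))"
        using f0 by (intro ennreal_mult sum_nonneg) auto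
      also have "ennreal (\<Sum>i<n. f ((?T ^^ i) z)) = (\<Sum>i<n. ennreal (f ((?T ^^ i) z)))"
        using f0 by (simp add: sum_ennreal)
      finally show ?thesis by (simp add: u_def F_def sum_distrib_right mult.assoc)
    qed
    have u_meas: "u n \<in> borel_measurable ?cyl" for n
      unfolding u_eq[abs_def] using F_meas by (intro borel_measurable_times_ennreal borel_measurable_sum) auto
    have u_int: "ennreal c * (\<integral>\<^sup>+z. u n z \<partial>?cyl) \<le> X" for n
    proof (cases "n = 0")
      case True
      then show ?thesis by (simp add: u_eq)
    next
      case False
      have "ennreal c * (\<integral>\<^sup>+z. u n z \<partial>?cyl) = ennreal c * (ennreal (1 / real n) * (\<Sum>i<n. \<integral>\<^sup>+z. F i z \<partial>?cyl))"
        unfolding u_eq[abs_def] using F_meas by (simp add: nn_integral_cmult nn_integral_sum)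
      also have "\<dots> = ennreal (1 / real n) * (\<Sum>i<n. ennreal c * (\<integral>\<^sup>+z. F i z \<partial>?cyl))"
        by (simp add: sum_distrib_left mult.left_commute)
      also have "\<dots> \<le> ennreal (1 / real n) * (\<Sum>i<n. X)"
        by (intro mult_left_mono sum_mono F_int) simp
      also have "\<dots> = (ennreal (1 / real n) * ennreal (real n)) * X"
        by (simp add: mult.assoc ennreal_of_nat_eq_real_of_nat)
      also have "ennreal (1 / real n) * ennreal (real n) = 1" using False by (simp add: ennreal_mult[symmetric])
      finally show ?thesis by simp
    qed
    have lim: "liminf (\<lambda>n. u n z) = ennreal (\<integral>w. f w \<partial>\<mu>) * indicator (P k) z" for z
    proof (cases "z \<in> P k")
      case True
      then have "(\<lambda>n. (\<Sum>i<n. f ((?T ^^ i) z)) / real n) \<longlonglongrightarrow> (\<integral>w. f w \<partial>\<mu>)"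
        using f by (auto simp: P_def Bs_def basin_def)
      then have "(\<lambda>n. ennreal ((\<Sum>i<n. f ((?T ^^ i) z)) / real n)) \<longlonglongrightarrow> ennreal (\<integral>w. f w \<partial>\<mu>)"
        by (rule tendsto_ennrealI)
      then show ?thesis using True by (simp add: u_def lim_imp_Liminf)
    qed (simp add: u_def Liminf_const)
    have "ennreal (c * mP * (\<integral>w. f w \<partial>\<mu>)) = ennreal c * (ennreal (\<integral>w. f w \<partial>\<mu>) * emeasure ?cyl (P k))"
    proof -
      have "0 \<le> (\<integral>w. f w \<partial>\<mu>)" using f0 by simp
      then show ?thesis using c mP by (simp add: ennreal_mult[symmetric] mult_ac)
    qed
    also have "ennreal (\<integral>w. f w \<partial>\<mu>) * emeasure ?cyl (P k) = (\<integral>\<^sup>+z. liminf (\<lambda>n. u n z) \<partial>?cyl)"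
      unfolding lim using P by (simp add: nn_integral_cmult_indicator)
    also have "\<dots> \<le> liminf (\<lambda>n. \<integral>\<^sup>+z. u n z \<partial>?cyl)" by (rule nn_integral_liminf[OF u_meas])
    also have "ennreal c * liminf (\<lambda>n. \<integral>\<^sup>+z. u n z \<partial>?cyl) \<le> X"
    proof -
      have "liminf (\<lambda>n. \<integral>\<^sup>+z. u n z \<partial>?cyl) \<le> ennreal (1 / c) * X"
      proof (rule Liminf_le[OF _ always_eventually], simp, rule allI)
        fix n
        have "ennreal (1 / c) * ennreal c = 1" using c by (simp add: ennreal_mult[symmetric])
        then have "(\<integral>\<^sup>+z. u n z \<partial>?cyl) = ennreal (1 / c) * (ennreal c * (\<integral>\<^sup>+z. u n z \<partial>?cyl))"
          by (simp add: mult.assoc[symmetric])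
        also have "\<dots> \<le> ennreal (1 / c) * X" by (intro mult_left_mono u_int) simp
        finally show "(\<integral>\<^sup>+z. u n z \<partial>?cyl) \<le> ennreal (1 / c) * X" .
      qed
      then have "ennreal c * liminf (\<lambda>n. \<integral>\<^sup>+z. u n z \<partial>?cyl) \<le> ennreal c * (ennreal (1 / c) * X)"
        by (intro mult_left_mono) auto
      also have "\<dots> = (ennreal c * ennreal (1 / c)) * X" by (simp add: mult.assoc)
      also have "ennreal c * ennreal (1 / c) = 1" using c by (simp add: ennreal_mult[symmetric])
      finally show ?thesis by simp
    qed
    finally show "ennreal (c * mP * (\<integral>z. f z \<partial>\<mu>)) \<le> ennreal (t / 2) * (\<integral>\<^sup>+z. ennreal ((f z)\<^sup>2) \<partial>?cyl)
      + ennreal (1 / (2 * t)) * (bell_mass TYPE(real ^ 'd) * R)"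
      unfolding X_def by (simp add: mult_left_mono)
  qed
qed

end

section \<open>Absolute continuity\<close>

text \<open>The approximating functions are functions of the distance to the image of \<open>K\<close> under \<open>circle_embedding\<close>; they are dominated
  by the indicator of a strip, whose measure is finite.\<close>

lemma compact_periodic_approximation:
  fixes K :: "(real \<times> (real ^ 'd)) set"
  assumes K: "compact K" "K \<noteq> {}" "K \<subseteq> {0..<1} \<times> UNIV"
  shows "\<exists>f. (\<forall>n. f n \<in> test_functions) \<and> (\<forall>n z. 0 \<le> f n z \<and> f n z \<le> 1) \<and> (\<forall>n. \<forall>z\<in>K. f n z = 1) \<and>
    (\<lambda>n. \<integral>\<^sup>+z. ennreal ((f n z)\<^sup>2) \<partial>lebesgue_cyl) \<longlonglongrightarrow> emeasure lebesgue_cyl K"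
proof -
  define K' where "K' = circle_embedding ` K"
  have K': "compact K'" "K' \<noteq> {}"
    using K compact_continuous_image[OF circle_embedding_continuous K(1)] by (auto simp: K'_def)
  define g where "g n z = max 0 (1 - real (Suc n) * infdist z K')" for n and z :: "complex \<times> (real ^ 'd)"
  note g = infdist_bump[OF K', folded g_def]
  define f where "f n z = g n (circle_embedding z)" for n and z :: "real \<times> (real ^ 'd)"
  have f_cont: "continuous_on UNIV (f n)" for n
    unfolding f_def by (intro continuous_on_compose2[OF g(5)] circle_embedding_continuous) auto
  have f_per: "f n (x + 1, y) = f n (x, y)" for n x y
    using cyc_int[of 1] by (simp add: f_def circle_embedding_def cyc_add)
  have f01: "0 \<le> f n z" "f n z \<le> 1" for n z
    using g(1,2) by (simp_all add: f_def)
  have test: "f n \<in> test_functions" for n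
  proof -
    have "bounded (range (f n))" using f01 by (intro boundedI[of _ 1]) auto
    then show ?thesis using f_cont f_per by (simp add: test_functions_def)
  qed
  have one: "f n z = 1" if "z \<in> K" for n z
    using that g(3) by (simp add: f_def K'_def)
  obtain \<rho> where \<rho>: "\<And>z. z \<in> K \<Longrightarrow> norm z \<le> \<rho>"
    using compact_imp_bounded[OF K(1)] by (auto simp: bounded_iff)
  have K_sets: "K \<in> sets lebesgue_cyl"
    using borel_Int_cyl_sets[OF borel_compact[OF K(1)]] K(3) by (simp add: Int_absorb2)
  have "(\<lambda>n. \<integral>\<^sup>+z. ennreal ((f n z)\<^sup>2) \<partial>lebesgue_cyl) \<longlonglongrightarrow> (\<integral>\<^sup>+z. indicator K z \<partial>lebesgue_cyl)"
  proof (rule nn_integral_dominated_convergence[where w = "indicator {z. norm (snd z) \<le> \<rho> + 1}"])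
    show "(\<lambda>z. ennreal ((f n z)\<^sup>2)) \<in> borel_measurable lebesgue_cyl" for n
      by (intro measurable_lebesgue_cyl measurable_compose[OF _ measurable_ennreal] borel_measurable_power
          borel_measurable_continuous_onI f_cont)
    show "(indicator K :: _ \<Rightarrow> ennreal) \<in> borel_measurable lebesgue_cyl"
      by (rule borel_measurable_indicator[OF K_sets])
    have "closed {z :: real \<times> (real ^ 'd). norm (snd z) \<le> \<rho> + 1}"
      by (intro closed_Collect_le continuous_intros)
    then show "(indicator {z. norm (snd z) \<le> \<rho> + 1} :: _ \<Rightarrow> ennreal) \<in> borel_measurable (lebesgue_cyl :: (real \<times> (real ^ 'd)) measure)"
      by (intro measurable_lebesgue_cyl borel_measurable_indicator) simp
    show "AE z in lebesgue_cyl. ennreal ((f n z)\<^sup>2) \<le> indicator {z. norm (snd z) \<le> \<rho> + 1} z" for n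
    proof (rule AE_I2)
      fix z :: "real \<times> (real ^ 'd)"
      show "ennreal ((f n z)\<^sup>2) \<le> indicator {z. norm (snd z) \<le> \<rho> + 1} z"
      proof (cases "f n z = 0")
        case False
        then have "0 < g n (circle_embedding z)" using f01(1)[of n z] by (simp add: f_def)
        then obtain k where k: "k \<in> K" "dist (circle_embedding z) (circle_embedding k) < 1"
          using g(4)[of n "circle_embedding z"] unfolding K'_def by blast
        have "dist (snd z) (snd k) \<le> dist (circle_embedding z) (circle_embedding k)"
          using dist_snd_le[of "circle_embedding z" "circle_embedding k"] by (simp add: circle_embedding_def)
        then have "norm (snd z) \<le> norm (snd k) + 1"
          using k(2) norm_triangle_sub[of "snd z" "snd k"] by (simp add: dist_norm)
        also have "norm (snd k) \<le> \<rho>" using norm_snd_le[of "snd k" "fst k"] \<rho>[OF k(1)] by simp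
        finally have "norm (snd z) \<le> \<rho> + 1" by simp
        moreover have "(f n z)\<^sup>2 \<le> 1" using f01 by (intro power_le_one)
        ultimately show ?thesis by simp
      qed simp
    qed
    show "(\<integral>\<^sup>+z. indicator {z. norm (snd z) \<le> \<rho> + 1} z \<partial>(lebesgue_cyl :: (real \<times> (real ^ 'd)) measure)) < \<infinity>"
      by (rule nn_integral_strip_finite)
    show "AE z in lebesgue_cyl. (\<lambda>n. ennreal ((f n z)\<^sup>2)) \<longlonglongrightarrow> indicator K z"
    proof (rule AE_I2)
      fix z :: "real \<times> (real ^ 'd)" assume z: "z \<in> space lebesgue_cyl"
      have "circle_embedding z \<in> K' \<longleftrightarrow> z \<in> K"
        using z K(3) circle_embedding_inj[of z] by (auto simp: K'_def space_lebesgue_cyl)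
      then have ind: "(indicator K' (circle_embedding z) :: real) = indicator K z" by (simp add: indicator_def)
      have "(\<lambda>n. (f n z)\<^sup>2) \<longlonglongrightarrow> (indicator K z)\<^sup>2"
        unfolding f_def using tendsto_power[OF g(6)[of "circle_embedding z"], of 2] unfolding ind .
      then have "(\<lambda>n. ennreal ((f n z)\<^sup>2)) \<longlonglongrightarrow> ennreal ((indicator K z)\<^sup>2)" by (rule tendsto_ennrealI)
      moreover have "ennreal ((indicator K z)\<^sup>2) = indicator K z" by (simp split: split_indicator)
      ultimately show "(\<lambda>n. ennreal ((f n z)\<^sup>2)) \<longlonglongrightarrow> indicator K z" by (simp only:)
    qed
  qed
  then have "(\<lambda>n. \<integral>\<^sup>+z. ennreal ((f n z)\<^sup>2) \<partial>lebesgue_cyl) \<longlonglongrightarrow> emeasure lebesgue_cyl K"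
    using K_sets by simp
  with test f01 one show ?thesis by (intro exI[of _ f]) auto
qed

text \<open>If a Lebesgue null set had positive measure for \<open>\<mu>\<close>, then so would some compact subset \<open>K\<close>, by inner
  regularity.  Functions decreasing to the indicator of \<open>K\<close> make the first term of the bound vanish, which
  leaves \<open>m \<mu>(K) \<le> c / (2t)\<close> for every \<open>t > 0\<close>.\<close>

lemma absolutely_continuous_of_energy_bound:
  fixes \<mu> :: "(real \<times> (real ^ 'd)) measure"
  assumes sets: "sets \<mu> = sets lebesgue_cyl" and "prob_space \<mu>" and m: "0 < m" and c: "c < \<infinity>"
    and bound: "\<And>f t. f \<in> test_functions \<Longrightarrow> (\<And>z. 0 \<le> f z) \<Longrightarrow> 0 < t \<Longrightarrow>
      ennreal (m * (\<integral>z. f z \<partial>\<mu>)) \<le> ennreal (t / 2) * (\<integral>\<^sup>+z. ennreal ((f z)\<^sup>2) \<partial>lebesgue_cyl) + ennreal (1 / (2 * t)) * c"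
  shows "absolutely_continuous lebesgue_cyl \<mu>"
  unfolding absolutely_continuous_def
proof
  interpret prob_space \<mu> by fact
  let ?cyl = "lebesgue_cyl :: (real \<times> (real ^ 'd)) measure"
  have space: "space \<mu> = {0..<1} \<times> UNIV" using sets_eq_imp_space_eq[OF sets] by (simp add: space_lebesgue_cyl)
  have id: "(\<lambda>z. z) \<in> \<mu> \<rightarrow>\<^sub>M borel"
    using measurable_id_lebesgue_cyl measurable_cong_sets[OF sets refl] by blast
  fix E assume E: "E \<in> null_sets ?cyl"
  then have E_sets: "E \<in> sets ?cyl" and E0: "emeasure ?cyl E = 0" by auto
  have E_space: "E \<subseteq> {0..<1} \<times> UNIV" using sets.sets_into_space[OF E_sets] by (simp add: space_lebesgue_cyl)
  have "emeasure \<mu> E = 0"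
  proof (rule ccontr)
    assume nz: "emeasure \<mu> E \<noteq> 0"
    define \<nu> where "\<nu> = distr \<mu> borel (\<lambda>z. z)"
    have \<nu>: "emeasure \<nu> S = emeasure \<mu> (S \<inter> space \<mu>)" if "S \<in> sets borel" for S
      unfolding \<nu>_def using emeasure_distr[OF id that] by simp
    interpret \<nu>: prob_space \<nu> unfolding \<nu>_def by (rule prob_space_distr[OF id])
    have "emeasure \<nu> E = emeasure \<mu> E"
      using \<nu>[OF sets_lebesgue_cyl_borel[OF E_sets]] E_space space by (simp add: Int_absorb2)
    moreover have "emeasure \<nu> E = (SUP K\<in>{K. K \<subseteq> E \<and> compact K}. emeasure \<nu> K)"
      by (rule inner_regular) (simp_all add: \<nu>_def sets_lebesgue_cyl_borel[OF E_sets] \<nu>.emeasure_finite[unfolded \<nu>_def])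
    ultimately have "0 < (SUP K\<in>{K. K \<subseteq> E \<and> compact K}. emeasure \<nu> K)"
      using nz by (simp add: zero_less_iff_neq_zero)
    then obtain K where K: "K \<subseteq> E" "compact K" "0 < emeasure \<nu> K"
      by (auto simp: less_SUP_iff)
    have K_space: "K \<subseteq> {0..<1} \<times> UNIV" using K E_space by blast
    have K_ne: "K \<noteq> {}" using K by auto
    have K_sets: "K \<in> sets \<mu>"
      unfolding sets using borel_Int_cyl_sets[OF borel_compact[OF K(2)]] K_space by (simp add: Int_absorb2)
    have "emeasure \<mu> K = emeasure \<nu> K"
      using \<nu>[OF borel_compact[OF K(2)]] K_space space by (simp add: Int_absorb2)
    then have "0 < ennreal (measure \<mu> K)" using K(3) by (simp only: emeasure_eq_measure)
    then have a: "0 < measure \<mu> K" by simp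
    obtain f where f: "\<And>n. f n \<in> test_functions" "\<And>n z. 0 \<le> f n z" "\<And>n z. f n z \<le> 1" "\<And>n z. z \<in> K \<Longrightarrow> f n z = 1"
      and lim: "(\<lambda>n. \<integral>\<^sup>+z. ennreal ((f n z)\<^sup>2) \<partial>?cyl) \<longlonglongrightarrow> emeasure ?cyl K"
      using compact_periodic_approximation[OF K(2) K_ne K_space] by blast
    have "emeasure ?cyl K \<le> emeasure ?cyl E" using E_sets K(1) by (intro emeasure_mono)
    then have lim0: "(\<lambda>n. \<integral>\<^sup>+z. ennreal ((f n z)\<^sup>2) \<partial>?cyl) \<longlonglongrightarrow> 0" using lim E0 by simp
    have int_ge: "measure \<mu> K \<le> (\<integral>z. f n z \<partial>\<mu>)" for n
    proof -
      have "continuous_on UNIV (f n)" using f(1) by (simp add: test_functions_def)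
      then have "f n \<in> borel_measurable \<mu>"
        using measurable_compose[OF id borel_measurable_continuous_onI] by blast
      then have "integrable \<mu> (f n)"
        using f(2,3) by (intro integrable_const_bound[of _ 1]) auto
      moreover have "indicat_real K z \<le> f n z" for z using f(2,4) by (auto split: split_indicator)
      moreover have "integrable \<mu> (indicat_real K)"
        using K_sets by (intro integrable_real_indicator) (simp_all add: emeasure_eq_measure)
      ultimately have "(\<integral>z. indicat_real K z \<partial>\<mu>) \<le> (\<integral>z. f n z \<partial>\<mu>)"
        by (intro integral_mono) auto
      then show ?thesis using K_sets by simp
    qed
    have key: "ennreal (m * measure \<mu> K) \<le> ennreal (1 / (2 * t)) * c" if t: "0 < t" for t
    proof -
      have "(\<lambda>n. ennreal (t / 2) * (\<integral>\<^sup>+z. ennreal ((f n z)\<^sup>2) \<partial>?cyl) + ennreal (1 / (2 * t)) * c)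
        \<longlonglongrightarrow> ennreal (t / 2) * 0 + ennreal (1 / (2 * t)) * c"
        by (intro tendsto_add tendsto_const ennreal_tendsto_cmult lim0) simp
      moreover have "ennreal (m * measure \<mu> K) \<le> ennreal (t / 2) * (\<integral>\<^sup>+z. ennreal ((f n z)\<^sup>2) \<partial>?cyl) + ennreal (1 / (2 * t)) * c" for n
      proof -
        have "ennreal (m * measure \<mu> K) \<le> ennreal (m * (\<integral>z. f n z \<partial>\<mu>))"
          using m by (intro ennreal_leI mult_left_mono int_ge) simp
        also have "\<dots> \<le> ennreal (t / 2) * (\<integral>\<^sup>+z. ennreal ((f n z)\<^sup>2) \<partial>?cyl) + ennreal (1 / (2 * t)) * c"
          by (rule bound[OF f(1) f(2) t])
        finally show ?thesis .
      qed
      ultimately have "ennreal (m * measure \<mu> K) \<le> ennreal (t / 2) * 0 + ennreal (1 / (2 * t)) * c"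
        by (intro LIMSEQ_le_const) auto
      then show ?thesis by simp
    qed
    obtain c' where c': "c = ennreal c'" "0 \<le> c'" using c by (cases c) auto
      \<comment> \<open>any \<open>t\<close> beyond \<open>c' / (2 m \<mu>(K))\<close> gives the contradiction\<close>
    define t where "t = c' / (m * measure \<mu> K) + 1"
    have ma: "0 < m * measure \<mu> K" using m a by simp
    have t: "0 < t" using c' ma by (simp add: t_def add_nonneg_pos)
    have "ennreal (m * measure \<mu> K) \<le> ennreal (1 / (2 * t) * c')"
      using key[OF t] t c' by (simp add: ennreal_mult[symmetric])
    then have "m * measure \<mu> K \<le> 1 / (2 * t) * c'"
      using t c' by (subst (asm) ennreal_le_iff) auto
    then have "2 * t * (m * measure \<mu> K) \<le> c'" using t by (simp add: field_simps)
    moreover have "t * (m * measure \<mu> K) = c' + m * measure \<mu> K"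
      unfolding t_def distrib_right using ma m a by simp
    ultimately show False using ma c'(2) by (simp add: mult.assoc)
  qed
  then show "E \<in> null_sets \<mu>" using E_sets sets by auto
qed

theorem theoremB:
  fixes A :: "real ^ 'd ^ 'd" and \<phi> :: "real \<Rightarrow> real ^ 'd"
    and l r :: nat and \<kappa> :: real and \<mu> :: "(real \<times> (real ^ 'd)) measure"
  assumes "l \<ge> 2"
    and "invertible A"
    and "spectral_radius A < 1"
    and "\<bar>det A\<bar> > 1 / real l"
    and "r \<ge> 2"
    and "real r \<ge> (real CARD('d) + 3) / 2"
    and "\<phi> \<in> Cr_circle r"
    and "\<kappa> > 0"
    and "\<phi> \<in> U_kappa r \<kappa>"
    and "derivative_dispersion l A \<phi> \<kappa>"
    and "SRB_measure (T_map l A \<phi>) \<mu>"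
  shows "absolutely_continuous lebesgue_cyl \<mu>"
proof -
  interpret solenoidal l r A \<phi> \<kappa>
    using assms by unfold_locales auto
  obtain R where R: "\<And>n. energy n \<le> ennreal R"
    using energy_bounded[OF assms(10,4,6)] by blast
  obtain m where m: "0 < m" and bound: "\<forall>f\<in>test_functions. (\<forall>z. 0 \<le> f z) \<longrightarrow> (\<forall>t>0.
      ennreal (m * (\<integral>z. f z \<partial>\<mu>)) \<le> ennreal (t / 2) * (\<integral>\<^sup>+z. ennreal ((f z)\<^sup>2) \<partial>lebesgue_cyl)
        + ennreal (1 / (2 * t)) * (bell_mass TYPE(real ^ 'd) * ennreal R))"
    using SRB_integral_bound[OF assms(11) R] by (elim exE conjE)
  show ?thesis
  proof (rule absolutely_continuous_of_energy_bound[OF _ _ m])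
    show "ennreal (m * (\<integral>z. f z \<partial>\<mu>)) \<le> ennreal (t / 2) * (\<integral>\<^sup>+z. ennreal ((f z)\<^sup>2) \<partial>lebesgue_cyl)
        + ennreal (1 / (2 * t)) * (bell_mass TYPE(real ^ 'd) * ennreal R)"
      if "f \<in> test_functions" "\<And>z. 0 \<le> f z" "0 < t" for f t
      using bspec[OF bound that(1)] that(2,3) by blast
    show "bell_mass TYPE(real ^ 'd) * ennreal R < \<infinity>"
      using bell_mass_finite[where 'a = "real ^ 'd"] by (simp add: ennreal_mult_less_top)
  qed (use assms(11) in \<open>auto simp: SRB_measure_def\<close>)
qed

end
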